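(* Let $\{\mathbf{u}^\mu\}_{\mu>0}$ be a family of periodic weak solutions of the incompressible Navier–Stokes equations with viscosity $\mu$, with common initial data $\mathbf{u}_0$ and common external force $\mathbf{f}$ (as specified in the context), and suppose that this family satisfies Assumption (K41w) (as defined in the context). Then, for any $T\in(0,\infty)$, there exist some $q>2$ and $M_T>0$, with $M_T$ depending on $\mathbf{u}_0$, $\mathbf{f}$ and $T$, and both independent of $\mu>0$, such that $$\|\mathbf{u}^\mu\|_{L^2\cap L^q([0,T)\times\mathbb{T}_P)}\le M_T<\infty .$$
   Context: Let $P>0$ and $\mathbb{T}_P=[-P/2,P/2]^3\subset\mathbb{R}^3$. A function of $\mathbf{x}\in\mathbb{R}^3$ is periodic with period $\mathbb{T}_P$ if it is invariant under $\mathbf{x}\mapsto \mathbf{x}+P\mathbf{e}_i$, $i=1,2,3$, with $(\mathbf{e}_i)$ the canonical basis. All spaces in $\mathbf{x}$ are spaces of periodic functions on $\mathbb{T}_P$. Navier–Stokes system: $\partial_t\mathbf{u}+\nabla\cdot(\mathbf{u}\otimes\mathbf{u})+\nabla p=\mu\Delta\mathbf{u}+\mathbf{f}$, $\nabla\cdot\mathbf{u}=0$ in $\mathbb{R}^3$, $\mathbf{u}|_{t=0}=\mathbf{u}_0$, where $\mathbf{u}\otimes\mathbf{u}=(u_iu_j)$, $\mathbf{u}_0\in L^2(\mathbb{T}_P)$ is periodic and $\mathbf{f}$ is periodic in $\mathbf{x}$ with $\mathbf{f}\in L^2(0,T;L^2(\mathbb{T}_P))$ for every $T>0$; $\mathbf{u}_0$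 and $\mathbf{f}$ do not depend on $\mu$. Weak solutions: for each $\mu>0$, $\mathbf{u}^\mu$ is periodic, with a corresponding periodic pressure $p^\mu$, such that for every $T>0$ the equations hold in the sense of distributions in $[0,T)\times\mathbb{R}^3$ (test functions in $C_c^\infty([0,T)\times\mathbb{R}^3)$, the initial data entering through the term at $t=0$), and: (1) $\mathbf{u}^\mu\in L^2(0,T;H^1)\cap C([0,T];L^2_w)\cap C([0,T];L^{s_1})$; (2) $\partial_t\mathbf{u}^\mu\in L^2(0,T;H^{-1})+\big(L^{s_2}(0,T;W^{-1,\frac{3s_2}{3s_2-2}})\cap L^{q'}(0,T;L^r)\big)$; (3) $p^\mu\in L^2((0,T)\times\mathbb{T}_P)+L^{s_2}(0,T;L^{\frac{3s_2}{3s_2-2}})$; (4) $\nabla p^\mu\in L^2(0,T;H^{-1})+L^{q'}(0,T;L^r)$, for $1\le s_1<2$, $1\le s_2<\infty$, $1\le q'<2$, $r=\frac{3q'}{2(2q'-1)}$; (5) in the sense of distributions in $[0,T)\times\mathbb{R}^3$, $\partial_t(\tfrac12|\mathbf{u}^\mu|^2)+\nabla\cdot\big(\mathbf{u}^\mu(\tfrac12|\mathbf{u}^\mu|^2+p^\mu)\big)+\mu|\nabla\mathbf{u}^\mu|^2-\mu\Delta(\tfrac12|\mathbf{u}^\mu|^2)\le\mathbf{f}\cdot\mathbf{u}^\mu$. Here $\mathbf{v}\in C([0,T];L^2_w)$ means $\mathbf{v}\in L^\infty(0,T;L^2(\mathbb{T}_P))$ and $\mathbf{v}$ is continuous in $t$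 with values in $L^2(\mathbb{T}_P)$ with the weak topology. In particular, for every $T>0$ there is $C'_T>0$ independent of $\mu$ with $$\|\mathbf{u}^\mu-\bar{\mathbf{u}}\|_{L^\infty(0,T;L^2(\mathbb{T}_P))}^2+\|\sqrt{\mu}\,\nabla\mathbf{u}^\mu\|^2_{L^2([0,T)\times\mathbb{T}_P)}\le C'_T\big(\|\mathbf{u}_0-\bar{\mathbf{u}}\|^2_{L^2(\mathbb{T}_P)}+\|\mathbf{f}-\bar{\mathbf{f}}\|^2_{L^2([0,T)\times\mathbb{T}_P)}\big),$$ where bars denote spatial means over $\mathbb{T}_P$ (the mean $\bar{\mathbf{u}}(t)=\frac1{|\mathbb{T}_P|}\int_{\mathbb{T}_P}\mathbf{u}_0\,d\mathbf{x}+\int_0^t\bar{\mathbf{f}}(s)\,ds$ is independent of $\mu$). Fourier coefficients: $\hat{\mathbf{u}}(t,\mathbf{k})=\frac{1}{|\mathbb{T}_P|}\int_{\mathbb{T}_P}\mathbf{u}(t,\mathbf{x})e^{-i\mathbf{k}\cdot\mathbf{x}}d\mathbf{x}$ for $\mathbf{k}\in\frac{2\pi}{P}\mathbb{Z}^3$. Assumption (K41w): there is some $\beta>0$, independent of $\mu$, such that for any $T>0$ there exist $C_T>0$ and $k_*$ (sufficiently large), depending on $\mathbf{u}_0$ and $\mathbf{f}$ but independent of the viscosity $\mu$, such that for all $\mu>0$ $$\sup_{|\mathbf{k}|\ge k_*}\Big(|\mathbf{k}|^{3+\beta}\int_0^T|\hat{\mathbf{u}}^\mu(t,\mathbf{k})|^2dt\Big)\le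 C_T .$$ *)

theory Defs
  imports "HOL-Analysis.Analysis"
begin

type_synonym space = "real ^ 3"

section \<open>Periodicity, the period cell and Lebesgue spaces\<close>

definition periodic :: "real \<Rightarrow> (space \<Rightarrow> 'b) \<Rightarrow> bool" where
  "periodic P g \<longleftrightarrow> (\<forall>x i. g (x + P *\<^sub>R axis i 1) = g x)"

definition torus :: "real \<Rightarrow> space set" where
  "torus P = cbox (vec (- P / 2)) (vec (P / 2))"

abbreviation torus_measure :: "real \<Rightarrow> space measure" where
  "torus_measure P \<equiv> lebesgue_on (torus P)"

abbreviation time_measure :: "real \<Rightarrow> real measure" where
  "time_measure T \<equiv> lebesgue_on {0<..<T}"

definition in_Lp :: "real \<Rightarrow> 'a measure \<Rightarrow> ('a \<Rightarrow> 'b::real_normed_vector) \<Rightarrow> bool" where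
  "in_Lp s M g \<longleftrightarrow> g \<in> borel_measurable M \<and> integrable M (\<lambda>x. norm (g x) powr s)"

definition Lp_norm :: "real \<Rightarrow> 'a measure \<Rightarrow> ('a \<Rightarrow> 'b::real_normed_vector) \<Rightarrow> real" where
  "Lp_norm s M g = (\<integral>x. norm (g x) powr s \<partial>M) powr (1 / s)"

text \<open>The space \<open>L\<^sup>s(0,T; L\<^sup>m)\<close>. Since \<open>L\<^sup>m\<close> is separable for \<open>m < \<infinity>\<close>, strong measurability in
  time amounts to joint measurability of a representative.\<close>

definition in_Lp_Lp :: "real \<Rightarrow> real \<Rightarrow> real \<Rightarrow> real \<Rightarrow> (real \<Rightarrow> space \<Rightarrow> 'b::real_normed_vector) \<Rightarrow> bool" where
  "in_Lp_Lp P T s m g \<longleftrightarrow>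
     (\<lambda>(t, x). g t x) \<in> borel_measurable (lebesgue_on ({0<..<T} \<times> torus P)) \<and>
     (AE t in time_measure T. in_Lp m (torus_measure P) (g t)) \<and>
     in_Lp s (time_measure T) (\<lambda>t. Lp_norm m (torus_measure P) (g t))"

section \<open>Test functions\<close>

primrec Ck :: "nat \<Rightarrow> ('a::euclidean_space \<Rightarrow> 'b::real_normed_vector) \<Rightarrow> bool" where
  "Ck 0 g = continuous_on UNIV g"
| "Ck (Suc k) g =
     ((\<forall>x. g differentiable (at x)) \<and>
      (\<forall>v\<in>Basis. Ck k (\<lambda>x. frechet_derivative g (at x) v)))"

definition smooth :: "('a::euclidean_space \<Rightarrow> 'b::real_normed_vector) \<Rightarrow> bool" where
  "smooth g \<longleftrightarrow> (\<forall>k. Ck k g)"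

definition test_function :: "'a::euclidean_space set \<Rightarrow> ('a \<Rightarrow> real) \<Rightarrow> bool" where
  "test_function S \<phi> \<longleftrightarrow>
     smooth \<phi> \<and> compact (closure {z. \<phi> z \<noteq> 0}) \<and> closure {z. \<phi> z \<noteq> 0} \<subseteq> S"

text \<open>\<open>C\<^sub>c\<^sup>\<infinity>([0,T) \<times> \<real>\<^sup>3)\<close> consists of the restrictions to \<open>t \<ge> 0\<close> of the functions below; their support
  may reach the initial time, but not the time \<open>T\<close>.\<close>

abbreviation spacetime_test :: "real \<Rightarrow> (real \<times> space \<Rightarrow> real) \<Rightarrow> bool" where
  "spacetime_test T \<equiv> test_function ({..<T} \<times> UNIV)"

definition dt :: "(real \<times> space \<Rightarrow> real) \<Rightarrow> real \<times> space \<Rightarrow> real" where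
  "dt \<phi> z = frechet_derivative \<phi> (at z) (1, 0)"

definition dx :: "3 \<Rightarrow> (real \<times> space \<Rightarrow> real) \<Rightarrow> real \<times> space \<Rightarrow> real" where
  "dx i \<phi> z = frechet_derivative \<phi> (at z) (0, axis i 1)"

definition grad :: "(real \<times> space \<Rightarrow> real) \<Rightarrow> real \<times> space \<Rightarrow> space" where
  "grad \<phi> z = (\<chi> i. dx i \<phi> z)"

definition lap :: "(real \<times> space \<Rightarrow> real) \<Rightarrow> real \<times> space \<Rightarrow> real" where
  "lap \<phi> z = (\<Sum>i\<in>UNIV. dx i (dx i \<phi>) z)"

section \<open>Periodic Sobolev spaces\<close>

text \<open>The matrix \<open>G x\<close> has the entries \<open>G x $ i $ j = \<partial>\<^sub>j v\<^sub>i\<close>, the derivatives being taken in the sense of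
  distributions in \<open>\<real>\<^sup>3\<close>.\<close>

definition has_weak_gradient :: "real \<Rightarrow> (space \<Rightarrow> space) \<Rightarrow> (space \<Rightarrow> real ^ 3 ^ 3) \<Rightarrow> bool" where
  "has_weak_gradient P v G \<longleftrightarrow>
     periodic P v \<and> periodic P G \<and>
     integrable (torus_measure P) v \<and> integrable (torus_measure P) G \<and>
     (\<forall>\<phi> j. test_function UNIV \<phi> \<longrightarrow>
        (\<integral>x. frechet_derivative \<phi> (at x) (axis j 1) *\<^sub>R v x \<partial>lebesgue) =
        - (\<integral>x. \<phi> x *\<^sub>R column j (G x) \<partial>lebesgue))"

definition in_W1 :: "real \<Rightarrow> real \<Rightarrow> (space \<Rightarrow> space) \<Rightarrow> (space \<Rightarrow> real ^ 3 ^ 3) \<Rightarrow> bool" where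
  "in_W1 P m v G \<longleftrightarrow>
     has_weak_gradient P v G \<and> in_Lp m (torus_measure P) v \<and> in_Lp m (torus_measure P) G"

definition W1_norm :: "real \<Rightarrow> real \<Rightarrow> (space \<Rightarrow> space) \<Rightarrow> (space \<Rightarrow> real ^ 3 ^ 3) \<Rightarrow> real" where
  "W1_norm P m v G =
     (Lp_norm m (torus_measure P) v powr m + Lp_norm m (torus_measure P) G powr m) powr (1 / m)"

text \<open>\<open>L\<^sup>2(0,T; H\<^sup>1)\<close>, with the weak gradient as an explicit argument (it is unique almost everywhere).\<close>

definition in_L2_H1 :: "real \<Rightarrow> real \<Rightarrow> (real \<Rightarrow> space \<Rightarrow> space) \<Rightarrow> (real \<Rightarrow> space \<Rightarrow> real ^ 3 ^ 3) \<Rightarrow> bool" where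
  "in_L2_H1 P T v G \<longleftrightarrow>
     (AE t in time_measure T. in_W1 P 2 (v t) (G t)) \<and>
     in_Lp_Lp P T 2 2 v \<and> in_Lp_Lp P T 2 2 G"

text \<open>For \<open>1 < m < \<infinity>\<close>, \<open>W\<^sup>-\<^sup>1\<^sup>,\<^sup>m\<close> is the dual of \<open>W\<^sup>1\<^sup>,\<^sup>m\<^sup>'\<close> with \<open>m' = m / (m - 1)\<close>; \<open>H\<^sup>-\<^sup>1\<close> is the case \<open>m = 2\<close>.
  A functional acts on representatives; boundedness makes its value independent of the choice of
  the representative.\<close>

definition in_W_neg1 :: "real \<Rightarrow> real \<Rightarrow> ((space \<Rightarrow> space) \<Rightarrow> real) \<Rightarrow> bool" where
  "in_W_neg1 P m \<Lambda> \<longleftrightarrow>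
     (\<forall>v G w H a b. in_W1 P (m / (m - 1)) v G \<and> in_W1 P (m / (m - 1)) w H \<longrightarrow>
        \<Lambda> (\<lambda>x. a *\<^sub>R v x + b *\<^sub>R w x) = a * \<Lambda> v + b * \<Lambda> w) \<and>
     (\<exists>c. \<forall>v G. in_W1 P (m / (m - 1)) v G \<longrightarrow> \<bar>\<Lambda> v\<bar> \<le> c * W1_norm P (m / (m - 1)) v G)"

definition W_neg1_norm :: "real \<Rightarrow> real \<Rightarrow> ((space \<Rightarrow> space) \<Rightarrow> real) \<Rightarrow> real" where
  "W_neg1_norm P m \<Lambda> =
     Sup {\<bar>\<Lambda> v\<bar> |v G. in_W1 P (m / (m - 1)) v G \<and> W1_norm P (m / (m - 1)) v G \<le> 1}"

text \<open>\<open>L\<^sup>s(0,T; W\<^sup>-\<^sup>1\<^sup>,\<^sup>m)\<close>. The dual is separable and reflexive for \<open>1 < m < \<infinity>\<close>, so strong measurability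
  is measurability of the pairing with each element of the predual.\<close>

definition in_Lp_W_neg1 :: "real \<Rightarrow> real \<Rightarrow> real \<Rightarrow> real \<Rightarrow> (real \<Rightarrow> (space \<Rightarrow> space) \<Rightarrow> real) \<Rightarrow> bool" where
  "in_Lp_W_neg1 P T s m \<Lambda> \<longleftrightarrow>
     (AE t in time_measure T. in_W_neg1 P m (\<Lambda> t)) \<and>
     (\<forall>v G. in_W1 P (m / (m - 1)) v G \<longrightarrow> (\<lambda>t. \<Lambda> t v) \<in> borel_measurable (time_measure T)) \<and>
     in_Lp s (time_measure T) (\<lambda>t. W_neg1_norm P m (\<Lambda> t))"

abbreviation smooth_periodic :: "real \<Rightarrow> (space \<Rightarrow> space) \<Rightarrow> bool" where
  "smooth_periodic P \<psi> \<equiv> smooth \<psi> \<and> periodic P \<psi>"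

section \<open>Regularity classes of the solutions\<close>

definition in_C_L2w :: "real \<Rightarrow> real \<Rightarrow> (real \<Rightarrow> space \<Rightarrow> space) \<Rightarrow> bool" where
  "in_C_L2w P T v \<longleftrightarrow>
     (\<forall>t\<in>{0..T}. in_Lp 2 (torus_measure P) (v t)) \<and>
     (\<exists>B. AE t in time_measure T. Lp_norm 2 (torus_measure P) (v t) \<le> B) \<and>
     (\<forall>w::space \<Rightarrow> space. in_Lp 2 (torus_measure P) w \<longrightarrow>
        continuous_on {0..T} (\<lambda>t. \<integral>x. v t x \<bullet> w x \<partial>torus_measure P))"

definition in_C_Lp :: "real \<Rightarrow> real \<Rightarrow> real \<Rightarrow> (real \<Rightarrow> space \<Rightarrow> space) \<Rightarrow> bool" where
  "in_C_Lp P T s v \<longleftrightarrow>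
     (\<forall>t\<in>{0..T}. in_Lp s (torus_measure P) (v t)) \<and>
     (\<forall>t\<in>{0..T}. ((\<lambda>\<tau>. Lp_norm s (torus_measure P) (\<lambda>x. v \<tau> x - v t x)) \<longlongrightarrow> 0) (at t within {0..T}))"

text \<open>\<open>\<partial>\<^sub>t v \<in> L\<^sup>2(0,T; H\<^sup>-\<^sup>1) + (L\<^sup>s(0,T; W\<^sup>-\<^sup>1\<^sup>,\<^sup>m) \<inter> L\<^sup>q(0,T; L\<^sup>r))\<close>. The element of the intersection is given both
  as a functional \<open>B\<close> and as a function \<open>b\<close>; the pairing of \<open>b\<close> with a general element of \<open>W\<^sup>1\<^sup>,\<^sup>m\<^sup>'\<close> need not
  be an absolutely convergent integral, so they are identified on smooth fields.\<close>

definition time_derivative_class ::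
  "real \<Rightarrow> real \<Rightarrow> real \<Rightarrow> real \<Rightarrow> real \<Rightarrow> real \<Rightarrow> (real \<Rightarrow> space \<Rightarrow> space) \<Rightarrow> bool" where
  "time_derivative_class P T s m q r v \<longleftrightarrow>
     (\<exists>A B b. in_Lp_W_neg1 P T 2 2 A \<and>
        in_Lp_W_neg1 P T s m B \<and>
        (\<forall>t. periodic P (b t)) \<and> in_Lp_Lp P T q r b \<and>
        (AE t in time_measure T. \<forall>\<psi>. smooth_periodic P \<psi> \<longrightarrow>
           B t \<psi> = (\<integral>x. b t x \<bullet> \<psi> x \<partial>torus_measure P)) \<and>
        (\<forall>\<theta> \<psi>. test_function {0<..<T} \<theta> \<and> smooth_periodic P \<psi> \<longrightarrow>
           - (\<integral>t. deriv \<theta> t * (\<integral>x. v t x \<bullet> \<psi> x \<partial>torus_measure P) \<partial>time_measure T) =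
           (\<integral>t. \<theta> t * (A t \<psi> + B t \<psi>) \<partial>time_measure T)))"

text \<open>\<open>\<pi> \<in> L\<^sup>2((0,T) \<times> \<bbbT>\<^sub>P) + L\<^sup>s(0,T; L\<^sup>m)\<close>\<close>

definition pressure_class ::
  "real \<Rightarrow> real \<Rightarrow> real \<Rightarrow> real \<Rightarrow> (real \<Rightarrow> space \<Rightarrow> real) \<Rightarrow> bool" where
  "pressure_class P T s m \<pi> \<longleftrightarrow>
     (\<exists>\<pi>1 \<pi>2. (\<forall>t. periodic P (\<pi>1 t) \<and> periodic P (\<pi>2 t)) \<and>
        in_Lp 2 (lebesgue_on ({0<..<T} \<times> torus P)) (\<lambda>(t, x). \<pi>1 t x) \<and>
        in_Lp_Lp P T s m \<pi>2 \<and>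
        (AE (t, x) in lebesgue_on ({0<..<T} \<times> torus P). \<pi> t x = \<pi>1 t x + \<pi>2 t x))"

text \<open>\<open>\<nabla>\<pi> \<in> L\<^sup>2(0,T; H\<^sup>-\<^sup>1) + L\<^sup>q(0,T; L\<^sup>r)\<close>; the trace below is the divergence of \<open>\<psi>\<close>.\<close>

definition pressure_gradient_class ::
  "real \<Rightarrow> real \<Rightarrow> real \<Rightarrow> real \<Rightarrow> (real \<Rightarrow> space \<Rightarrow> real) \<Rightarrow> bool" where
  "pressure_gradient_class P T q r \<pi> \<longleftrightarrow>
     (\<exists>A b. in_Lp_W_neg1 P T 2 2 A \<and>
        (\<forall>t. periodic P (b t)) \<and> in_Lp_Lp P T q r b \<and>
        (AE t in time_measure T. \<forall>\<psi>. smooth_periodic P \<psi> \<longrightarrow>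
           - (\<integral>x. \<pi> t x * trace (matrix (frechet_derivative \<psi> (at x))) \<partial>torus_measure P) =
           A t \<psi> + (\<integral>x. b t x \<bullet> \<psi> x \<partial>torus_measure P)))"

section \<open>Weak solutions of the Navier--Stokes system\<close>

definition momentum_equation ::
  "real \<Rightarrow> real \<Rightarrow> (space \<Rightarrow> space) \<Rightarrow> (real \<Rightarrow> space \<Rightarrow> space) \<Rightarrow>
   (real \<Rightarrow> space \<Rightarrow> space) \<Rightarrow> (real \<Rightarrow> space \<Rightarrow> real) \<Rightarrow> bool" where
  "momentum_equation T \<mu> u0 f v \<pi> \<longleftrightarrow>
     (\<forall>\<phi>. spacetime_test T \<phi> \<longrightarrow>
        - (\<integral>(t, x). dt \<phi> (t, x) *\<^sub>R v t x + (v t x \<bullet> grad \<phi> (t, x)) *\<^sub>R v t x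
                 + \<pi> t x *\<^sub>R grad \<phi> (t, x) \<partial>lebesgue_on ({0..<T} \<times> UNIV))
        - (\<integral>x. \<phi> (0, x) *\<^sub>R u0 x \<partial>lebesgue) =
        (\<integral>(t, x). (\<mu> * lap \<phi> (t, x)) *\<^sub>R v t x + \<phi> (t, x) *\<^sub>R f t x \<partial>lebesgue_on ({0..<T} \<times> UNIV)))"

definition divergence_free :: "real \<Rightarrow> (real \<Rightarrow> space \<Rightarrow> space) \<Rightarrow> bool" where
  "divergence_free T v \<longleftrightarrow>
     (\<forall>\<phi>. spacetime_test T \<phi> \<longrightarrow>
        (\<integral>(t, x). v t x \<bullet> grad \<phi> (t, x) \<partial>lebesgue_on ({0..<T} \<times> UNIV)) = 0)"

text \<open>The energy flux has to be locally integrable to define a distribution. For functions in the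
  regularity classes of a weak solution this is automatic; the other terms are products of functions
  in \<open>L\<^sup>2\<close>.\<close>

definition local_energy_inequality ::
  "real \<Rightarrow> real \<Rightarrow> real \<Rightarrow> (space \<Rightarrow> space) \<Rightarrow> (real \<Rightarrow> space \<Rightarrow> space) \<Rightarrow>
   (real \<Rightarrow> space \<Rightarrow> space) \<Rightarrow> (real \<Rightarrow> space \<Rightarrow> real ^ 3 ^ 3) \<Rightarrow> (real \<Rightarrow> space \<Rightarrow> real) \<Rightarrow> bool" where
  "local_energy_inequality P T \<mu> u0 f v G \<pi> \<longleftrightarrow>
     integrable (lebesgue_on ({0..<T} \<times> torus P))
       (\<lambda>(t, x). ((norm (v t x))\<^sup>2 / 2 + \<pi> t x) *\<^sub>R v t x) \<and>
     (\<forall>\<phi>. spacetime_test T \<phi> \<and> (\<forall>z. 0 \<le> \<phi> z) \<longrightarrow>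
        (\<integral>(t, x). - ((norm (v t x))\<^sup>2 / 2 * dt \<phi> (t, x))
                 - ((norm (v t x))\<^sup>2 / 2 + \<pi> t x) * (v t x \<bullet> grad \<phi> (t, x))
                 + \<mu> * (norm (G t x))\<^sup>2 * \<phi> (t, x)
                 - \<mu> * ((norm (v t x))\<^sup>2 / 2) * lap \<phi> (t, x) \<partial>lebesgue_on ({0..<T} \<times> UNIV))
        - (\<integral>x. (norm (u0 x))\<^sup>2 / 2 * \<phi> (0, x) \<partial>lebesgue)
        \<le> (\<integral>(t, x). (f t x \<bullet> v t x) * \<phi> (t, x) \<partial>lebesgue_on ({0..<T} \<times> UNIV)))"

definition NS_weak_solution ::
  "real \<Rightarrow> real \<Rightarrow> (space \<Rightarrow> space) \<Rightarrow> (real \<Rightarrow> space \<Rightarrow> space) \<Rightarrow>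
   (real \<Rightarrow> space \<Rightarrow> space) \<Rightarrow> (real \<Rightarrow> space \<Rightarrow> real) \<Rightarrow> bool" where
  "NS_weak_solution P \<mu> u0 f v \<pi> \<longleftrightarrow>
     (\<forall>t\<ge>0. periodic P (v t) \<and> periodic P (\<pi> t)) \<and>
     (\<forall>T>0.
        momentum_equation T \<mu> u0 f v \<pi> \<and>
        divergence_free T v \<and>
        (\<exists>G. (\<forall>t\<ge>0. periodic P (G t)) \<and> in_L2_H1 P T v G \<and>
             local_energy_inequality P T \<mu> u0 f v G \<pi>) \<and>
        in_C_L2w P T v \<and>
        (\<forall>s1. 1 \<le> s1 \<and> s1 < 2 \<longrightarrow> in_C_Lp P T s1 v) \<and>
        (\<forall>s2 q'. 1 \<le> s2 \<and> 1 \<le> q' \<and> q' < 2 \<longrightarrow>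
           time_derivative_class P T s2 (3 * s2 / (3 * s2 - 2)) q' (3 * q' / (2 * (2 * q' - 1))) v) \<and>
        (\<forall>s2\<ge>1. pressure_class P T s2 (3 * s2 / (3 * s2 - 2)) \<pi>) \<and>
        (\<forall>q'. 1 \<le> q' \<and> q' < 2 \<longrightarrow>
           pressure_gradient_class P T q' (3 * q' / (2 * (2 * q' - 1))) \<pi>))"

section \<open>The weak Kolmogorov hypothesis\<close>

definition wavevectors :: "real \<Rightarrow> space set" where
  "wavevectors P = range (\<lambda>n::int ^ 3. (2 * pi / P) *\<^sub>R (\<chi> i. real_of_int (n $ i)))"

definition fourier_coeff :: "real \<Rightarrow> (space \<Rightarrow> space) \<Rightarrow> space \<Rightarrow> complex ^ 3" where
  "fourier_coeff P v k =
     (\<chi> i. (1 / of_real (measure lebesgue (torus P))) *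
       (\<integral>x. of_real (v x $ i) * exp (- (\<i> * of_real (k \<bullet> x))) \<partial>torus_measure P))"

definition K41w :: "real \<Rightarrow> (real \<Rightarrow> real \<Rightarrow> space \<Rightarrow> space) \<Rightarrow> bool" where
  "K41w P u \<longleftrightarrow>
     (\<exists>\<beta>>0. \<forall>T>0. \<exists>C>0. \<exists>kstar>0. \<forall>\<mu>>0.
        \<forall>k\<in>wavevectors P. norm k \<ge> kstar \<longrightarrow>
          norm k powr (3 + \<beta>) *
            (\<integral>t. (norm (fourier_coeff P (u \<mu> t) k))\<^sup>2 \<partial>time_measure T) \<le> C)"

section \<open>The intersection of Lebesgue spaces\<close>

definition in_L2_Lq :: "real \<Rightarrow> 'a measure \<Rightarrow> ('a \<Rightarrow> 'b::real_normed_vector) \<Rightarrow> bool" where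
  "in_L2_Lq q M g \<longleftrightarrow> in_Lp 2 M g \<and> in_Lp q M g"

definition L2_Lq_norm :: "real \<Rightarrow> 'a measure \<Rightarrow> ('a \<Rightarrow> 'b::real_normed_vector) \<Rightarrow> real" where
  "L2_Lq_norm q M g = max (Lp_norm 2 M g) (Lp_norm q M g)"

end

theory Submission
  imports Defs
begin

text \<open>Testing the local energy inequality with \<open>e\<^sup>-\<^sup>t \<eta>(t) w(x\<^sub>1) w(x\<^sub>2) w(x\<^sub>3)\<close>, where \<open>w\<close> is the moving
  average of a bump over one period, bounds \<open>\<parallel>u\<^sup>\<mu>(t)\<parallel>\<close> in \<open>L\<^sup>2\<close> uniformly in \<open>t\<close> and \<open>\<mu>\<close>. This bounds
  the Fourier modes below a frequency \<open>N\<close> pointwise by a multiple of \<open>N\<^sup>3\<close>. The Kolmogorov hypothesis and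
  Parseval's identity bound the modes above \<open>N\<close> in \<open>L\<^sup>2\<close> of space-time, squared, by a multiple of
  \<open>N\<^bsup>-\<beta>/2\<^esup>\<close>. Where \<open>\<bar>u\<^sup>\<mu>\<bar>\<close> is about \<open>N\<^sup>3\<close> the high modes carry at least half of it, so the integral of
  \<open>\<bar>u\<^sup>\<mu>\<bar>\<^bsup>2+r\<^esup>\<close> over this set is at most a multiple of \<open>N\<^bsup>3r-\<beta>/2\<^esup>\<close>, which is summable over dyadic \<open>N\<close>
  for \<open>3r < \<beta>/2\<close>.\<close>

section \<open>Smooth test functions\<close>

text \<open>The hypothesis bounds every Fourier mode separately and only after integration in time,
  so at a fixed time nothing but the energy controls the low modes. Bounds on the gradient do not
  help, since they degenerate as \<mu> tends to 0. The power 3 + \<beta> exceeds the dimension,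
  which makes the mode-by-mode bounds summable over the lattice. The gain in integrability depends
  on \<beta> alone, hence is the same for all T.

  A compactly supported cutoff in space would normally leave flux terms of unknown size at its edge.
  The derivative of the moving average is b(s + P) - b(s), which integrates to zero against a
  periodic function, so the local inequality on the whole space acts like a global one on the torus,
  and the pressure enters only through the integrability of the flux. The factor exp(-t) is
  Gronwall's argument built into the test function: its derivative absorbs the part of the forcing
  term that is quadratic in the solution. Testing yields averages of the energy over short time
  windows; weak continuity turns them into a bound at each time.\<close>

lemma Ck_Suc_D: "Ck (Suc k) g \<Longrightarrow> Ck k g"
proof (induction k arbitrary: g)
  case 0
  then show ?case
    by (auto simp: continuous_on_eq_continuous_within intro: differentiable_imp_continuous_within)
next
  case (Suc k)
  then show ?case by simp
qed

lemma Ck_const: "Ck k (\<lambda>x. c)"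
  by (induction k arbitrary: c) auto

lemma Ck_add: "Ck k g \<Longrightarrow> Ck k h \<Longrightarrow> Ck k (\<lambda>x. g x + h x)"
proof (induction k arbitrary: g h)
  case 0
  then show ?case by (auto intro: continuous_intros)
next
  case (Suc k)
  have "frechet_derivative (\<lambda>x. g x + h x) (at x)
      = (\<lambda>v. frechet_derivative g (at x) v + frechet_derivative h (at x) v)" for x
    by (rule frechet_derivative_at[symmetric], rule has_derivative_add)
      (use Suc.prems in \<open>auto simp: frechet_derivative_works\<close>)
  with Suc show ?case by simp
qed

lemma Ck_mult:
  fixes g h :: "'a::euclidean_space \<Rightarrow> real"
  shows "Ck k g \<Longrightarrow> Ck k h \<Longrightarrow> Ck k (\<lambda>x. g x * h x)"
proof (induction k arbitrary: g h)
  case 0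
  then show ?case by (auto intro: continuous_intros)
next
  case (Suc k)
  have "frechet_derivative (\<lambda>x. g x * h x) (at x)
      = (\<lambda>v. g x * frechet_derivative h (at x) v + frechet_derivative g (at x) v * h x)" for x
    by (rule frechet_derivative_at[symmetric], rule has_derivative_mult)
      (use Suc.prems in \<open>auto simp: frechet_derivative_works\<close>)
  then show ?case
    using Suc Ck_Suc_D[OF Suc.prems(1)] Ck_Suc_D[OF Suc.prems(2)]
    by (auto intro!: Ck_add)
qed

text \<open>As the outer function has one real variable, each directional derivative of the
  composite is a composite of the same kind, with the derivative of \<open>g\<close> outside, times
  the constant \<open>L v\<close>. This closes the induction.\<close>

lemma Ck_compose_affine:
  fixes g :: "real \<Rightarrow> real" and L :: "'a::euclidean_space \<Rightarrow> real"
  assumes L: "bounded_linear L"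
  shows "Ck k g \<Longrightarrow> Ck k (\<lambda>x. g (L x + c))"
proof (induction k arbitrary: g)
  case 0
  then show ?case
    using continuous_on_compose2[of UNIV g UNIV "\<lambda>x. L x + c"]
      continuous_on_add[OF linear_continuous_on[OF L] continuous_on_const, of UNIV c] by simp
next
  case (Suc k)
  have d: "((\<lambda>x. g (L x + c)) has_derivative (\<lambda>v. frechet_derivative g (at (L x + c)) (L v))) (at x)" for x
  proof -
    have "(g has_derivative frechet_derivative g (at (L x + c))) (at (L x + c))"
      using Suc.prems by (auto simp: frechet_derivative_works)
    moreover have "((\<lambda>x. L x + c) has_derivative L) (at x)"
      using has_derivative_add[OF bounded_linear_imp_has_derivative[OF L] has_derivative_const] by simp
    ultimately show ?thesis
      using diff_chain_at[of "\<lambda>x. L x + c" L x g] by (simp add: o_def)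
  qed
  have lin: "frechet_derivative g (at y) (L v) = frechet_derivative g (at y) 1 * L v" for y v
  proof -
    have "linear (frechet_derivative g (at y))"
      using Suc.prems by (auto intro: linear_frechet_derivative)
    then show ?thesis
      using linear_scale[of "frechet_derivative g (at y)" "L v" 1] by (simp add: mult.commute)
  qed
  have "Ck k (\<lambda>x. frechet_derivative g (at (L x + c)) 1)"
    using Suc.IH[of "\<lambda>y. frechet_derivative g (at y) 1"] Suc.prems by simp
  then have "Ck k (\<lambda>x. frechet_derivative g (at (L x + c)) 1 * L v)" for v
    by (intro Ck_mult Ck_const)
  then show ?case
    using d by (auto simp: lin differentiable_def frechet_derivative_at[OF d, symmetric])
qed

lemma smooth_mult: "smooth g \<Longrightarrow> smooth h \<Longrightarrow> smooth (\<lambda>x. g x * h x)"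
  for g h :: "'a::euclidean_space \<Rightarrow> real"
  by (simp add: smooth_def Ck_mult)

lemma smooth_compose_affine:
  fixes g :: "real \<Rightarrow> real" and L :: "'a::euclidean_space \<Rightarrow> real"
  shows "bounded_linear L \<Longrightarrow> smooth g \<Longrightarrow> smooth (\<lambda>x. g (L x + c))"
  by (simp add: smooth_def Ck_compose_affine)

lemma smooth_prod:
  fixes g :: "'i \<Rightarrow> 'a::euclidean_space \<Rightarrow> real"
  shows "(\<And>i. i \<in> I \<Longrightarrow> smooth (g i)) \<Longrightarrow> smooth (\<lambda>x. \<Prod>i\<in>I. g i x)"
  by (induction I rule: infinite_finite_induct)
    (auto simp: smooth_mult smooth_def[of "\<lambda>_. 1"] Ck_const)

lemma Ck_Suc_real:
  fixes g :: "real \<Rightarrow> real"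
  assumes "\<And>x. (g has_real_derivative g' x) (at x)"
  shows "Ck (Suc k) g \<longleftrightarrow> Ck k g'"
proof -
  have "frechet_derivative g (at x) = (*) (g' x)" for x
    by (rule frechet_derivative_at[symmetric])
      (use assms in \<open>simp add: has_field_derivative_def\<close>)
  moreover have "g differentiable at x" for x
    using assms real_differentiable_def by blast
  ultimately show ?thesis by simp
qed

text \<open>Needed in both directions: to differentiate smooth functions, and to recognise a moving
  average as smooth when only its derivative is explicit.\<close>

lemma smooth_antiderivative:
  fixes g :: "real \<Rightarrow> real"
  assumes "\<And>x. (g has_real_derivative g' x) (at x)"
  shows "smooth g \<longleftrightarrow> smooth g'"
proof
  assume "smooth g"
  then show "smooth g'"
    by (metis smooth_def Ck_Suc_real[OF assms])
next
  assume s: "smooth g'"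
  show "smooth g"
    unfolding smooth_def
  proof
    fix k show "Ck k g"
    using s by (cases k) (metis smooth_def Ck_Suc_real[OF assms] Ck_Suc_D)+
  qed
qed

lemma smooth_imp_continuous: "smooth g \<Longrightarrow> continuous_on S g"
  unfolding smooth_def by (metis Ck.simps(1) continuous_on_subset subset_UNIV)

lemma smooth_real_deriv:
  fixes g :: "real \<Rightarrow> real"
  assumes "smooth g"
  shows "(g has_real_derivative deriv g x) (at x)" "smooth (deriv g)"
proof -
  have "Ck (Suc 0) g" using assms smooth_def by blast
  then have *: "(g has_real_derivative deriv g x) (at x)" for x
    using DERIV_deriv_iff_real_differentiable by auto
  show "(g has_real_derivative deriv g x) (at x)" by (rule *)
  show "smooth (deriv g)" using smooth_antiderivative[OF *] assms by simp
qed

lemma smooth_exp_minus: "smooth (\<lambda>t::real. exp (- t))"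
proof -
  \<comment> \<open>The factor \<open>c\<close> absorbs the sign that each differentiation
    produces.\<close>
  have "Ck k (\<lambda>t::real. c * exp (- t))" for k c
  proof (induction k arbitrary: c)
    case 0
    then show ?case by (auto intro!: continuous_intros)
  next
    case (Suc k)
    have "Ck (Suc k) (\<lambda>t::real. c * exp (- t)) \<longleftrightarrow> Ck k (\<lambda>t::real. (- c) * exp (- t))"
      by (rule Ck_Suc_real) (auto intro!: derivative_eq_intros)
    with Suc show ?case by blast
  qed
  from this[of _ 1] show ?thesis by (simp add: smooth_def)
qed

text \<open>The functions \<open>p(1/x) e\<^bsup>-1/x\<^esup>\<close>, extended by \<open>0\<close> to \<open>x \<le> 0\<close>, are closed under differentiation,
  with \<open>p(y)\<close> turning into \<open>y\<^sup>2 (p(y) - p'(y))\<close>.\<close>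

definition flat :: "real poly \<Rightarrow> real \<Rightarrow> real" where
  "flat p x = (if x > 0 then poly p (1 / x) * exp (- (1 / x)) else 0)"

lemma poly_times_exp_minus_tendsto_0: "((\<lambda>y. poly p y * exp (- y)) \<longlongrightarrow> 0) at_top" for p :: "real poly"
proof -
  have "((\<lambda>y. coeff p i * (y ^ i / exp y)) \<longlongrightarrow> coeff p i * 0) at_top" for i
    by (intro tendsto_mult tendsto_const tendsto_power_div_exp_0)
  then have "((\<lambda>y. \<Sum>i\<le>degree p. coeff p i * (y ^ i / exp y)) \<longlongrightarrow> (\<Sum>i\<le>degree p. coeff p i * 0)) at_top"
    by (intro tendsto_sum)
  then show ?thesis
    by (simp add: poly_altdef exp_minus sum_distrib_right divide_inverse mult.assoc)
qed

lemma flat_deriv: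
  "(flat p has_real_derivative flat (monom 1 2 * (p - pderiv p)) x) (at x)"
proof -
  consider "x > 0" | "x < 0" | "x = 0" by linarith
  then show ?thesis
  proof cases
    case 1
    have "((\<lambda>x. poly p (1 / x) * exp (- (1 / x))) has_real_derivative
        flat (monom 1 2 * (p - pderiv p)) x) (at x)"
      using 1 by (auto intro!: derivative_eq_intros DERIV_chain2[OF poly_DERIV]
          simp: flat_def poly_monom power2_eq_square field_simps)
    moreover have "eventually (\<lambda>y. flat p y = poly p (1 / y) * exp (- (1 / y))) (nhds x)"
      using eventually_nhds_in_open[of "{0<..}" x] 1
      by (auto elim!: eventually_mono simp: flat_def)
    ultimately show ?thesis
      by (simp add: DERIV_cong_ev)
  next
    case 2
    have "eventually (\<lambda>y. flat p y = 0) (nhds x)"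
      using eventually_nhds_in_open[of "{..<0}" x] 2
      by (auto elim!: eventually_mono simp: flat_def)
    then have "(flat p has_real_derivative 0) (at x)"
      using DERIV_cong_ev[OF refl _ refl, of "flat p" "\<lambda>_. 0" x 0] by simp
    then show ?thesis using 2 by (simp add: flat_def)
  next
    case 3
    \<comment> \<open>With y = 1 / h, the right difference quotient at 0 is y p(y) exp(-y); the
      extra monomial is the division by h.\<close>
    have "((\<lambda>y. poly (monom 1 1 * p) y * exp (- y)) \<longlongrightarrow> 0) at_top"
      by (rule poly_times_exp_minus_tendsto_0)
    then have "((\<lambda>h. poly (monom 1 1 * p) (inverse h) * exp (- inverse h)) \<longlongrightarrow> 0) (at_right 0)"
      by (rule filterlim_compose) (rule filterlim_inverse_at_top_right)
    then have "((\<lambda>h. flat p h / h) \<longlongrightarrow> 0) (at_right 0)"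
      by (rule Lim_transform_eventually)
        (auto simp: eventually_at_filter flat_def poly_monom field_simps intro: always_eventually)
    moreover have "((\<lambda>h. flat p h / h) \<longlongrightarrow> 0) (at_left 0)"
      by (rule Lim_transform_eventually[OF tendsto_const])
        (auto simp: eventually_at_filter flat_def)
    ultimately have "((\<lambda>h. flat p h / h) \<longlongrightarrow> 0) (at 0)"
      by (simp add: filterlim_at_split)
    then show ?thesis
      using 3 by (simp add: has_field_derivative_iff flat_def)
  qed
qed

lemma smooth_flat: "smooth (flat p)"
proof -
  have "Ck k (flat p)" for k
  proof (induction k arbitrary: p)
    case 0
    show ?case
      unfolding Ck.simps using DERIV_isCont[OF flat_deriv]
      by (intro continuous_at_imp_continuous_on) auto
  next
    case (Suc k)
    then show ?case using Ck_Suc_real[OF flat_deriv] by blast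
  qed
  then show ?thesis by (simp add: smooth_def)
qed

section \<open>Bumps and their moving averages\<close>

lemma smooth_bump:
  fixes a b :: real
  obtains \<rho> :: "real \<Rightarrow> real" where
    "smooth \<rho>" "\<And>x. 0 \<le> \<rho> x" "\<And>x. \<rho> x > 0 \<longleftrightarrow> a < x \<and> x < b"
proof
  let ?\<rho> = "\<lambda>x. flat 1 (x - a) * flat 1 (b - x)"
  have "smooth (\<lambda>x::real. flat 1 (x + (- a)))" "smooth (\<lambda>x::real. flat 1 (- x + b))"
    by (rule smooth_compose_affine; simp add: smooth_flat bounded_linear_ident bounded_linear_minus)+
  then show "smooth ?\<rho>"
    using smooth_mult by (simp add: add.commute)
  show "0 \<le> ?\<rho> x" for x by (simp add: flat_def)
  show "?\<rho> x > 0 \<longleftrightarrow> a < x \<and> x < b" for x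
    by (auto simp: flat_def zero_less_mult_iff)
qed

text \<open>The derivative of a moving average is a difference of two translates. In space, with
  \<open>c\<close> equal to the period, this makes fluxes cancel; in time, with \<open>c\<close>
  longer than the time interval, only one translate is visible and the average is a decreasing
  cutoff.\<close>

lemma smooth_window:
  fixes a b c :: real and \<rho> :: "real \<Rightarrow> real"
  assumes sm: "smooth \<rho>" and nn: "\<And>x. 0 \<le> \<rho> x"
    and pos: "\<And>x. \<rho> x > 0 \<longleftrightarrow> a < x \<and> x < b" and c: "c > 0"
  obtains w where "smooth w" "\<And>x. 0 \<le> w x" "\<And>x. w x > 0 \<longleftrightarrow> a - c < x \<and> x < b \<and> a < b"
    "\<And>x. (w has_real_derivative \<rho> (x + c) - \<rho> x) (at x)"
    "\<And>x. w x = integral {x..x + c} \<rho>"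
proof -
  define w where "w = (\<lambda>x. integral {x..x + c} \<rho>)"
  have cont: "continuous_on S \<rho>" for S
    using sm by (rule smooth_imp_continuous)
  have int: "\<rho> integrable_on {x..y}" for x y
    by (intro integrable_continuous_real cont)
  have d: "(w has_real_derivative \<rho> (x + c) - \<rho> x) (at x)" for x
  proof -
    \<comment> \<open>Starting the antiderivative at x - 1 keeps x in the interior of the interval
      of integration, so that \<open>w\<close> is a difference of values of \<open>A\<close> in a
      whole neighbourhood of x.\<close>
    define A where "A = (\<lambda>y. integral {x - 1..y} \<rho>)"
    have dA: "(A has_real_derivative \<rho> y) (at y)" if "y > x - 1" for y
    proof -
      have "((\<lambda>y. integral {x - 1..y} \<rho>) has_real_derivative \<rho> y) (at y within {x - 1..y + 1})"
        by (rule integral_has_real_derivative) (use cont that in auto)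
      moreover have "at y within {x - 1..y + 1} = at y"
        by (rule at_within_interior) (use that in auto)
      ultimately show ?thesis by (simp add: A_def)
    qed
    have "((\<lambda>y. A (y + c)) has_real_derivative \<rho> (x + c)) (at x)"
      using dA[of "x + c"] c by (simp add: DERIV_shift)
    then have "((\<lambda>y. A (y + c) - A y) has_real_derivative \<rho> (x + c) - \<rho> x) (at x)"
      by (intro derivative_intros dA) auto
    moreover have "eventually (\<lambda>y. w y = A (y + c) - A y) (nhds x)"
    proof -
      have "eventually (\<lambda>y. y \<in> {x - 1<..}) (nhds x)"
        by (intro eventually_nhds_in_open) auto
      then show ?thesis
      proof eventually_elim
        case (elim y)
        then show ?case
          using Henstock_Kurzweil_Integration.integral_combine[of "x - 1" y "y + c" \<rho>] int c
          by (simp add: w_def A_def)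
      qed
    qed
    ultimately show ?thesis by (simp add: DERIV_cong_ev)
  qed
  have "smooth (\<lambda>x. \<rho> (x + c) - \<rho> x)"
    using smooth_compose_affine[of "\<lambda>x. x" \<rho> c] sm
      Ck_add[of _ "\<lambda>x. \<rho> (x + c)" "\<lambda>x. (-1) * \<rho> x"] Ck_mult[OF Ck_const, of _ \<rho> "-1"]
    by (simp add: smooth_def bounded_linear_ident)
  then have sw: "smooth w" using smooth_antiderivative[OF d] by simp
  have w0: "0 \<le> w x" for x
    unfolding w_def by (rule Henstock_Kurzweil_Integration.integral_nonneg[OF int]) (simp add: nn)
  have z: "w x = 0 \<longleftrightarrow> (\<forall>y\<in>{x..x+c}. \<rho> y = 0)" for x
  proof -
    have "w x = 0 \<longleftrightarrow> (\<rho> has_integral 0) (cbox x (x + c))"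
      using int[of x "x + c"] by (auto simp: w_def has_integral_iff)
    also have "\<dots> \<longleftrightarrow> (\<forall>y\<in>{x..x+c}. \<rho> y = 0)"
      using has_integral_0_cbox_imp_0[of x "x + c" \<rho>] cont nn c
      by (auto intro: has_integral_is_0)
    finally show ?thesis .
  qed
  have wp: "w x > 0 \<longleftrightarrow> a - c < x \<and> x < b \<and> a < b" for x
  proof -
    have "w x > 0 \<longleftrightarrow> (\<exists>y\<in>{x..x+c}. \<rho> y > 0)"
      using z[of x] w0[of x] nn by (metis less_le)
    also have "\<dots> \<longleftrightarrow> a - c < x \<and> x < b \<and> a < b"
    proof
      assume "a - c < x \<and> x < b \<and> a < b"
      then have "max x a < min (x + c) b" using c by auto
      then obtain y where "max x a < y" "y < min (x + c) b" using dense by blast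
      then show "\<exists>y\<in>{x..x+c}. \<rho> y > 0" by (intro bexI[of _ y]) (auto simp: pos)
    qed (auto simp: pos)
    finally show ?thesis .
  qed
  show ?thesis using sw w0 wp d by (intro that[of w]) (auto simp: w_def)
qed

section \<open>Product test functions and their derivatives\<close>

text \<open>The spatial factors are indexed by the coordinate, although they start out equal,
  because a partial derivative replaces just one of them; the class is thus closed under all
  derivatives in the weak formulation.\<close>

definition prod_fun :: "(real \<Rightarrow> real) \<Rightarrow> (3 \<Rightarrow> real \<Rightarrow> real) \<Rightarrow> real \<times> space \<Rightarrow> real" where
  "prod_fun \<Theta> F z = \<Theta> (fst z) * (\<Prod>j\<in>UNIV. F j (snd z $ j))"

lemma smooth_prod_fun:
  assumes "smooth \<Theta>" "\<And>j. smooth (F j)"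
  shows "smooth (prod_fun \<Theta> F)"
proof -
  have "smooth (\<lambda>z::real \<times> space. \<Theta> (fst z + 0))"
    by (intro smooth_compose_affine bounded_linear_fst assms)
  moreover have "smooth (\<lambda>z::real \<times> space. F j (snd z $ j + 0))" for j
    by (intro smooth_compose_affine bounded_linear_compose[OF bounded_linear_vec_nth bounded_linear_snd] assms)
  ultimately show ?thesis
    unfolding prod_fun_def by (intro smooth_mult smooth_prod) simp_all
qed

text \<open>Turns \<open>dt\<close> and \<open>dx\<close>, which are values of a Frechet derivative,
  into one-variable derivatives along a line, where uniqueness of the derivative identifies
  them.\<close>

lemma smooth_has_directional_derivative:
  fixes \<phi> :: "'a::euclidean_space \<Rightarrow> real"
  assumes "smooth \<phi>"
  shows "((\<lambda>s. \<phi> (z + s *\<^sub>R v)) has_real_derivative frechet_derivative \<phi> (at z) v) (at 0)"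
proof -
  have "Ck (Suc 0) \<phi>" using assms smooth_def by blast
  then have d: "(\<phi> has_derivative frechet_derivative \<phi> (at z)) (at (z + 0 *\<^sub>R v))"
    by (auto simp: frechet_derivative_works)
  have "((\<lambda>s. z + s *\<^sub>R v) has_derivative (\<lambda>s. s *\<^sub>R v)) (at 0)"
    by (auto intro!: derivative_eq_intros)
  from diff_chain_at[OF this d]
  have "((\<lambda>s. \<phi> (z + s *\<^sub>R v)) has_derivative (\<lambda>s. frechet_derivative \<phi> (at z) (s *\<^sub>R v))) (at 0)"
    by (simp add: o_def)
  moreover have "(\<lambda>s. frechet_derivative \<phi> (at z) (s *\<^sub>R v)) = (*) (frechet_derivative \<phi> (at z) v)"
    using linear_scale[OF has_derivative_linear[OF d]] by (auto simp: mult.commute)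
  ultimately show ?thesis by (simp add: has_field_derivative_def)
qed

lemma dt_prod_fun:
  assumes "smooth \<Theta>" "\<And>j. smooth (F j)"
  shows "dt (prod_fun \<Theta> F) = prod_fun (deriv \<Theta>) F"
proof
  fix z :: "real \<times> space"
  have "((\<lambda>s. prod_fun \<Theta> F (z + s *\<^sub>R (1, 0))) has_real_derivative prod_fun (deriv \<Theta>) F z) (at 0)"
  proof -
    have "((\<lambda>s. \<Theta> (s + fst z)) has_real_derivative deriv \<Theta> (fst z)) (at 0)"
      using smooth_real_deriv(1)[OF assms(1), of "0 + fst z"] by (subst DERIV_shift[symmetric]) simp
    then show ?thesis
      unfolding prod_fun_def by (auto intro!: derivative_eq_intros simp: add.commute)
  qed
  then show "dt (prod_fun \<Theta> F) z = prod_fun (deriv \<Theta>) F z"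
    unfolding dt_def
    by (rule DERIV_unique[OF smooth_has_directional_derivative[OF smooth_prod_fun[of \<Theta> F, OF assms]]])
qed

lemma prod_fun_upd:
  "prod_fun \<Theta> (F(i := g)) z = \<Theta> (fst z) * g (snd z $ i) * (\<Prod>j\<in>UNIV - {i}. F j (snd z $ j))"
  unfolding prod_fun_def by (subst prod.remove[of UNIV i]) (auto intro!: prod.cong)

lemma dx_prod_fun:
  assumes "smooth \<Theta>" "\<And>j. smooth (F j)"
  shows "dx i (prod_fun \<Theta> F) = prod_fun \<Theta> (F(i := deriv (F i)))"
proof
  fix z :: "real \<times> space"
  have "((\<lambda>s. prod_fun \<Theta> (F(i := F i)) (z + s *\<^sub>R (0, axis i 1))) has_real_derivative
      prod_fun \<Theta> (F(i := deriv (F i))) z) (at 0)"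
  proof -
    have "((\<lambda>s. F i (s + snd z $ i)) has_real_derivative deriv (F i) (snd z $ i)) (at 0)"
      using smooth_real_deriv(1)[OF assms(2), of i "0 + snd z $ i"] by (subst DERIV_shift[symmetric]) simp
    moreover have "(snd z + s *\<^sub>R axis i 1) $ j = snd z $ j" if "j \<in> UNIV - {i}" for j s
      using that by (auto simp: axis_def)
    moreover have "(snd z + s *\<^sub>R axis i 1) $ i = s + snd z $ i" for s
      by (simp add: axis_def)
    ultimately show ?thesis
      unfolding prod_fun_upd fst_add snd_add fst_scaleR snd_scaleR fst_conv snd_conv
      by (auto intro!: derivative_eq_intros simp del: vector_add_component)
  qed
  then show "dx i (prod_fun \<Theta> F) z = prod_fun \<Theta> (F(i := deriv (F i))) z"
    unfolding dx_def fun_upd_triv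
    by (rule DERIV_unique[OF smooth_has_directional_derivative[OF smooth_prod_fun[of \<Theta> F, OF assms]]])
qed

section \<open>Lebesgue measure on products and periodic functions\<close>

text \<open>\<open>lebesgue\<close> on a product space is a completion and not itself a product
  measure. Tonelli's theorem is therefore applied to a Borel representative, and the exceptional
  null set has null sections over almost every x.\<close>

lemma nn_integral_lebesgue_pair:
  fixes g :: "'a::euclidean_space \<times> 'b::euclidean_space \<Rightarrow> ennreal"
  assumes "g \<in> borel_measurable lebesgue"
  shows "(\<integral>\<^sup>+z. g z \<partial>lebesgue) = (\<integral>\<^sup>+x. \<integral>\<^sup>+y. g (x, y) \<partial>lebesgue \<partial>lebesgue)"
proof -
  obtain g' where g': "g' \<in> borel_measurable lborel" "AE z in lborel. g z = g' z"
    using completion_ex_borel_measurable[OF assms] by auto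
  have "(\<integral>\<^sup>+z. g z \<partial>lebesgue) = (\<integral>\<^sup>+z. g' z \<partial>lborel)"
    using g'(2) by (simp add: nn_integral_completion nn_integral_cong_AE)
  also have "\<dots> = (\<integral>\<^sup>+x. \<integral>\<^sup>+y. g' (x, y) \<partial>lborel \<partial>lborel)"
    using g'(1) by (subst lborel.nn_integral_fst) (simp_all add: lborel_prod)
  also have "\<dots> = (\<integral>\<^sup>+x. \<integral>\<^sup>+y. g (x, y) \<partial>lborel \<partial>lborel)"
  proof (rule nn_integral_cong_AE)
    have "AE z in lborel \<Otimes>\<^sub>M lborel. g z = g' z" unfolding lborel_prod by (rule g'(2))
    then have "AE x in lborel. AE y in lborel. g (x, y) = g' (x, y)"
      by (rule lborel_pair.AE_pair)
    then show "AE x in lborel. (\<integral>\<^sup>+y. g' (x, y) \<partial>lborel) = (\<integral>\<^sup>+y. g (x, y) \<partial>lborel)"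
      by eventually_elim (auto intro!: nn_integral_cong_AE elim!: eventually_mono)
  qed
  finally show ?thesis by (simp add: nn_integral_completion)
qed

lemma Times_in_sets_lebesgue:
  fixes S :: "'a::euclidean_space set" and U :: "'b::euclidean_space set"
  assumes "S \<in> sets borel" "U \<in> sets borel"
  shows "S \<times> U \<in> sets lebesgue"
  using pair_measureI[OF assms] unfolding borel_prod
  by (metis sets_completionI_sets sets_lborel)

lemma nn_integral_lebesgue_on_pair:
  fixes g :: "'a::euclidean_space \<times> 'b::euclidean_space \<Rightarrow> ennreal"
  assumes S: "S \<in> sets borel" and U: "U \<in> sets borel"
    and g: "g \<in> borel_measurable (lebesgue_on (S \<times> U))"
  shows "(\<integral>\<^sup>+z. g z \<partial>lebesgue_on (S \<times> U)) = (\<integral>\<^sup>+x. \<integral>\<^sup>+y. g (x, y) \<partial>lebesgue_on U \<partial>lebesgue_on S)"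
proof -
  have SU: "S \<times> U \<in> sets lebesgue" by (rule Times_in_sets_lebesgue[OF S U])
  have "(\<integral>\<^sup>+z. g z \<partial>lebesgue_on (S \<times> U)) = (\<integral>\<^sup>+z. g z * indicator (S \<times> U) z \<partial>lebesgue)"
    using SU by (subst nn_integral_restrict_space) auto
  also have "\<dots> = (\<integral>\<^sup>+x. \<integral>\<^sup>+y. g (x, y) * indicator (S \<times> U) (x, y) \<partial>lebesgue \<partial>lebesgue)"
    using g SU by (intro nn_integral_lebesgue_pair)
      (simp add: borel_measurable_restrict_space_iff_ennreal)
  also have "\<dots> = (\<integral>\<^sup>+x. (\<integral>\<^sup>+y. g (x, y) \<partial>lebesgue_on U) * indicator S x \<partial>lebesgue)"
    using U by (intro nn_integral_cong)
      (simp add: indicator_times nn_integral_restrict_space split: split_indicator)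
  also have "\<dots> = (\<integral>\<^sup>+x. \<integral>\<^sup>+y. g (x, y) \<partial>lebesgue_on U \<partial>lebesgue_on S)"
    using S by (subst nn_integral_restrict_space) auto
  finally show ?thesis .
qed

section \<open>Translation invariance and periodic functions\<close>

lemma measurable_lebesgue_translation:
  "(\<lambda>x. x + a) \<in> measurable lebesgue (lebesgue :: 'a::euclidean_space measure)"
proof (rule measurableI)
  fix A :: "'a set" assume "A \<in> sets lebesgue"
  then have "(+) (- a) ` A \<in> sets lebesgue" by (rule lebesgue_sets_translation)
  also have "(+) (- a) ` A = (\<lambda>x. x + a) -` A"
    by (force simp: image_iff intro: bexI[of _ "_ + a"])
  finally show "(\<lambda>x. x + a) -` A \<inter> space lebesgue \<in> sets lebesgue" by simp
qed auto

lemma distr_lebesgue_translation: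
  "distr lebesgue lebesgue (\<lambda>x. x + a) = (lebesgue :: 'a::euclidean_space measure)"
proof (rule measure_eqI)
  fix A :: "'a set" assume A: "A \<in> sets (distr lebesgue lebesgue (\<lambda>x. x + a))"
  have "(\<lambda>x. x + a) -` A = (\<lambda>x. 1 *\<^sub>R x + (- a)) ` A"
    by (force simp: image_iff intro: bexI[of _ "_ + a"])
  then show "emeasure (distr lebesgue lebesgue (\<lambda>x. x + a)) A = emeasure lebesgue A"
    using A emeasure_lebesgue_affine[of 1 "- a" A]
    by (simp add: emeasure_distr measurable_lebesgue_translation)
qed simp

lemma integrable_lebesgue_translation:
  fixes g :: "'a::euclidean_space \<Rightarrow> 'b::{banach, second_countable_topology}"
  assumes "integrable lebesgue g"
  shows "integrable lebesgue (\<lambda>x. g (x + a))"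
  using integrable_distr[OF measurable_lebesgue_translation[of a], where f = g] assms
  by (simp add: distr_lebesgue_translation)

lemma integral_lebesgue_translation:
  fixes g :: "'a::euclidean_space \<Rightarrow> 'b::{banach, second_countable_topology}"
  assumes "integrable lebesgue g"
  shows "(\<integral>x. g (x + a) \<partial>lebesgue) = (\<integral>x. g x \<partial>lebesgue)"
  using integral_distr[OF measurable_lebesgue_translation[of a], where f = g] assms
  by (simp add: distr_lebesgue_translation)

lemma set_integrable_UN_translates:
  fixes g :: "'a::euclidean_space \<Rightarrow> 'b::{banach, second_countable_topology}"
  assumes "finite I" and A: "A \<in> sets lebesgue" and g: "set_integrable lebesgue A g"
    and per: "\<And>a x. a \<in> I \<Longrightarrow> x \<in> A \<Longrightarrow> g (x + a) = g x"
  shows "set_integrable lebesgue (\<Union>a\<in>I. (+) a ` A) g"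
proof (rule set_integrable_UN[OF \<open>finite I\<close>])
  fix a assume a: "a \<in> I"
  show "(+) a ` A \<in> sets lebesgue" by (rule lebesgue_sets_translation[OF A])
  have "integrable lebesgue (\<lambda>x. indicator A (x + (- a)) *\<^sub>R g (x + (- a)))"
    using g integrable_lebesgue_translation unfolding set_integrable_def by fast
  moreover have "indicator A (x + (- a)) *\<^sub>R g (x + (- a)) = indicator ((+) a ` A) x *\<^sub>R g x" for x
  proof (cases "x - a \<in> A")
    case True
    then have "x \<in> (+) a ` A" by (auto intro: image_eqI[of _ _ "x - a"])
    with True per[OF a True] show ?thesis by simp
  next
    case False
    then have "x \<notin> (+) a ` A" by auto
    with False show ?thesis by simp
  qed
  ultimately show "set_integrable lebesgue ((+) a ` A) g" by (simp add: set_integrable_def)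
qed

lemma periodic_minus:
  fixes g :: "space \<Rightarrow> 'b"
  assumes "periodic P g" shows "g (x - P *\<^sub>R axis i 1) = g x"
  using assms[unfolded periodic_def, rule_format, of "x - P *\<^sub>R axis i 1" i] by simp

lemma periodic_int_axis:
  fixes g :: "space \<Rightarrow> 'b"
  assumes "periodic P g"
  shows "g (x + (P * of_int m) *\<^sub>R axis i 1) = g x"
proof (induction m rule: int_induct[where k = 0])
  case base
  then show ?case by simp
next
  case (step1 m)
  then show ?case
    using assms[unfolded periodic_def, rule_format, of "x + (P * of_int m) *\<^sub>R axis i 1" i]
    by (simp add: algebra_simps)
next
  case (step2 m)
  then show ?case
    using periodic_minus[OF assms, of "x + (P * of_int m) *\<^sub>R axis i 1" i]
    by (simp add: algebra_simps)
qed

definition int_vec :: "int ^ 3 \<Rightarrow> space" where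
  "int_vec n = (\<chi> i. of_int (n $ i))"

lemma periodic_int_vec:
  fixes g :: "space \<Rightarrow> 'b"
  assumes "periodic P g"
  shows "g (x + P *\<^sub>R int_vec n) = g x"
proof -
  have "P *\<^sub>R int_vec n = (P * of_int (n $ 1)) *\<^sub>R axis 1 1 + (P * of_int (n $ 2)) *\<^sub>R axis 2 1
      + (P * of_int (n $ 3)) *\<^sub>R axis 3 1"
    by (simp add: vec_eq_iff forall_3 int_vec_def axis_def)
  then show ?thesis
    by (simp only: add.assoc[symmetric] periodic_int_axis[OF assms])
qed

text \<open>Cubes of frequencies instead of balls, so that counting and sums of products factor over
  the coordinates. The cube of size 1 also lists the translates of the period cell that cover a cube
  of twice its side.\<close>

definition int_box :: "nat \<Rightarrow> (int ^ 3) set" where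
  "int_box N = {n. \<forall>i. \<bar>n $ i\<bar> \<le> int N}"

lemma finite_int_box: "finite (int_box N)"
proof -
  have "int_box N \<subseteq> vec_lambda ` (UNIV \<rightarrow>\<^sub>E {- int N..int N})"
  proof
    fix n assume "n \<in> int_box N"
    then have "vec_nth n \<in> UNIV \<rightarrow>\<^sub>E {- int N..int N}"
      by (auto simp: int_box_def abs_le_iff minus_le_iff)
    then show "n \<in> vec_lambda ` (UNIV \<rightarrow>\<^sub>E {- int N..int N})"
      by (metis image_eqI vec_nth_inverse)
  qed
  then show ?thesis by (rule finite_subset) (intro finite_imageI finite_PiE; simp)
qed

lemma torus_int_translate:
  assumes P: "P > 0" and x: "\<And>i. \<bar>x $ i\<bar> \<le> P"
  obtains n y where "n \<in> int_box 1" "y \<in> torus P" "x = y + P *\<^sub>R int_vec n"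
proof -
  define m where "m = (\<lambda>i. if x $ i > P / 2 then 1 else if x $ i < - P / 2 then - 1 else (0 :: int))"
  define n :: "int ^ 3" where "n = (\<chi> i. m i)"
  show ?thesis
  proof
    show "n \<in> int_box 1" by (simp add: int_box_def n_def m_def)
    show "x = (x - P *\<^sub>R int_vec n) + P *\<^sub>R int_vec n" by simp
    show "x - P *\<^sub>R int_vec n \<in> torus P"
      using x P by (auto simp: torus_def mem_box_cart int_vec_def n_def m_def abs_le_iff)
         (smt (verit) field_sum_of_halves)+
  qed
qed

lemma torus_borel [simp]: "torus P \<in> sets borel" "torus P \<in> sets lebesgue"
  by (auto simp: torus_def)

text \<open>The spatial weights are supported in a cube of side 2 P, whereas integrability is known
  on a cell of side P; finitely many translates of the cell cover the larger cube.\<close>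

lemma set_integrable_periodic:
  fixes g :: "real \<times> space \<Rightarrow> 'b::{banach, second_countable_topology}"
  assumes P: "P > 0" and S: "S \<in> sets borel"
    and g: "set_integrable lebesgue (S \<times> torus P) g"
    and per: "\<And>t. t \<in> S \<Longrightarrow> periodic P (\<lambda>x. g (t, x))"
  shows "set_integrable lebesgue (S \<times> cbox (vec (- P)) (vec P)) g"
proof -
  let ?I = "(\<lambda>n. (0 :: real, P *\<^sub>R int_vec n)) ` int_box 1"
  have "set_integrable lebesgue (\<Union>a\<in>?I. (+) a ` (S \<times> torus P)) g"
    using periodic_int_vec[OF per]
    by (intro set_integrable_UN_translates g Times_in_sets_lebesgue S finite_imageI finite_int_box torus_borel)
       auto
  then show ?thesis
  proof (rule set_integrable_subset)
    show "S \<times> cbox (vec (- P)) (vec P) \<in> sets lebesgue"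
      using S by (intro Times_in_sets_lebesgue) auto
    show "S \<times> cbox (vec (- P)) (vec P) \<subseteq> (\<Union>a\<in>?I. (+) a ` (S \<times> torus P))"
    proof clarify
      fix t and x :: space assume t: "t \<in> S" and x: "x \<in> cbox (vec (- P)) (vec P)"
      then have "\<bar>x $ i\<bar> \<le> P" for i by (auto simp: mem_box_cart abs_le_iff minus_le_iff)
      then obtain n y where "n \<in> int_box 1" "y \<in> torus P" "x = y + P *\<^sub>R int_vec n"
        using torus_int_translate[OF P] by metis
      then show "(t, x) \<in> (\<Union>a\<in>?I. (+) a ` (S \<times> torus P))"
        using t by (auto intro!: bexI[of _ n] image_eqI[of _ _ "(t, y)"])
    qed
  qed
qed

section \<open>The uniform energy bound\<close>

lemma slice_null_sets:
  fixes a :: real and U :: "'a::euclidean_space set"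
  assumes "U \<in> sets borel"
  shows "{a} \<times> U \<in> null_sets lebesgue"
proof -
  have "emeasure (lborel \<Otimes>\<^sub>M lborel) ({a} \<times> U) = 0"
    using assms by (subst lborel.emeasure_pair_measure_Times) auto
  then have "{a} \<times> U \<in> null_sets lborel"
    using pair_measureI[of "{a}" borel U borel] assms unfolding lborel_prod borel_prod
    by (auto simp: null_sets_def)
  then show ?thesis by (rule null_sets_completionI)
qed

text \<open>The regularity classes refer to 0 < t < T and the weak formulation to 0 \<le> t < T. The
  initial slice is null, so measurability carries over.\<close>

lemma measurable_slab_initial_time:
  fixes g :: "real \<times> space \<Rightarrow> 'b::euclidean_space"
  assumes "g \<in> borel_measurable (lebesgue_on ({0<..<T} \<times> torus P))"
  shows "g \<in> borel_measurable (lebesgue_on ({0..<T} \<times> torus P))"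
proof (cases "T > 0")
  case True
  let ?Q = "{0..<T} \<times> torus P"
  have Q: "?Q \<in> sets lebesgue" by (rule Times_in_sets_lebesgue) auto
  have "{0} \<times> torus P \<in> null_sets (lebesgue_on ?Q)"
    using True slice_null_sets[of "torus P" 0] by (subst null_sets_restrict_space[OF Q]) auto
  moreover have "?Q - {0} \<times> torus P = {0<..<T} \<times> torus P"
    by auto
  ultimately show ?thesis
    using borel_measurable_diff_null[OF _ Q, of "{0} \<times> torus P" g] assms by simp
next
  case False
  then show ?thesis using assms by simp
qed

lemma AE_initial_time:
  assumes "AE t in time_measure T. Q t"
  shows "AE t in lebesgue_on {0..<T}. Q t"
proof -
  have "AE t in lebesgue. t \<in> {0<..<T} \<longrightarrow> Q t"
    using assms by (simp add: AE_restrict_space_iff)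
  moreover have "AE t in lebesgue. t \<noteq> (0::real)"
    by (intro AE_completion AE_lborel_singleton)
  ultimately show ?thesis
    by (subst AE_restrict_space_iff) auto
qed

lemma nn_integral_initial_time:
  "(\<integral>\<^sup>+t. h t \<partial>lebesgue_on {0..<T}) = (\<integral>\<^sup>+t. h t \<partial>time_measure T)"
proof -
  have "AE t in lebesgue. t \<noteq> (0::real)"
    by (intro AE_completion AE_lborel_singleton)
  then have "AE t in lebesgue. h t * indicator {0..<T} t = h t * indicator {0<..<T} t"
    by eventually_elim (auto split: split_indicator)
  then show ?thesis
    by (simp add: nn_integral_restrict_space nn_integral_cong_AE)
qed

lemma Lp_norm_2_squared: "(Lp_norm 2 M g)\<^sup>2 = (\<integral>x. (norm (g x))\<^sup>2 \<partial>M)"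
proof -
  have "(\<integral>x. norm (g x) powr 2 \<partial>M) = (\<integral>x. (norm (g x))\<^sup>2 \<partial>M)"
    by (rule Bochner_Integration.integral_cong) auto
  moreover have "0 \<le> (\<integral>x. (norm (g x))\<^sup>2 \<partial>M)" by simp
  ultimately show ?thesis
    by (simp add: Lp_norm_def powr_half_sqrt)
qed

lemma in_Lp_2_iff:
  "in_Lp 2 M g \<longleftrightarrow> g \<in> borel_measurable M \<and> integrable M (\<lambda>x. (norm (g x))\<^sup>2)"
  by (simp add: in_Lp_def)

lemma in_Lp_Lp_2:
  fixes v :: "real \<Rightarrow> space \<Rightarrow> 'b::euclidean_space"
  assumes "in_Lp_Lp P T 2 2 v"
  shows in_Lp_Lp_2_measurable:
      "(\<lambda>z. v (fst z) (snd z)) \<in> borel_measurable (lebesgue_on ({0..<T} \<times> torus P))"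
    and in_Lp_Lp_2_integrable:
      "integrable (lebesgue_on ({0..<T} \<times> torus P)) (\<lambda>z. (norm (v (fst z) (snd z)))\<^sup>2)"
proof -
  show m: "(\<lambda>z. v (fst z) (snd z)) \<in> borel_measurable (lebesgue_on ({0..<T} \<times> torus P))"
    using assms by (intro measurable_slab_initial_time) (simp add: in_Lp_Lp_def case_prod_beta')
  let ?N = "\<lambda>t. Lp_norm 2 (torus_measure P) (v t)"
  have ae: "AE t in time_measure T. in_Lp 2 (torus_measure P) (v t)"
    and N: "integrable (time_measure T) (\<lambda>t. (?N t)\<^sup>2)"
    using assms by (auto simp: in_Lp_Lp_def in_Lp_2_iff)
  have "(\<integral>\<^sup>+z. ennreal ((norm (v (fst z) (snd z)))\<^sup>2) \<partial>lebesgue_on ({0..<T} \<times> torus P))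
      = (\<integral>\<^sup>+t. \<integral>\<^sup>+x. ennreal ((norm (v t x))\<^sup>2) \<partial>torus_measure P \<partial>lebesgue_on {0..<T})"
    using m by (subst nn_integral_lebesgue_on_pair) auto
  also have "\<dots> = (\<integral>\<^sup>+t. ennreal ((?N t)\<^sup>2) \<partial>lebesgue_on {0..<T})"
  proof (rule nn_integral_cong_AE)
    show "AE t in lebesgue_on {0..<T}. (\<integral>\<^sup>+x. ennreal ((norm (v t x))\<^sup>2) \<partial>torus_measure P) = ennreal ((?N t)\<^sup>2)"
      using AE_initial_time[OF ae]
      by eventually_elim (auto simp: in_Lp_2_iff Lp_norm_2_squared nn_integral_eq_integral)
  qed
  also have "\<dots> = (\<integral>\<^sup>+t. ennreal ((?N t)\<^sup>2) \<partial>time_measure T)"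
    by (rule nn_integral_initial_time)
  also have "\<dots> < \<infinity>"
    using N by (subst nn_integral_eq_integral) auto
  finally show "integrable (lebesgue_on ({0..<T} \<times> torus P)) (\<lambda>z. (norm (v (fst z) (snd z)))\<^sup>2)"
    using m by (intro integrableI_bounded) (auto simp: measurable_compose[OF m])
qed

lemma continuous_prod_fun:
  assumes "continuous_on UNIV \<Theta>" "\<And>j. continuous_on UNIV (F j)"
  shows "continuous_on S (prod_fun \<Theta> F)"
  unfolding prod_fun_def
  by (intro continuous_intros continuous_on_compose2[OF assms(1)] continuous_on_compose2[OF assms(2)]) auto

lemma prod_fun_eq_0:
  assumes "\<And>j s. \<bar>s\<bar> > P \<Longrightarrow> F j s = 0" and "x \<notin> cbox (vec (- P)) (vec P)"
  shows "prod_fun \<Theta> F (t, x) = 0"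
proof -
  have "\<exists>j. \<bar>x $ j\<bar> > P"
  proof (rule ccontr)
    assume "\<nexists>j. \<bar>x $ j\<bar> > P"
    then have "\<bar>x $ j\<bar> \<le> P" for j by (meson not_le)
    then have "- P \<le> x $ j \<and> x $ j \<le> P" for j by (meson abs_le_iff minus_le_iff)
    then show False using assms(2) by (simp add: mem_box_cart)
  qed
  then obtain j where "\<bar>x $ j\<bar> > P" ..
  then show ?thesis using assms(1) by (auto simp: prod_fun_def)
qed

text \<open>The common hypotheses of the energy density, the flux components, the dissipation, the
  squared force and the power of the force, all of which are paired with product test
  functions.\<close>

locale slab =
  fixes P T :: real and g :: "real \<times> space \<Rightarrow> real"
  assumes P: "P > 0"
    and integrable_cell: "integrable (lebesgue_on ({0..<T} \<times> torus P)) g"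
    and periodic: "\<And>t. t \<ge> 0 \<Longrightarrow> periodic P (\<lambda>x. g (t, x))"
begin

lemma set_integrable_cell: "set_integrable lebesgue ({0..<T} \<times> torus P) g"
  unfolding set_integrable_def
  using integrable_cell by (subst integrable_restrict_space[symmetric]) (auto intro!: Times_in_sets_lebesgue)

lemma integrable_prod_fun:
  assumes \<Theta>: "continuous_on UNIV \<Theta>" and F: "\<And>j. continuous_on UNIV (F j)"
    and supp: "\<And>j s. \<bar>s\<bar> > P \<Longrightarrow> F j s = 0"
  shows "integrable lebesgue (\<lambda>z. indicator ({0..<T} \<times> UNIV) z * (prod_fun \<Theta> F z * g z))"
    and "integrable (lebesgue_on ({0..<T} \<times> UNIV)) (\<lambda>z. prod_fun \<Theta> F z * g z)"
proof -
  let ?B = "cbox (vec (- P)) (vec P) :: space set"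
  have g: "set_integrable lebesgue ({0..<T} \<times> ?B) g"
    by (rule set_integrable_periodic[OF P _ set_integrable_cell]) (auto intro: periodic)
  have "compact (prod_fun \<Theta> F ` ({0..T} \<times> ?B))"
    by (intro compact_continuous_image continuous_prod_fun \<Theta> F compact_Times) auto
  then obtain c where c: "\<And>z. z \<in> {0..T} \<times> ?B \<Longrightarrow> \<bar>prod_fun \<Theta> F z\<bar> \<le> c"
    unfolding bounded_iff[THEN iffD1, OF compact_imp_bounded]
    by (metis compact_imp_bounded bounded_iff image_eqI real_norm_def)
  have m: "prod_fun \<Theta> F \<in> borel_measurable lebesgue"
    using continuous_prod_fun[of \<Theta> F UNIV, OF \<Theta> F]
    by (intro measurable_completion) (simp add: borel_measurable_continuous_onI)
  have "integrable lebesgue (\<lambda>z. prod_fun \<Theta> F z * (indicator ({0..<T} \<times> ?B) z *\<^sub>R g z))"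
  proof (rule Bochner_Integration.integrable_bound)
    show "integrable lebesgue (\<lambda>z. c * (indicator ({0..<T} \<times> ?B) z *\<^sub>R g z))"
      using g unfolding set_integrable_def by simp
    show "(\<lambda>z. prod_fun \<Theta> F z * (indicator ({0..<T} \<times> ?B) z *\<^sub>R g z)) \<in> borel_measurable lebesgue"
      using g m unfolding set_integrable_def by (auto dest: borel_measurable_integrable)
    show "AE z in lebesgue. norm (prod_fun \<Theta> F z * (indicator ({0..<T} \<times> ?B) z *\<^sub>R g z))
        \<le> norm (c * (indicator ({0..<T} \<times> ?B) z *\<^sub>R g z))"
    proof (rule AE_I2)
      fix z
      show "norm (prod_fun \<Theta> F z * (indicator ({0..<T} \<times> ?B) z *\<^sub>R g z))
        \<le> norm (c * (indicator ({0..<T} \<times> ?B) z *\<^sub>R g z))"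
      proof (cases "z \<in> {0..<T} \<times> ?B")
        case True
        then have "\<bar>prod_fun \<Theta> F z\<bar> \<le> \<bar>c\<bar>" using c[of z] by force
        then show ?thesis by (simp add: abs_mult mult_right_mono)
      qed auto
    qed
  qed
  moreover have "prod_fun \<Theta> F z * (indicator ({0..<T} \<times> ?B) z *\<^sub>R g z)
      = indicator ({0..<T} \<times> UNIV) z * (prod_fun \<Theta> F z * g z)" for z
    using prod_fun_eq_0[of P F "snd z" \<Theta> "fst z"] supp
    by (cases z) (auto split: split_indicator)
  ultimately show *: "integrable lebesgue (\<lambda>z. indicator ({0..<T} \<times> UNIV) z * (prod_fun \<Theta> F z * g z))"
    by (simp only:)
  then show "integrable (lebesgue_on ({0..<T} \<times> UNIV)) (\<lambda>z. prod_fun \<Theta> F z * g z)"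
    by (subst integrable_restrict_space) (auto intro!: Times_in_sets_lebesgue)
qed

text \<open>Translating the i-th coordinate by a period changes neither \<open>g\<close> nor the
  other factors and carries one of the two integrals into the other. The support of \<open>c\<close>
  in [0, P] keeps both translates inside [-P, P], so each integral converges by itself.\<close>

lemma integral_translation_difference:
  assumes \<Theta>: "continuous_on UNIV \<Theta>" and F: "\<And>j. continuous_on UNIV (F j)"
    and c: "continuous_on UNIV c"
    and supp: "\<And>j s. \<bar>s\<bar> > P \<Longrightarrow> F j s = 0" and suppc: "\<And>s. s \<notin> {0..P} \<Longrightarrow> c s = 0"
  shows "(\<integral>z. prod_fun \<Theta> (F(i := \<lambda>s. c (s + P) - c s)) z * g z \<partial>lebesgue_on ({0..<T} \<times> UNIV)) = 0"
proof -
  let ?k = "\<lambda>h z. indicator ({0..<T} \<times> UNIV) z * (prod_fun \<Theta> (F(i := h)) z * g z)"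
  let ?cP = "\<lambda>s. c (s + P)"
  have int: "integrable lebesgue (?k h)"
    if "continuous_on UNIV h" "\<And>s. \<bar>s\<bar> > P \<Longrightarrow> h s = 0" for h
    by (rule integrable_prod_fun) (use that \<Theta> F supp in auto)
  have i1: "integrable lebesgue (?k c)"
    by (rule int[OF c], rule suppc) (use P in auto)
  have i2: "integrable lebesgue (?k ?cP)"
    by (rule int, intro continuous_on_compose2[OF c] continuous_intros, simp, rule suppc) (use P in auto)
  have tr: "?k c (z + (0, P *\<^sub>R axis i 1)) = ?k ?cP z" for z
  proof -
    have "(\<Prod>j\<in>UNIV - {i}. F j (snd (z + (0, P *\<^sub>R axis i 1)) $ j)) = (\<Prod>j\<in>UNIV - {i}. F j (snd z $ j))"
      by (rule prod.cong) (auto simp: axis_def)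
    moreover have "g (z + (0, P *\<^sub>R axis i 1)) = g z" if "fst z \<ge> 0"
      using periodic[OF that] by (cases z) (simp add: periodic_def)
    ultimately show ?thesis
      unfolding prod_fun_upd by (cases z) (auto split: split_indicator simp: axis_def)
  qed
  have "(\<integral>z. prod_fun \<Theta> (F(i := \<lambda>s. c (s + P) - c s)) z * g z \<partial>lebesgue_on ({0..<T} \<times> UNIV))
      = (\<integral>z. ?k ?cP z - ?k c z \<partial>lebesgue)"
    by (subst integral_restrict_space)
      (auto intro!: Times_in_sets_lebesgue Bochner_Integration.integral_cong simp: prod_fun_upd algebra_simps)
  also have "\<dots> = (\<integral>z. ?k c (z + (0, P *\<^sub>R axis i 1)) \<partial>lebesgue) - (\<integral>z. ?k c z \<partial>lebesgue)"
    using i1 i2 by (simp add: tr)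
  also have "\<dots> = 0"
    using integral_lebesgue_translation[OF i1, of "(0, P *\<^sub>R axis i 1)"] by simp
  finally show ?thesis .
qed

end


section \<open>The energy inequality on the period cell\<close>

lemma integrable_inner_L2:
  fixes f g :: "'a \<Rightarrow> 'b::euclidean_space"
  assumes [measurable]: "f \<in> borel_measurable M" "g \<in> borel_measurable M"
    and "integrable M (\<lambda>x. (norm (f x))\<^sup>2)" "integrable M (\<lambda>x. (norm (g x))\<^sup>2)"
  shows "integrable M (\<lambda>x. f x \<bullet> g x)"
proof (rule Bochner_Integration.integrable_bound)
  show "integrable M (\<lambda>x. (norm (f x))\<^sup>2 + (norm (g x))\<^sup>2)"
    using assms by simp
  show "AE x in M. norm (f x \<bullet> g x) \<le> norm ((norm (f x))\<^sup>2 + (norm (g x))\<^sup>2)"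
  proof (rule AE_I2)
    fix x
    have "\<bar>f x \<bullet> g x\<bar> \<le> norm (f x) * norm (g x)" by (rule Cauchy_Schwarz_ineq2)
    also have "\<dots> \<le> (norm (f x))\<^sup>2 + (norm (g x))\<^sup>2"
      using sum_squares_bound[of "norm (f x)" "norm (g x)"]
        mult_nonneg_nonneg[OF norm_ge_zero[of "f x"] norm_ge_zero[of "g x"]] by linarith
    finally show "norm (f x \<bullet> g x) \<le> norm ((norm (f x))\<^sup>2 + (norm (g x))\<^sup>2)" by simp
  qed
qed simp

lemma two_inner_le: "2 * (x \<bullet> y) \<le> (norm x)\<^sup>2 + (norm (y :: 'a::real_inner))\<^sup>2"
  using zero_le_power2[of "norm (x - y)"] by (simp add: dot_norm_neg)

text \<open>Weak continuity gives \<open>\<parallel>v(t)\<parallel>\<^sup>2 \<ge> 2 \<langle>v(t), v(\<tau>)\<rangle> - \<parallel>v(\<tau>)\<parallel>\<^sup>2 \<longrightarrow> \<parallel>v(\<tau>)\<parallel>\<^sup>2\<close> as \<open>t \<longrightarrow> \<tau>\<close>.\<close>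

lemma in_C_L2w_lower_semicontinuous:
  assumes v: "in_C_L2w P T v" and \<tau>: "0 < \<tau>" "\<tau> < T" and \<delta>: "\<delta> > 0"
  obtains \<epsilon> where "\<epsilon> > 0" "\<tau> + \<epsilon> < T"
    "\<And>t. \<tau> < t \<Longrightarrow> t < \<tau> + \<epsilon> \<Longrightarrow>
       (\<integral>x. (norm (v \<tau> x))\<^sup>2 \<partial>torus_measure P) - \<delta> \<le> (\<integral>x. (norm (v t x))\<^sup>2 \<partial>torus_measure P)"
proof -
  let ?M = "torus_measure P"
  have L2: "in_Lp 2 ?M (v t)" if "t \<in> {0..T}" for t
    using v that by (auto simp: in_C_L2w_def)
  define h where "h = (\<lambda>t. \<integral>x. v t x \<bullet> v \<tau> x \<partial>?M)"
  have "continuous_on {0..T} h"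
    using v L2[of \<tau>] \<tau> by (auto simp: in_C_L2w_def h_def)
  moreover have "\<tau> \<in> {0..T}" "\<delta> / 2 > 0" using \<tau> \<delta> by auto
  ultimately obtain d where d: "d > 0" "\<And>t. t \<in> {0..T} \<Longrightarrow> dist t \<tau> < d \<Longrightarrow> dist (h t) (h \<tau>) < \<delta> / 2"
    unfolding continuous_on_iff by blast
  show ?thesis
  proof
    show "min d ((T - \<tau>) / 2) > 0" "\<tau> + min d ((T - \<tau>) / 2) < T"
      using d(1) \<tau> by (auto simp: min_def field_simps)
    fix t assume t: "\<tau> < t" "t < \<tau> + min d ((T - \<tau>) / 2)"
    then have tT: "t \<in> {0..T}" and "dist t \<tau> < d"
      using \<tau> \<open>\<tau> + min d ((T - \<tau>) / 2) < T\<close> by (auto simp: dist_real_def)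
    then have "\<bar>h t - h \<tau>\<bar> < \<delta> / 2" using d(2) by (simp add: dist_real_def)
    then have "h \<tau> - \<delta> / 2 \<le> h t" unfolding abs_less_iff by linarith
    moreover have "2 * h t \<le> (\<integral>x. (norm (v t x))\<^sup>2 \<partial>?M) + (\<integral>x. (norm (v \<tau> x))\<^sup>2 \<partial>?M)"
    proof -
      have i: "integrable ?M (\<lambda>x. (norm (v t x))\<^sup>2)" "integrable ?M (\<lambda>x. (norm (v \<tau> x))\<^sup>2)"
        and "v t \<in> borel_measurable ?M" "v \<tau> \<in> borel_measurable ?M"
        using L2[OF tT] L2[of \<tau>] \<tau> by (auto simp: in_Lp_2_iff)
      then have "integrable ?M (\<lambda>x. v t x \<bullet> v \<tau> x)" by (intro integrable_inner_L2)
      then have "(\<integral>x. 2 * (v t x \<bullet> v \<tau> x) \<partial>?M) \<le> (\<integral>x. (norm (v t x))\<^sup>2 + (norm (v \<tau> x))\<^sup>2 \<partial>?M)"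
        using i by (intro integral_mono two_inner_le) auto
      then show ?thesis using i by (simp add: h_def)
    qed
    moreover have "h \<tau> = (\<integral>x. (norm (v \<tau> x))\<^sup>2 \<partial>?M)"
      by (simp add: h_def power2_norm_eq_inner)
    ultimately show "(\<integral>x. (norm (v \<tau> x))\<^sup>2 \<partial>?M) - \<delta> \<le> (\<integral>x. (norm (v t x))\<^sup>2 \<partial>?M)"
      by linarith
  qed
qed

lemma spacetime_test_prod_fun:
  assumes "smooth \<Theta>" "\<And>j. smooth (F j)"
    and \<Theta>: "\<And>t. t \<notin> {a..b} \<Longrightarrow> \<Theta> t = 0" "b < T"
    and F: "\<And>j s. \<bar>s\<bar> > P \<Longrightarrow> F j s = 0"
  shows "spacetime_test T (prod_fun \<Theta> F)"
proof -
  let ?C = "{a..b} \<times> cbox (vec (- P)) (vec P) :: (real \<times> space) set"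
  have C: "compact ?C" by (intro compact_Times) auto
  have "{z. prod_fun \<Theta> F z \<noteq> 0} \<subseteq> ?C"
    using \<Theta>(1) prod_fun_eq_0[of P F _ \<Theta>, OF F] by (fastforce simp: prod_fun_def)
  then have sub: "closure {z. prod_fun \<Theta> F z \<noteq> 0} \<subseteq> ?C"
    using closure_minimal compact_imp_closed[OF C] by blast
  then have "compact (closure {z. prod_fun \<Theta> F z \<noteq> 0})"
    using C compact_Int_closed[OF C closed_closure] by (metis inf.absorb_iff2)
  with sub \<Theta>(2) show ?thesis
    unfolding test_function_def using smooth_prod_fun[OF assms(1,2)] by (auto dest!: subsetD)
qed

text \<open>Testing with \<open>\<Theta>(t) \<Prod>\<^sub>j w(x\<^sub>j)\<close>, the flux and the viscous term drop out: \<open>w'\<close> and \<open>w''\<close> are differences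
  of translates by a period.\<close>

lemma cell_energy_inequality:
  fixes w b \<Theta> :: "real \<Rightarrow> real"
  assumes P: "P > 0" and \<mu>: "\<mu> > 0" and T: "T > 0"
    and f: "\<forall>t\<ge>0. periodic P (f t)" "in_Lp_Lp P T 2 2 f"
    and NS: "NS_weak_solution P \<mu> u0 f v \<pi>"
    and b: "smooth b" "\<And>s. s \<notin> {0..P} \<Longrightarrow> b s = 0"
    and w: "smooth w" "\<And>s. 0 \<le> w s" "\<And>s. \<bar>s\<bar> > P \<Longrightarrow> w s = 0"
      "\<And>s. (w has_real_derivative b (s + P) - b s) (at s)"
    and \<Theta>: "smooth \<Theta>" "\<And>t. 0 \<le> \<Theta> t" "\<And>t. t \<notin> {l..r} \<Longrightarrow> \<Theta> t = 0" "r < T"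
  shows "(\<integral>z. prod_fun (\<lambda>t. - deriv \<Theta> t) (\<lambda>_. w) z * ((norm (v (fst z) (snd z)))\<^sup>2 / 2) \<partial>lebesgue_on ({0..<T} \<times> UNIV))
    \<le> \<Theta> 0 * (\<integral>x. (norm (u0 x))\<^sup>2 / 2 * (\<Prod>j\<in>UNIV. w (x $ j)) \<partial>lebesgue)
      + (\<integral>z. prod_fun \<Theta> (\<lambda>_. w) z * (f (fst z) (snd z) \<bullet> v (fst z) (snd z)) \<partial>lebesgue_on ({0..<T} \<times> UNIV))"
proof -
  let ?Q = "lebesgue_on ({0..<T} \<times> torus P)" and ?M = "lebesgue_on ({0..<T} \<times> (UNIV :: space set))"
  obtain G where G: "\<forall>t\<ge>0. periodic P (G t)" "in_L2_H1 P T v G"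
    "local_energy_inequality P T \<mu> u0 f v G \<pi>"
    using NS T by (auto simp: NS_weak_solution_def)
  have per: "periodic P (v t)" "periodic P (\<pi> t)" if "t \<ge> 0" for t
    using NS that by (auto simp: NS_weak_solution_def)
  have v2: "in_Lp_Lp P T 2 2 v" and G2: "in_Lp_Lp P T 2 2 G"
    using G(2) by (auto simp: in_L2_H1_def)
  define V where "V = (\<lambda>z. (norm (v (fst z) (snd z)))\<^sup>2 / 2)"
  \<comment> \<open>The flux is split into components because each is multiplied by a different
    partial derivative of the test function.\<close>
  define E where "E = (\<lambda>i z. ((norm (v (fst z) (snd z)))\<^sup>2 / 2 + \<pi> (fst z) (snd z)) * v (fst z) (snd z) $ i)"
  define D where "D = (\<lambda>z. \<mu> * (norm (G (fst z) (snd z)))\<^sup>2)"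
  have "integrable ?Q (\<lambda>z. ((norm (v (fst z) (snd z)))\<^sup>2 / 2 + \<pi> (fst z) (snd z)) *\<^sub>R v (fst z) (snd z))"
    using G(3) by (simp add: local_energy_inequality_def case_prod_beta')
  from integrable_bounded_linear[OF bounded_linear_vec_nth this]
  have intE: "integrable ?Q (E i)" for i by (simp add: E_def)
  have intV: "integrable ?Q V" and intD: "integrable ?Q D"
    using in_Lp_Lp_2_integrable[OF v2] in_Lp_Lp_2_integrable[OF G2] by (auto simp: V_def D_def)
  interpret V: slab P T V
    by unfold_locales (use P intV per in \<open>auto simp: V_def periodic_def\<close>)
  interpret E: slab P T "E i" for i
    by unfold_locales (use P intE per in \<open>auto simp: E_def periodic_def\<close>)
  interpret D: slab P T D
    by unfold_locales (use P intD G(1) in \<open>auto simp: D_def periodic_def\<close>)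
  define F :: "3 \<Rightarrow> real \<Rightarrow> real" where "F = (\<lambda>_. w)"
  define b' where "b' = deriv b"
  have sF: "smooth (F j)" and cF: "continuous_on UNIV (F j)" and F0: "\<bar>s\<bar> > P \<Longrightarrow> F j s = 0" for j s
    using w smooth_imp_continuous by (auto simp: F_def)
  have dw: "deriv w = (\<lambda>s. b (s + P) - b s)"
    using w(4) DERIV_imp_deriv by blast
  have ddw: "deriv (deriv w) = (\<lambda>s. b' (s + P) - b' s)"
  proof
    fix s
    have "((\<lambda>s. b (s + P) - b s) has_real_derivative b' (s + P) - b' s) (at s)"
      unfolding b'_def
      by (intro DERIV_diff DERIV_shift[THEN iffD1] smooth_real_deriv(1)[OF b(1)])
    then show "deriv (deriv w) s = b' (s + P) - b' s"
      unfolding dw by (rule DERIV_imp_deriv)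
  qed
  have b'0: "b' s = 0" if "s \<notin> {0..P}" for s
  proof -
    have "eventually (\<lambda>y. y \<in> - {0..P}) (nhds s)"
      using that by (intro eventually_nhds_in_open) auto
    then have "eventually (\<lambda>y. b y = (\<lambda>_. 0) y) (nhds s)"
      by eventually_elim (use b(2) in auto)
    then show ?thesis unfolding b'_def by (subst deriv_cong_ev[OF _ refl]) auto
  qed
  have sdw: "smooth (deriv w)" by (rule smooth_real_deriv(2)[OF w(1)])
  have cb: "continuous_on UNIV b" "continuous_on UNIV b'"
    using b(1) smooth_real_deriv(2)[OF b(1)] smooth_imp_continuous by (auto simp: b'_def)
  have c\<Theta>: "continuous_on UNIV \<Theta>" "continuous_on UNIV (\<lambda>t. - deriv \<Theta> t)"
    using \<Theta>(1) smooth_real_deriv(2)[OF \<Theta>(1)] smooth_imp_continuous by (auto intro: continuous_on_minus)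
  define \<phi> where "\<phi> = prod_fun \<Theta> F"
  have test: "spacetime_test T \<phi>"
    unfolding \<phi>_def by (rule spacetime_test_prod_fun[OF \<Theta>(1) sF \<Theta>(3,4) F0])
  have \<phi>0: "0 \<le> \<phi> z" for z
    unfolding \<phi>_def prod_fun_def F_def by (intro mult_nonneg_nonneg prod_nonneg \<Theta>(2)) (auto intro: w(2))
  have dt: "dt \<phi> = prod_fun (deriv \<Theta>) F" unfolding \<phi>_def by (rule dt_prod_fun[OF \<Theta>(1) sF])
  have dx: "dx i \<phi> = prod_fun \<Theta> (F(i := deriv w))" for i
    unfolding \<phi>_def using dx_prod_fun[OF \<Theta>(1) sF] by (simp add: F_def)
  have dxx: "dx i (dx i \<phi>) = prod_fun \<Theta> (F(i := deriv (deriv w)))" for i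
    unfolding dx using dx_prod_fun[OF \<Theta>(1), of "F(i := deriv w)" i] sF sdw by simp
  define c where "c = (\<lambda>i z. dx i \<phi> z * E i z)"
  define d where "d = (\<lambda>i z. dx i (dx i \<phi>) z * (\<mu> * V z))"
  define a where "a = (\<lambda>z. prod_fun (\<lambda>t. - deriv \<Theta> t) F z * V z)"
  define g where "g = (\<lambda>z. prod_fun \<Theta> F z * D z)"
  have supp1: "deriv w s = 0" "deriv (deriv w) s = 0" if "\<bar>s\<bar> > P" for s
  proof -
    have n: "s \<notin> {0..P}" "s + P \<notin> {0..P}" using that P by auto
    show "deriv w s = 0" using b(2)[OF n(1)] b(2)[OF n(2)] by (simp add: dw)
    show "deriv (deriv w) s = 0" using b'0[OF n(1)] b'0[OF n(2)] by (simp add: ddw)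
  qed
  have cdw: "continuous_on UNIV (deriv w)" "continuous_on UNIV (deriv (deriv w))"
    using sdw smooth_real_deriv(2)[OF sdw] smooth_imp_continuous by auto
  have ia: "integrable ?M a"
    unfolding a_def by (rule V.integrable_prod_fun(2)[OF c\<Theta>(2) cF F0])
  have ig: "integrable ?M g"
    unfolding g_def by (rule D.integrable_prod_fun(2)[OF c\<Theta>(1) cF F0])
  have ic: "integrable ?M (c i)" for i
    unfolding c_def dx
    by (rule E.integrable_prod_fun(2)[OF c\<Theta>(1)]) (use cdw cF F0 supp1 in auto)
  have id: "integrable ?M (d i)" for i
  proof -
    have "integrable ?M (\<lambda>z. \<mu> * (prod_fun \<Theta> (F(i := deriv (deriv w))) z * V z))"
      by (intro integrable_mult_right V.integrable_prod_fun(2)[OF c\<Theta>(1)]) (use cdw cF F0 supp1 in auto)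
    then show ?thesis by (simp add: d_def dxx mult.left_commute)
  qed
  have c0: "(\<integral>z. c i z \<partial>?M) = 0" for i
    unfolding c_def dx unfolding dw
    by (rule E.integral_translation_difference[OF c\<Theta>(1) cF cb(1) F0 b(2)])
  have d0: "(\<integral>z. d i z \<partial>?M) = 0" for i
  proof -
    have "(\<integral>z. d i z \<partial>?M) = \<mu> * (\<integral>z. prod_fun \<Theta> (F(i := \<lambda>s. b' (s + P) - b' s)) z * V z \<partial>?M)"
      unfolding d_def dxx ddw by (subst integral_mult_right_zero[symmetric]) (simp add: mult.left_commute)
    then show ?thesis
      using V.integral_translation_difference[OF c\<Theta>(1) cF cb(2) F0 b'0] by simp
  qed
  \<comment> \<open>The terms \<open>c i\<close> and \<open>d i\<close> integrate to zero and can be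
    inserted freely; with them the integrand becomes that of the local energy inequality.\<close>
  have "(\<integral>z. a z \<partial>?M) + (\<integral>z. g z \<partial>?M)
      = (\<integral>z. a z - (\<Sum>i\<in>UNIV. c i z) + g z - (\<Sum>i\<in>UNIV. d i z) \<partial>?M)"
    using ia ig ic id c0 d0 by (simp add: Bochner_Integration.integral_sum)
  also have "\<dots> = (\<integral>(t, x). - ((norm (v t x))\<^sup>2 / 2 * dt \<phi> (t, x))
                 - ((norm (v t x))\<^sup>2 / 2 + \<pi> t x) * (v t x \<bullet> grad \<phi> (t, x))
                 + \<mu> * (norm (G t x))\<^sup>2 * \<phi> (t, x)
                 - \<mu> * ((norm (v t x))\<^sup>2 / 2) * lap \<phi> (t, x) \<partial>?M)"
    unfolding a_def c_def g_def d_def dt grad_def lap_def V_def D_def E_def \<phi>_def[symmetric]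
    by (rule Bochner_Integration.integral_cong[OF refl])
      (simp add: split_beta prod_fun_def inner_vec_def sum_distrib_left sum_distrib_right sum_divide_distrib mult_ac)
  also have "\<dots> \<le> (\<integral>x. (norm (u0 x))\<^sup>2 / 2 * \<phi> (0, x) \<partial>lebesgue)
      + (\<integral>(t, x). (f t x \<bullet> v t x) * \<phi> (t, x) \<partial>?M)"
    using G(3) test \<phi>0 unfolding local_energy_inequality_def by (simp add: algebra_simps)
  also have "(\<integral>x. (norm (u0 x))\<^sup>2 / 2 * \<phi> (0, x) \<partial>lebesgue)
      = \<Theta> 0 * (\<integral>x. (norm (u0 x))\<^sup>2 / 2 * (\<Prod>j\<in>UNIV. w (x $ j)) \<partial>lebesgue)"
    by (subst integral_mult_right_zero[symmetric]) (simp add: \<phi>_def prod_fun_def F_def mult_ac)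
  finally have "(\<integral>z. a z \<partial>?M) + (\<integral>z. g z \<partial>?M)
    \<le> \<Theta> 0 * (\<integral>x. (norm (u0 x))\<^sup>2 / 2 * (\<Prod>j\<in>UNIV. w (x $ j)) \<partial>lebesgue)
      + (\<integral>z. \<phi> z * (f (fst z) (snd z) \<bullet> v (fst z) (snd z)) \<partial>?M)"
    by (simp add: case_prod_beta' mult.commute)
  \<comment> \<open>The dissipation has a favourable sign and is discarded, which removes \<mu> from
    the estimate.\<close>
  moreover have "0 \<le> (\<integral>z. g z \<partial>?M)"
    by (rule Bochner_Integration.integral_nonneg) (use \<mu> \<phi>0 in \<open>auto simp: g_def D_def \<phi>_def[symmetric]\<close>)
  ultimately show ?thesis
    unfolding a_def V_def \<phi>_def F_def by simp
qed

text \<open>Both the data terms and the averaged energy carry the factor R, the total mass of the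
  bump \<open>\<rho>\<close> in time. It cancels, so the bound does not depend on how short the time
  window after \<open>\<tau>\<close> has to be, and \<open>K\<close> can be fixed before \<mu> and
  the solution.\<close>

lemma energy_bound:
  assumes P: "P > 0" and T: "T > 0"
    and f: "\<forall>t\<ge>0. periodic P (f t)" "in_Lp_Lp P T 2 2 f"
  obtains K where "K \<ge> 0"
    "\<And>\<mu> v \<pi> \<tau>. \<mu> > 0 \<Longrightarrow> NS_weak_solution P \<mu> u0 f v \<pi> \<Longrightarrow> 0 < \<tau> \<Longrightarrow> \<tau> < T \<Longrightarrow>
       (\<integral>x. (norm (v \<tau> x))\<^sup>2 \<partial>torus_measure P) \<le> K"
proof -
  let ?Q = "lebesgue_on ({0..<T} \<times> torus P)" and ?M = "lebesgue_on ({0..<T} \<times> (UNIV :: space set))"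
  obtain b :: "real \<Rightarrow> real" where b: "smooth b" "\<And>s. 0 \<le> b s" "\<And>s. b s > 0 \<longleftrightarrow> 0 < s \<and> s < P"
    by (rule smooth_bump[of 0 P]) (rule that)
  obtain w :: "real \<Rightarrow> real" where w: "smooth w" "\<And>x. 0 \<le> w x" "\<And>x. w x > 0 \<longleftrightarrow> 0 - P < x \<and> x < P \<and> 0 < P"
    "\<And>x. (w has_real_derivative b (x + P) - b x) (at x)" "\<And>x. w x = integral {x..x + P} b"
    by (rule smooth_window[OF b P]) (rule that)
  have b0: "b s = 0" if "s \<notin> {0..P}" for s
    using b(2)[of s] b(3)[of s] that by (auto simp: less_le)
  have w0: "w s = 0" if "\<bar>s\<bar> > P" for s
    using w(2)[of s] w(3)[of s] that by (auto simp: less_le)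
  have cw: "continuous_on S w" for S by (rule smooth_imp_continuous[OF w(1)])
  define X :: "space \<Rightarrow> real" where "X = (\<lambda>x. \<Prod>j\<in>UNIV. w (x $ j))"
  have X0: "0 \<le> X x" for x unfolding X_def by (intro prod_nonneg) (auto intro: w(2))
  have pf: "prod_fun \<Theta> (\<lambda>_. w) z = \<Theta> (fst z) * X (snd z)" for \<Theta> z
    by (simp add: prod_fun_def X_def)
  \<comment> \<open>The closed cell has half-width P / 2 and so lies inside the open set where the
    weight is positive; compactness gives a positive lower bound.\<close>
  obtain c where c: "c > 0" "\<And>x. x \<in> torus P \<Longrightarrow> c \<le> X x"
  proof -
    have "continuous_on (torus P) X"
      unfolding X_def by (intro continuous_on_prod continuous_on_compose2[OF cw[of UNIV]] continuous_intros) auto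
    moreover have "compact (torus P)" by (simp add: torus_def)
    moreover have "0 \<in> torus P" using P by (simp add: torus_def mem_box_cart)
    then have "torus P \<noteq> {}" by blast
    ultimately obtain x0 where x0: "x0 \<in> torus P" "\<And>x. x \<in> torus P \<Longrightarrow> X x0 \<le> X x"
      using continuous_attains_inf by metis
    have "w (x0 $ j) > 0" for j
    proof -
      have "- P / 2 \<le> x0 $ j" "x0 $ j \<le> P / 2" using x0(1) by (auto simp: torus_def mem_box_cart)
      then show ?thesis using P by (subst w(3)) auto
    qed
    then have "X x0 > 0" unfolding X_def by (intro prod_pos) auto
    then show thesis using that x0(2) by blast
  qed
  define E0 where "E0 = (\<integral>x. (norm (u0 x))\<^sup>2 / 2 * X x \<partial>lebesgue)"
  define f2 where "f2 = (\<lambda>z. (norm (f (fst z) (snd z)))\<^sup>2 / 2)"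
  define F0 where "F0 = (\<integral>z. prod_fun (\<lambda>_. 1) (\<lambda>_. w) z * f2 z \<partial>?M)"
  have "E0 \<ge> 0" "F0 \<ge> 0"
    unfolding E0_def F0_def pf by (auto intro!: Bochner_Integration.integral_nonneg simp: f2_def X0)
  \<comment> \<open>The factor 2 undoes the half in the energy density, \<open>exp T\<close> the
    decay of exp(-t) up to time T, and \<open>1 / c\<close> the passage from the weight to the
    cell.\<close>
  define K where "K = 2 * exp T * (E0 + F0) / c"
  have K: "K \<ge> 0" using \<open>E0 \<ge> 0\<close> \<open>F0 \<ge> 0\<close> c by (simp add: K_def)
  interpret F: slab P T f2
    by unfold_locales (use P f in_Lp_Lp_2_integrable[OF f(2)] in \<open>auto simp: f2_def periodic_def\<close>)
  show ?thesis
  proof (rule that[OF K], rule field_le_epsilon)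
    \<comment> \<open>The slack \<open>\<delta>\<close> pays for replacing the energies in a window
      after \<open>\<tau>\<close> by the energy at \<open>\<tau>\<close> itself.\<close>
    fix \<mu> v \<pi> \<tau> \<delta> assume \<mu>: "\<mu> > (0::real)" and NS: "NS_weak_solution P \<mu> u0 f v \<pi>"
      and \<tau>: "0 < \<tau>" "\<tau> < T" and \<delta>: "(0::real) < \<delta>"
    define N where "N = (\<integral>x. (norm (v \<tau> x))\<^sup>2 \<partial>torus_measure P)"
    have v2: "in_Lp_Lp P T 2 2 v" and vw: "in_C_L2w P T v"
      using NS T by (auto simp: NS_weak_solution_def in_L2_H1_def)
    have perv: "periodic P (v t)" if "t \<ge> 0" for t
      using NS that by (auto simp: NS_weak_solution_def)
    define V where "V = (\<lambda>z. (norm (v (fst z) (snd z)))\<^sup>2 / 2)"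
    define fv where "fv = (\<lambda>z. f (fst z) (snd z) \<bullet> v (fst z) (snd z))"
    interpret V: slab P T V
      by unfold_locales (use P perv in_Lp_Lp_2_integrable[OF v2] in \<open>auto simp: V_def periodic_def\<close>)
    interpret fv: slab P T fv
      by unfold_locales (use P perv f(1) integrable_inner_L2[OF in_Lp_Lp_2_measurable[OF f(2)]
          in_Lp_Lp_2_measurable[OF v2] in_Lp_Lp_2_integrable[OF f(2)] in_Lp_Lp_2_integrable[OF v2]]
          in \<open>auto simp: fv_def periodic_def\<close>)
    obtain \<epsilon> where \<epsilon>: "\<epsilon> > 0" "\<tau> + \<epsilon> < T"
      "\<And>t. \<tau> < t \<Longrightarrow> t < \<tau> + \<epsilon> \<Longrightarrow> N - \<delta> \<le> (\<integral>x. (norm (v t x))\<^sup>2 \<partial>torus_measure P)"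
      by (rule in_C_L2w_lower_semicontinuous[OF vw \<tau> \<delta>, folded N_def]) (rule that)
    obtain \<rho> :: "real \<Rightarrow> real" where \<rho>: "smooth \<rho>" "\<And>s. 0 \<le> \<rho> s" "\<And>s. \<rho> s > 0 \<longleftrightarrow> \<tau> < s \<and> s < \<tau> + \<epsilon>"
      by (rule smooth_bump[of \<tau> "\<tau> + \<epsilon>"]) (rule that)
    \<comment> \<open>Averaging over the length T + 1 pushes the second translate of
      \<open>\<rho>\<close> to negative times. For t \<ge> 0 the average \<open>\<eta>\<close> thus
      equals the mass R up to \<open>\<tau>\<close>, falls with slope \<open>- \<rho>\<close> inside
      the window, and vanishes afterwards.\<close>
    have "T + 1 > 0" using T by simp
    obtain \<eta> :: "real \<Rightarrow> real" where \<eta>: "smooth \<eta>" "\<And>x. 0 \<le> \<eta> x"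
      "\<And>x. \<eta> x > 0 \<longleftrightarrow> \<tau> - (T + 1) < x \<and> x < \<tau> + \<epsilon> \<and> \<tau> < \<tau> + \<epsilon>"
      "\<And>x. (\<eta> has_real_derivative \<rho> (x + (T + 1)) - \<rho> x) (at x)"
      "\<And>x. \<eta> x = integral {x..x + (T + 1)} \<rho>"
      by (rule smooth_window[OF \<rho> \<open>T + 1 > 0\<close>]) (rule that)
    have \<rho>0: "\<rho> s = 0" if "\<not> (\<tau> < s \<and> s < \<tau> + \<epsilon>)" for s
      using \<rho>(2)[of s] \<rho>(3)[of s] that by (auto simp: less_le)
    have \<eta>': "(\<eta> has_real_derivative - \<rho> t) (at t)" if "t \<ge> 0" for t
      using \<eta>(4)[of t] \<rho>0[of "t + (T + 1)"] \<epsilon>(2) that by simp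
    define R where "R = \<eta> 0"
    have R: "R > 0" unfolding R_def using \<tau> \<epsilon>(1) by (subst \<eta>(3)) auto
    have \<eta>R: "\<eta> t \<le> R" if "t \<ge> 0" for t
      unfolding R_def using that \<eta>' \<rho>(2) by (intro DERIV_nonpos_imp_nonincreasing[of 0 t]) fastforce+
    have c\<rho>: "continuous_on S \<rho>" for S by (rule smooth_imp_continuous[OF \<rho>(1)])
    have R_nn: "ennreal R = (\<integral>\<^sup>+t. \<rho> t \<partial>lebesgue_on {0..<T})"
    proof -
      have i: "integrable (lebesgue_on {0..T + 1}) \<rho>"
        by (rule continuous_imp_integrable_real[OF c\<rho>])
      have "R = integral\<^sup>L (lebesgue_on {0..T + 1}) \<rho>"
        unfolding R_def \<eta>(5) using lebesgue_integral_eq_integral[OF i] by simp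
      then have "ennreal R = (\<integral>\<^sup>+t. \<rho> t \<partial>lebesgue_on {0..T + 1})"
        using i \<rho>(2) by (simp add: nn_integral_eq_integral)
      also have "\<dots> = (\<integral>\<^sup>+t. \<rho> t \<partial>lebesgue_on {0..<T})"
        using \<rho>0 \<tau> \<epsilon>
        by (subst (1 2) nn_integral_restrict_space) (auto intro!: nn_integral_cong split: split_indicator)
      finally show ?thesis .
    qed
    define \<Theta> where "\<Theta> = (\<lambda>t. exp (- t) * \<eta> t)"
    have d\<Theta>: "deriv \<Theta> t = - \<Theta> t - exp (- t) * \<rho> t" if "t \<ge> 0" for t
    proof -
      have "(\<Theta> has_real_derivative - exp (- t) * \<eta> t + exp (- t) * (- \<rho> t)) (at t)"
        unfolding \<Theta>_def using \<eta>'[OF that] by (auto intro!: derivative_eq_intros)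
      then show ?thesis by (simp add: DERIV_imp_deriv \<Theta>_def)
    qed
    have s\<Theta>: "smooth \<Theta>" unfolding \<Theta>_def by (intro smooth_mult smooth_exp_minus \<eta>(1))
    have c\<Theta>: "continuous_on UNIV \<Theta>" by (rule smooth_imp_continuous[OF s\<Theta>])
    have \<Theta>0: "0 \<le> \<Theta> t" for t by (simp add: \<Theta>_def \<eta>(2))
    have \<Theta>R: "\<Theta> t \<le> R" if "t \<ge> 0" for t
    proof -
      have "\<Theta> t \<le> 1 * \<eta> t" unfolding \<Theta>_def using that \<eta>(2) by (intro mult_right_mono) auto
      then show ?thesis using \<eta>R[OF that] by simp
    qed
    have supp: "\<Theta> t = 0" if "t \<notin> {\<tau> - (T + 1)..\<tau> + \<epsilon>}" for t
      using \<eta>(2)[of t] \<eta>(3)[of t] that by (auto simp: \<Theta>_def less_le)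
    let ?\<rho> = "\<lambda>t. exp (- t) * \<rho> t"
    have cexp\<rho>: "continuous_on UNIV ?\<rho>" by (intro continuous_intros c\<rho>)
    note pint = V.integrable_prod_fun(2)[OF _ cw w0] F.integrable_prod_fun(2)[OF _ cw w0]
      fv.integrable_prod_fun(2)[OF _ cw w0]
    note i = pint(1)[OF c\<Theta>] pint(2)[OF c\<Theta>] pint(3)[OF c\<Theta>] pint(1)[OF cexp\<rho>] pint(2)[OF continuous_on_const, of 1]
    \<comment> \<open>For t \<ge> 0 the function \<open>- deriv \<Theta>\<close> is the sum of
      \<open>\<Theta>\<close> and \<open>exp (- t) * \<rho> t\<close>. The second summand produces
      the average to be estimated.\<close>
    have "(\<integral>z. prod_fun \<Theta> (\<lambda>_. w) z * V z \<partial>?M) + (\<integral>z. prod_fun ?\<rho> (\<lambda>_. w) z * V z \<partial>?M)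
      = (\<integral>z. prod_fun \<Theta> (\<lambda>_. w) z * V z + prod_fun ?\<rho> (\<lambda>_. w) z * V z \<partial>?M)"
      by (rule Bochner_Integration.integral_add[OF i(1,4), symmetric])
    also have "\<dots> = (\<integral>z. prod_fun (\<lambda>t. - deriv \<Theta> t) (\<lambda>_. w) z * V z \<partial>?M)"
      by (rule Bochner_Integration.integral_cong[OF refl]) (auto simp: pf d\<Theta> algebra_simps)
    also have "\<dots> \<le> \<Theta> 0 * E0 + (\<integral>z. prod_fun \<Theta> (\<lambda>_. w) z * fv z \<partial>?M)"
      unfolding V_def fv_def E0_def X_def
      by (rule cell_energy_inequality[OF P \<mu> T f NS b(1) b0 w(1,2) w0 w(4) s\<Theta> \<Theta>0 supp \<epsilon>(2)])
    also have "\<Theta> 0 = R" by (simp add: \<Theta>_def R_def)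
    \<comment> \<open>Young's inequality with weights 1/2 and 1/2: the quadratic term in
      \<open>v\<close> is exactly the \<open>\<Theta>\<close> term on the left, and the two
      cancel.\<close>
    also have "(\<integral>z. prod_fun \<Theta> (\<lambda>_. w) z * fv z \<partial>?M)
        \<le> (\<integral>z. R * (prod_fun (\<lambda>_. 1) (\<lambda>_. w) z * f2 z) + prod_fun \<Theta> (\<lambda>_. w) z * V z \<partial>?M)"
    proof (rule integral_mono)
      fix z assume "z \<in> space ?M"
      then have z: "fst z \<ge> 0" by auto
      have "fv z \<le> f2 z + V z"
        using two_inner_le[of "f (fst z) (snd z)" "v (fst z) (snd z)"] by (simp add: fv_def f2_def V_def)
      then have "prod_fun \<Theta> (\<lambda>_. w) z * fv z \<le> \<Theta> (fst z) * X (snd z) * (f2 z + V z)"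
        unfolding pf by (intro mult_left_mono mult_nonneg_nonneg \<Theta>0 X0)
      also have "\<dots> \<le> R * X (snd z) * f2 z + \<Theta> (fst z) * X (snd z) * V z"
        unfolding distrib_left
        by (intro add_mono mult_right_mono \<Theta>R z X0) (auto simp: f2_def V_def)
      finally show "prod_fun \<Theta> (\<lambda>_. w) z * fv z
          \<le> R * (prod_fun (\<lambda>_. 1) (\<lambda>_. w) z * f2 z) + prod_fun \<Theta> (\<lambda>_. w) z * V z"
        by (simp add: pf mult.assoc)
    qed (use i in auto)
    also have "\<dots> = R * F0 + (\<integral>z. prod_fun \<Theta> (\<lambda>_. w) z * V z \<partial>?M)"
      using i by (simp add: F0_def)
    finally have J: "(\<integral>z. prod_fun ?\<rho> (\<lambda>_. w) z * V z \<partial>?M) \<le> R * (E0 + F0)"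
      by (simp add: algebra_simps)
    show "(\<integral>x. (norm (v \<tau> x))\<^sup>2 \<partial>torus_measure P) \<le> K + \<delta>"
    proof (cases "N \<le> \<delta>")
      case True
      then show ?thesis using K by (simp add: N_def)
    next
      case False
      \<comment> \<open>As N - \<delta> is positive, the comparison can run in extended nonnegative
        integrals: first in time over the window, then over the slab by Tonelli, finally over all of
        space by positivity of the weight.\<close>
      let ?a = "exp (- T) * c / 2"
      have a: "?a > 0" using c by simp
      have mQ: "(\<lambda>z. ennreal (?a * \<rho> (fst z) * (norm (v (fst z) (snd z)))\<^sup>2)) \<in> borel_measurable ?Q"
      proof -
        have "(\<lambda>z :: real \<times> space. \<rho> (fst z)) \<in> borel_measurable ?Q"
          by (intro measurable_restrict_space1 measurable_completion)
            (simp add: borel_measurable_continuous_onI continuous_on_compose2[OF c\<rho>[of UNIV]] continuous_intros)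
        then show ?thesis
          by (intro measurable_compose[OF _ measurable_ennreal] borel_measurable_times borel_measurable_power
              borel_measurable_const measurable_compose[OF in_Lp_Lp_2_measurable[OF v2] borel_measurable_norm])
      qed
      have "ennreal (?a * (N - \<delta>) * R) = (\<integral>\<^sup>+t. ennreal (?a * (N - \<delta>)) * \<rho> t \<partial>lebesgue_on {0..<T})"
      proof -
        have "(\<lambda>t. ennreal (\<rho> t)) \<in> borel_measurable (lebesgue_on {0..<T})"
          by (intro measurable_restrict_space1 measurable_completion measurable_compose[OF _ measurable_ennreal])
            (simp add: borel_measurable_continuous_onI c\<rho>)
        then have "(\<integral>\<^sup>+t. ennreal (?a * (N - \<delta>)) * \<rho> t \<partial>lebesgue_on {0..<T})
            = ennreal (?a * (N - \<delta>)) * ennreal R"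
          by (simp only: nn_integral_cmult R_nn)
        also have "\<dots> = ennreal (?a * (N - \<delta>) * R)"
          using False R by (intro ennreal_mult[symmetric] mult_nonneg_nonneg less_imp_le[OF a]) auto
        finally show ?thesis ..
      qed
      also have "\<dots> \<le> (\<integral>\<^sup>+t. \<integral>\<^sup>+x. ennreal (?a * \<rho> t * (norm (v t x))\<^sup>2) \<partial>torus_measure P \<partial>lebesgue_on {0..<T})"
      proof (rule nn_integral_mono)
        fix t assume "t \<in> space (lebesgue_on {0..<T})"
        then have "in_Lp 2 (torus_measure P) (v t)"
          using vw by (auto simp: in_C_L2w_def)
        then have "(\<integral>\<^sup>+x. ennreal (?a * \<rho> t * (norm (v t x))\<^sup>2) \<partial>torus_measure P)
            = ennreal (?a * \<rho> t * (\<integral>x. (norm (v t x))\<^sup>2 \<partial>torus_measure P))"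
          using a \<rho>(2)[of t] by (subst nn_integral_eq_integral) (auto simp: in_Lp_2_iff)
        moreover have "?a * (N - \<delta>) * \<rho> t \<le> ?a * \<rho> t * (\<integral>x. (norm (v t x))\<^sup>2 \<partial>torus_measure P)"
        proof (cases "\<tau> < t \<and> t < \<tau> + \<epsilon>")
          case True
          then have "?a * \<rho> t * (N - \<delta>) \<le> ?a * \<rho> t * (\<integral>x. (norm (v t x))\<^sup>2 \<partial>torus_measure P)"
            using a \<rho>(2)[of t] by (intro mult_left_mono \<epsilon>(3) mult_nonneg_nonneg) auto
          then show ?thesis by (simp add: mult_ac)
        qed (simp add: \<rho>0)
        ultimately show "ennreal (?a * (N - \<delta>)) * \<rho> t
            \<le> (\<integral>\<^sup>+x. ennreal (?a * \<rho> t * (norm (v t x))\<^sup>2) \<partial>torus_measure P)"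
          using a False \<rho>(2)[of t] by (simp add: ennreal_mult[symmetric] ennreal_leI)
      qed
      also have "\<dots> = (\<integral>\<^sup>+z. ennreal (?a * \<rho> (fst z) * (norm (v (fst z) (snd z)))\<^sup>2) \<partial>?Q)"
        using mQ by (subst nn_integral_lebesgue_on_pair) auto
      also have "\<dots> \<le> (\<integral>\<^sup>+z. ennreal (prod_fun ?\<rho> (\<lambda>_. w) z * V z) \<partial>?M)"
      proof -
        have "?a * \<rho> (fst z) * (norm (v (fst z) (snd z)))\<^sup>2 \<le> prod_fun ?\<rho> (\<lambda>_. w) z * V z"
          if "z \<in> {0..<T} \<times> torus P" for z
        proof -
          have "exp (- T) * c \<le> exp (- fst z) * X (snd z)"
            using that c by (intro mult_mono) auto
          then have "exp (- T) * c * (\<rho> (fst z) * V z) \<le> exp (- fst z) * X (snd z) * (\<rho> (fst z) * V z)"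
            using \<rho>(2) by (intro mult_right_mono) (auto simp: V_def)
          then show ?thesis by (simp add: pf V_def mult_ac)
        qed
        then show ?thesis
          by (subst (1 2) nn_integral_restrict_space)
            (auto intro!: Times_in_sets_lebesgue nn_integral_mono ennreal_leI split: split_indicator)
      qed
      also have "\<dots> = ennreal (\<integral>z. prod_fun ?\<rho> (\<lambda>_. w) z * V z \<partial>?M)"
        using i(4) by (intro nn_integral_eq_integral) (auto simp: pf V_def X0 \<rho>(2))
      also have "\<dots> \<le> ennreal (R * (E0 + F0))" by (rule ennreal_leI[OF J])
      finally have "?a * (N - \<delta>) * R \<le> R * (E0 + F0)"
        using R \<open>E0 \<ge> 0\<close> \<open>F0 \<ge> 0\<close> by (simp add: ennreal_le_iff)
      then have "?a * (N - \<delta>) \<le> E0 + F0" using R by simp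
      then have "N - \<delta> \<le> K"
        using c by (simp add: K_def field_simps exp_minus)
      then show ?thesis by (simp add: N_def)
    qed
  qed
qed

section \<open>Fourier series of square integrable functions\<close>

definition mode :: "real \<Rightarrow> int ^ 3 \<Rightarrow> space \<Rightarrow> complex" where
  "mode P n x = cis (2 * pi / P * (int_vec n \<bullet> x))"

lemma norm_mode [simp]: "norm (mode P n x) = 1"
  by (simp add: mode_def)

lemma int_vec_add: "int_vec (m + n) = int_vec m + int_vec n"
  and int_vec_minus: "int_vec (- n) = - int_vec n"
  and int_vec_0: "int_vec 0 = 0"
  by (simp_all add: int_vec_def vec_eq_iff)

lemma mode_add: "mode P (m + n) x = mode P m x * mode P n x"
  by (simp add: mode_def cis_mult int_vec_add inner_add_left distrib_left)

lemma mode_minus: "mode P (- n) x = cnj (mode P n x)"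
  by (simp add: mode_def cis_cnj int_vec_minus)

lemma mode_0 [simp]: "mode P 0 x = 1"
  by (simp add: mode_def int_vec_0)

lemma continuous_mode: "continuous_on S (mode P n)"
  unfolding mode_def by (intro continuous_intros)

lemma integral_lborel_prod:
  fixes f :: "'a::euclidean_space \<Rightarrow> real \<Rightarrow> complex"
  assumes f: "\<And>b. b \<in> Basis \<Longrightarrow> integrable lborel (f b)"
  shows "(\<integral>x. (\<Prod>b\<in>Basis. f b (x \<bullet> b)) \<partial>lborel) = (\<Prod>b\<in>Basis. (\<integral>s. f b s \<partial>lborel))"
proof -
  interpret product_sigma_finite "\<lambda>_::'a. lborel :: real measure" ..
  have m [measurable]: "b \<in> Basis \<Longrightarrow> f b \<in> borel_measurable borel" for b
    using borel_measurable_integrable[OF f] by simp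
  have "(\<integral>x. (\<Prod>b\<in>Basis. f b (x \<bullet> b)) \<partial>lborel)
      = (\<integral>g. (\<Prod>b\<in>Basis. f b ((\<Sum>b\<in>Basis. g b *\<^sub>R b) \<bullet> b)) \<partial>(\<Pi>\<^sub>M b\<in>Basis. lborel))"
    by (subst lborel_eq, subst integral_distr) auto
  also have "\<dots> = (\<integral>g. (\<Prod>b\<in>Basis. f b (g b)) \<partial>(\<Pi>\<^sub>M b\<in>Basis. lborel))"
    by simp
  also have "\<dots> = (\<Prod>b\<in>Basis. (\<integral>s. f b s \<partial>lborel))"
    by (rule product_integral_prod) (use f in auto)
  finally show ?thesis .
qed

lemma integral_cis_period:
  assumes P: "P > 0" and m: "m \<noteq> 0"
  shows "(\<integral>s. indicator {- P / 2..P / 2} s *\<^sub>R cis (2 * pi / P * (of_int m * s)) \<partial>lborel) = 0"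
proof -
  define a where "a = 2 * pi / P * of_int m"
  have a: "a \<noteq> 0" using P m by (simp add: a_def)
  have d: "((\<lambda>s. cis (a * s) / (\<i> * of_real a)) has_vector_derivative cis (a * s)) (at s within S)" for s S
  proof -
    have "((\<lambda>s. exp (\<i> * of_real a * of_real s) / (\<i> * of_real a)) has_vector_derivative
        exp (\<i> * of_real a * of_real s)) (at s within S)"
      using a by (auto intro!: derivative_eq_intros has_vector_derivative_real_field
        simp: field_simps)
    then show ?thesis by (simp add: cis_conv_exp mult_ac)
  qed
  have "(\<integral>s. indicator {- P / 2..P / 2} s *\<^sub>R cis (a * s) \<partial>lborel)
      = cis (a * (P / 2)) / (\<i> * of_real a) - cis (a * (- P / 2)) / (\<i> * of_real a)"
    using P by (intro integral_FTC_Icc d) (auto intro!: continuous_intros)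
  also have "cis (a * (P / 2)) = cis (a * (- P / 2)) * cis (2 * pi * of_int m)"
    using P by (simp add: cis_mult a_def field_simps)
  also have "cis (2 * pi * of_int m) = 1" by (simp add: cis_multiple_2pi)
  finally show ?thesis by (simp add: a_def mult_ac)
qed

lemma integrable_torus_continuous:
  fixes g :: "space \<Rightarrow> 'b::euclidean_space"
  assumes "continuous_on UNIV g"
  shows "integrable (torus_measure P) g"
  unfolding torus_def by (intro continuous_imp_integrable continuous_on_subset[OF assms]) auto

text \<open>The mode is a product over the coordinates, and a nonzero index has a coordinate whose
  factor integrates to zero over a period.\<close>

lemma integral_mode:
  assumes P: "P > 0" and n: "n \<noteq> 0"
  shows "(\<integral>x. mode P n x \<partial>torus_measure P) = 0"
proof -
  define h where "h = (\<lambda>b s. indicator {- P / 2..P / 2} s *\<^sub>R cis (2 * pi / P * ((int_vec n \<bullet> b) * s)))"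
  have int: "integrable lborel (h b)" for b
    unfolding h_def set_integrable_def[symmetric]
    using P by (intro borel_integrable_atLeastAtMost') (auto intro!: continuous_intros)
  have "(\<integral>x. mode P n x \<partial>torus_measure P) = (\<integral>x. indicator (torus P) x *\<^sub>R mode P n x \<partial>lebesgue)"
    by (subst integral_restrict_space) auto
  also have "\<dots> = (\<integral>x. indicator (torus P) x *\<^sub>R mode P n x \<partial>lborel)"
    using borel_measurable_continuous_onI[OF continuous_mode, of P n]
    by (intro integral_completion borel_measurable_scaleR borel_measurable_indicator) simp_all
  also have "\<dots> = (\<integral>x. (\<Prod>b\<in>Basis. h b (x \<bullet> b)) \<partial>lborel)"
  proof (rule Bochner_Integration.integral_cong[OF refl])
    fix x :: space
    have "(\<Prod>b\<in>Basis. h b (x \<bullet> b)) = (\<Prod>b\<in>Basis. indicator {- P / 2..P / 2} (x \<bullet> b)) *\<^sub>R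
        (\<Prod>b\<in>Basis. cis (2 * pi / P * ((int_vec n \<bullet> b) * (x \<bullet> b))))"
      by (simp add: h_def scaleR_conv_of_real prod.distrib)
    also have "(\<Prod>b\<in>Basis. indicator {- P / 2..P / 2} (x \<bullet> b)) = (indicator (torus P) x :: real)"
    proof -
      have "x \<in> torus P \<longleftrightarrow> (\<forall>b\<in>Basis. x \<bullet> b \<in> {- P / 2..P / 2})"
        by (auto simp: torus_def mem_box Basis_vec_def inner_axis)
      then show ?thesis
        by (auto simp: indicator_def prod_zero_iff)
    qed
    also have "(\<Prod>b\<in>Basis. cis (2 * pi / P * ((int_vec n \<bullet> b) * (x \<bullet> b)))) = mode P n x"
    proof -
      have "(\<Prod>b\<in>B. cis (f b)) = cis (\<Sum>b\<in>B. f b)" for f :: "space \<Rightarrow> real" and B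
        by (induction B rule: infinite_finite_induct) (auto simp: cis_mult)
      then show ?thesis
        by (simp add: mode_def euclidean_inner[of "int_vec n" x] sum_distrib_left)
    qed
    finally show "indicator (torus P) x *\<^sub>R mode P n x = (\<Prod>b\<in>Basis. h b (x \<bullet> b))" by simp
  qed
  also have "\<dots> = (\<Prod>b\<in>Basis. (\<integral>s. h b s \<partial>lborel))"
    by (rule integral_lborel_prod[OF int])
  also have "\<dots> = 0"
  proof -
    obtain i where i: "n $ i \<noteq> 0" using n by (auto simp: vec_eq_iff)
    have "int_vec n \<bullet> axis i 1 = of_int (n $ i)" by (simp add: inner_axis int_vec_def)
    then have "(\<integral>s. h (axis i 1) s \<partial>lborel) = 0"
      using integral_cis_period[OF P i] by (simp add: h_def)
    moreover have "axis i 1 \<in> (Basis :: space set)" by (auto simp: Basis_vec_def)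
    ultimately show ?thesis by (auto simp: prod_zero_iff)
  qed
  finally show ?thesis .
qed

definition tvol :: "real \<Rightarrow> real" where
  "tvol P = measure lebesgue (torus P)"

lemma tvol_pos: "P > 0 \<Longrightarrow> tvol P > 0"
  unfolding tvol_def torus_def
  by (simp add: content_pos_lt_eq Basis_vec_def inner_axis)

lemma integral_mode_orthogonal:
  assumes "P > 0"
  shows "(\<integral>x. mode P m x * cnj (mode P n x) \<partial>torus_measure P) = (if m = n then of_real (tvol P) else 0)"
proof -
  have "mode P m x * cnj (mode P n x) = mode P (m - n) x" for x
    using mode_add[of P m "- n" x] by (simp add: mode_minus)
  then show ?thesis
    using integral_mode[OF assms, of "m - n"]
    by (auto simp: tvol_def measure_restrict_space scaleR_conv_of_real)
qed

section \<open>Fourier coefficients and distance to trigonometric sums\<close>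

definition coef :: "real \<Rightarrow> (space \<Rightarrow> complex) \<Rightarrow> int ^ 3 \<Rightarrow> complex" where
  "coef P g n = (\<integral>x. g x * cnj (mode P n x) \<partial>torus_measure P) / of_real (tvol P)"

lemma finite_measure_torus: "finite_measure (torus_measure P)"
  unfolding torus_def by (intro finite_measure_lebesgue_on) auto

lemma integrable_torus_L2:
  fixes g :: "space \<Rightarrow> 'b::euclidean_space"
  assumes "g \<in> borel_measurable (torus_measure P)" "integrable (torus_measure P) (\<lambda>x. (norm (g x))\<^sup>2)"
  shows "integrable (torus_measure P) g"
  using finite_measure.square_integrable_imp_integrable[OF finite_measure_torus, of "\<lambda>x. norm (g x)" P] assms
  by (simp add: integrable_norm_iff borel_measurable_norm)

text \<open>Completing the square in the coefficients. Because \<open>a\<close> is arbitrary, one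
  identity contains both Bessel's inequality, at \<open>a = coef P g\<close>, and the optimality of
  that choice.\<close>

lemma L2_distance_trig_sum:
  fixes g :: "space \<Rightarrow> complex"
  assumes P: "P > 0" and g: "g \<in> borel_measurable (torus_measure P)"
    "integrable (torus_measure P) (\<lambda>x. (norm (g x))\<^sup>2)" and F: "finite F"
  shows "integrable (torus_measure P) (\<lambda>x. (norm (g x - (\<Sum>n\<in>F. a n * mode P n x)))\<^sup>2)"
    and "(\<integral>x. (norm (g x - (\<Sum>n\<in>F. a n * mode P n x)))\<^sup>2 \<partial>torus_measure P)
      = (\<integral>x. (norm (g x))\<^sup>2 \<partial>torus_measure P) - tvol P * (\<Sum>n\<in>F. (norm (coef P g n))\<^sup>2)
        + tvol P * (\<Sum>n\<in>F. (norm (a n - coef P g n))\<^sup>2)"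
proof -
  let ?M = "torus_measure P"
  define p where "p = (\<lambda>x. \<Sum>n\<in>F. a n * mode P n x)"
  have p: "p x = (\<Sum>n\<in>F. a n * mode P n x)" for x by (simp add: p_def)
  have ig: "integrable ?M g" by (rule integrable_torus_L2[OF g])
  have igm: "integrable ?M (\<lambda>x. g x * cnj (mode P n x))" for n
  proof (rule Bochner_Integration.integrable_bound[OF ig])
    show "(\<lambda>x. g x * cnj (mode P n x)) \<in> borel_measurable ?M"
      unfolding mode_minus[symmetric]
      by (intro borel_measurable_times g(1) borel_measurable_integrable[OF integrable_torus_continuous[OF continuous_mode]])
  qed (simp add: norm_mult)
  have gp: "g x * cnj (p x) = (\<Sum>n\<in>F. cnj (a n) * (g x * cnj (mode P n x)))" for x
    by (simp add: p_def sum_distrib_left mult_ac)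
  have igp: "integrable ?M (\<lambda>x. g x * cnj (p x))"
    unfolding gp by (intro Bochner_Integration.integrable_sum integrable_mult_right igm)
  have "(\<integral>x. g x * cnj (p x) \<partial>?M) = (\<Sum>n\<in>F. cnj (a n) * (coef P g n * of_real (tvol P)))"
    unfolding gp using igm tvol_pos[OF P] by (subst Bochner_Integration.integral_sum) (auto simp: coef_def)
  then have Igp: "(\<integral>x. Re (g x * cnj (p x)) \<partial>?M) = tvol P * (\<Sum>n\<in>F. Re (cnj (a n) * coef P g n))"
    using integral_Re[OF igp] by (simp add: sum_distrib_left algebra_simps)
  have pp: "p x * cnj (p x) = (\<Sum>m\<in>F. \<Sum>n\<in>F. a m * cnj (a n) * (mode P m x * cnj (mode P n x)))" for x
    by (simp add: p_def sum_product mult_ac)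
  have imm: "integrable ?M (\<lambda>x. mode P m x * cnj (mode P n x))" for m n
    unfolding mode_minus[symmetric] mode_add[symmetric] by (rule integrable_torus_continuous[OF continuous_mode])
  have ipp: "integrable ?M (\<lambda>x. p x * cnj (p x))"
    unfolding pp by (intro Bochner_Integration.integrable_sum integrable_mult_right imm)
  have "(\<integral>x. p x * cnj (p x) \<partial>?M) = (\<Sum>m\<in>F. \<Sum>n\<in>F. a m * cnj (a n) * (if m = n then of_real (tvol P) else 0))"
    unfolding pp using imm
    by (simp add: Bochner_Integration.integral_sum Bochner_Integration.integrable_sum integral_mode_orthogonal[OF P])
  also have "\<dots> = (\<Sum>m\<in>F. of_real (tvol P * (norm (a m))\<^sup>2))"
    using F by (simp add: if_distrib[of "(*) _"] sum.delta' complex_norm_square[symmetric] mult.commute cong: if_cong)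
  finally have Ipp: "(\<integral>x. Re (p x * cnj (p x)) \<partial>?M) = tvol P * (\<Sum>m\<in>F. (norm (a m))\<^sup>2)"
    using integral_Re[OF ipp] by (simp add: sum_distrib_left)
  have eq: "(norm (g x - p x))\<^sup>2 = (norm (g x))\<^sup>2 - 2 * Re (g x * cnj (p x)) + Re (p x * cnj (p x))" for x
    unfolding cmod_power2 by (simp add: power2_eq_square algebra_simps)
  define A where "A = (\<lambda>x. Re (g x * cnj (p x)))"
  define B where "B = (\<lambda>x. Re (p x * cnj (p x)))"
  have i: "integrable ?M A" "integrable ?M B"
    unfolding A_def B_def
    by (rule integrable_bounded_linear[OF bounded_linear_Re igp])
      (rule integrable_bounded_linear[OF bounded_linear_Re ipp])
  have eq': "(norm (g x - p x))\<^sup>2 = (norm (g x))\<^sup>2 - 2 * A x + B x" for x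
    unfolding A_def B_def by (rule eq)
  show "integrable ?M (\<lambda>x. (norm (g x - (\<Sum>n\<in>F. a n * mode P n x)))\<^sup>2)"
    unfolding p[symmetric] eq' using g(2) i by simp
  have "(\<integral>x. (norm (g x - p x))\<^sup>2 \<partial>?M)
      = (\<integral>x. (norm (g x))\<^sup>2 \<partial>?M) - 2 * (\<integral>x. A x \<partial>?M) + (\<integral>x. B x \<partial>?M)"
    unfolding eq' using g(2) i by simp
  also have "\<dots> = (\<integral>x. (norm (g x))\<^sup>2 \<partial>?M) - 2 * (tvol P * (\<Sum>n\<in>F. Re (cnj (a n) * coef P g n)))
        + tvol P * (\<Sum>m\<in>F. (norm (a m))\<^sup>2)"
    unfolding A_def B_def Igp Ipp ..
  finally have "(\<integral>x. (norm (g x - p x))\<^sup>2 \<partial>?M)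
      = (\<integral>x. (norm (g x))\<^sup>2 \<partial>?M) - 2 * (tvol P * (\<Sum>n\<in>F. Re (cnj (a n) * coef P g n)))
        + tvol P * (\<Sum>m\<in>F. (norm (a m))\<^sup>2)" .
  moreover have "(\<Sum>n\<in>F. (norm (a n - coef P g n))\<^sup>2)
      = (\<Sum>n\<in>F. (norm (a n))\<^sup>2) - 2 * (\<Sum>n\<in>F. Re (cnj (a n) * coef P g n)) + (\<Sum>n\<in>F. (norm (coef P g n))\<^sup>2)"
  proof -
    have "(norm (a n - coef P g n))\<^sup>2
        = (norm (a n))\<^sup>2 - 2 * Re (cnj (a n) * coef P g n) + (norm (coef P g n))\<^sup>2" for n
      unfolding cmod_power2 by (simp add: power2_eq_square algebra_simps)
    then show ?thesis
      by (simp only: sum.distrib sum_subtractf sum_distrib_left)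
  qed
  ultimately show "(\<integral>x. (norm (g x - (\<Sum>n\<in>F. a n * mode P n x)))\<^sup>2 \<partial>?M)
      = (\<integral>x. (norm (g x))\<^sup>2 \<partial>?M) - tvol P * (\<Sum>n\<in>F. (norm (coef P g n))\<^sup>2)
        + tvol P * (\<Sum>n\<in>F. (norm (a n - coef P g n))\<^sup>2)"
    unfolding p[symmetric] by (simp only: distrib_left right_diff_distrib)
qed

section \<open>Density of trigonometric polynomials\<close>

definition trig_poly :: "real \<Rightarrow> (space \<Rightarrow> complex) \<Rightarrow> bool" where
  "trig_poly P q \<longleftrightarrow> (\<exists>N c. \<forall>x. q x = (\<Sum>n\<in>int_box N. c n * mode P n x))"

lemma int_box_mono: "M \<le> N \<Longrightarrow> int_box M \<subseteq> int_box N"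
  unfolding int_box_def by (auto intro: order_trans)

lemma in_int_box_Max: "n \<in> int_box (Max (range (\<lambda>i. nat \<bar>n $ i\<bar>)))"
proof -
  have "nat \<bar>n $ i\<bar> \<le> Max (range (\<lambda>i. nat \<bar>n $ i\<bar>))" for i by (rule Max_ge) auto
  then show ?thesis by (simp add: int_box_def nat_le_iff)
qed

lemma trig_poly_mode: "trig_poly P (\<lambda>x. a * mode P m x)"
proof -
  obtain N where "m \<in> int_box N" using in_int_box_Max by blast
  then have "\<forall>x. a * mode P m x = (\<Sum>n\<in>int_box N. (if n = m then a else 0) * mode P n x)"
    by (simp add: if_distrib[of "\<lambda>c. c * _"] finite_int_box cong: if_cong)
  then show ?thesis
    unfolding trig_poly_def by (intro exI[of _ N] exI[of _ "\<lambda>n. if n = m then a else 0"])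
qed

lemma trig_poly_add:
  assumes "trig_poly P q" "trig_poly P r"
  shows "trig_poly P (\<lambda>x. q x + r x)"
proof -
  obtain M c where q: "\<And>x. q x = (\<Sum>n\<in>int_box M. c n * mode P n x)"
    using assms(1) by (auto simp: trig_poly_def)
  obtain N d where r: "\<And>x. r x = (\<Sum>n\<in>int_box N. d n * mode P n x)"
    using assms(2) by (auto simp: trig_poly_def)
  have ext: "(\<Sum>n\<in>int_box K. c n * mode P n x)
      = (\<Sum>n\<in>int_box (max M N). (if n \<in> int_box K then c n else 0) * mode P n x)"
    if "K \<le> max M N" for K x and c :: "int ^ 3 \<Rightarrow> complex"
    using int_box_mono[OF that] by (intro sum.mono_neutral_cong_left finite_int_box) auto
  have "\<forall>x. q x + r x = (\<Sum>n\<in>int_box (max M N).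
      ((if n \<in> int_box M then c n else 0) + (if n \<in> int_box N then d n else 0)) * mode P n x)"
    unfolding q r using ext[of M c] ext[of N d] by (simp add: sum.distrib distrib_right)
  then show ?thesis
    unfolding trig_poly_def
    by (intro exI[of _ "max M N"] exI[of _ "\<lambda>n. (if n \<in> int_box M then c n else 0) + (if n \<in> int_box N then d n else 0)"])
qed

lemma trig_poly_sum:
  "(\<And>i. i \<in> I \<Longrightarrow> trig_poly P (q i)) \<Longrightarrow> trig_poly P (\<lambda>x. \<Sum>i\<in>I. q i x)"
proof (induction I rule: infinite_finite_induct)
  case (insert i I)
  then show ?case by (simp add: trig_poly_add)
qed (use trig_poly_mode[of P 0] in auto)

lemma trig_poly_mult:
  assumes "trig_poly P q" "trig_poly P r"
  shows "trig_poly P (\<lambda>x. q x * r x)"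
proof -
  obtain M c where q: "\<And>x. q x = (\<Sum>n\<in>int_box M. c n * mode P n x)"
    using assms(1) by (auto simp: trig_poly_def)
  obtain N d where r: "\<And>x. r x = (\<Sum>n\<in>int_box N. d n * mode P n x)"
    using assms(2) by (auto simp: trig_poly_def)
  have "q x * r x = (\<Sum>m\<in>int_box M. \<Sum>n\<in>int_box N. (c m * d n) * mode P (m + n) x)" for x
    unfolding q r sum_product mode_add by (simp add: mult_ac)
  then show ?thesis by (simp add: trig_poly_sum trig_poly_mode)
qed

text \<open>The quotient map onto the torus embedded in a real vector space. Real polynomials there
  pull back to trigonometric polynomials, which makes the Stone-Weierstrass theorem
  applicable.\<close>

definition torus_map :: "real \<Rightarrow> space \<Rightarrow> complex ^ 3" where
  "torus_map P x = (\<chi> i. cis (2 * pi / P * x $ i))"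

text \<open>A real linear functional combines the complex coordinates and their conjugates, and
  these pull back to the modes whose index is plus or minus a unit vector.\<close>

lemma trig_poly_linear:
  fixes f :: "complex ^ 3 \<Rightarrow> real"
  assumes "linear f"
  shows "trig_poly P (\<lambda>x. of_real (f (torus_map P x)))"
proof -
  have rep: "z = (\<Sum>i\<in>UNIV. Re (z $ i) *\<^sub>R axis i 1 + Im (z $ i) *\<^sub>R axis i \<i>)" for z :: "complex ^ 3"
    by (simp add: vec_eq_iff sum_3 forall_3 axis_def complex_eq_iff)
  have f: "f z = (\<Sum>i\<in>UNIV. Re (z $ i) * f (axis i 1) + Im (z $ i) * f (axis i \<i>))" for z
    by (subst rep[of z]) (simp add: linear_sum[OF assms] linear_add[OF assms] linear_scale[OF assms])
  have mode: "torus_map P x $ i = mode P (axis i 1) x" "cnj (torus_map P x $ i) = mode P (- axis i 1) x" for x i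
  proof -
    have "int_vec (axis i 1) = axis i 1" by (auto simp: int_vec_def axis_def vec_eq_iff)
    then show "torus_map P x $ i = mode P (axis i 1) x"
      by (simp add: torus_map_def mode_def inner_axis')
    then show "cnj (torus_map P x $ i) = mode P (- axis i 1) x"
      by (simp only: mode_minus)
  qed
  have *: "of_real (Re z * a + Im z * b) = (Complex (a / 2) (- b / 2)) * z + (Complex (a / 2) (b / 2)) * cnj z"
    for z a b
    by (simp add: complex_eq_iff)
  have "of_real (f (torus_map P x)) = (\<Sum>i\<in>UNIV.
      Complex (f (axis i 1) / 2) (- f (axis i \<i>) / 2) * mode P (axis i 1) x
      + Complex (f (axis i 1) / 2) (f (axis i \<i>) / 2) * mode P (- axis i 1) x)" for x
    using arg_cong[OF f[of "torus_map P x"], of complex_of_real] by (simp only: of_real_sum * mode mode_minus)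
  then show ?thesis
    by (simp only:) (intro trig_poly_sum trig_poly_add trig_poly_mode)
qed

lemma trig_poly_polynomial:
  assumes "real_polynomial_function f"
  shows "trig_poly P (\<lambda>x. of_real (f (torus_map P x)))"
  using assms
proof (induction rule: real_polynomial_function.induct)
  case (linear f)
  then show ?case by (intro trig_poly_linear bounded_linear.linear)
next
  case (const c)
  then show ?case using trig_poly_mode[of P "of_real c" 0] by simp
qed (simp_all add: trig_poly_add trig_poly_mult)

lemma continuous_torus_map: "continuous_on S (torus_map P)"
  unfolding torus_map_def by (intro continuous_intros continuous_on_vec_lambda)

text \<open>Points of the closed cell with the same image either coincide or both lie on its
  boundary, where \<open>h\<close> vanishes; so \<open>h\<close> is constant on fibres. The factor
  is continuous because preimages of closed sets under it are images of compact sets.\<close>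

lemma torus_map_factor:
  fixes h :: "space \<Rightarrow> real"
  assumes P: "P > 0" and h: "continuous_on UNIV h"
    and h0: "\<And>x. x \<notin> box (vec (- P / 2)) (vec (P / 2)) \<Longrightarrow> h x = 0"
  obtains H where "continuous_on (torus_map P ` torus P) H" "\<And>x. x \<in> torus P \<Longrightarrow> H (torus_map P x) = h x"
proof -
  let ?B = "box (vec (- P / 2)) (vec (P / 2)) :: space set"
  have per: "\<exists>m. x $ i = y $ i + P * of_int m" if "torus_map P x = torus_map P y" for x y i
  proof -
    have "cis (2 * pi / P * x $ i) = cis (2 * pi / P * y $ i)"
      using arg_cong[OF that, of "\<lambda>z. z $ i"] by (simp add: torus_map_def)
    then have "\<exists>m::int. 2 * pi / P * x $ i = 2 * pi / P * y $ i + 2 * pi * m"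
      by (intro sin_cos_eq_iff[THEN iffD1]) (simp add: complex_eq_iff)
    then obtain m :: int where "2 * pi / P * x $ i = 2 * pi / P * y $ i + 2 * pi * m" ..
    also have "\<dots> = 2 * pi / P * (y $ i + P * m)" using P by (simp add: field_simps)
    finally have "x $ i = y $ i + P * m" using P by (subst (asm) mult_cancel_left) auto
    then show ?thesis ..
  qed
  \<comment> \<open>Two points of the cell differ by at most P in each coordinate, which leaves only
    the integers -1, 0 and 1.\<close>
  have small: "m \<in> {-1, 0, 1}" if "\<bar>P * of_int m\<bar> \<le> P" for m :: int
  proof -
    have "\<bar>of_int m\<bar> \<le> (1 :: real)" using that P by (simp add: abs_mult)
    then show ?thesis by auto
  qed
  have edge: "y \<notin> ?B" if xy: "x \<in> torus P" "y \<in> torus P" "torus_map P x = torus_map P y" and x: "x \<notin> ?B" for x y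
  proof -
    have tx: "- P / 2 \<le> x $ i" "x $ i \<le> P / 2" "- P / 2 \<le> y $ i" "y $ i \<le> P / 2" for i
      using xy(1,2) by (auto simp: torus_def mem_box_cart)
    obtain i where i: "\<not> (- P / 2 < x $ i \<and> x $ i < P / 2)" using x by (auto simp: mem_box_cart)
    obtain m where m: "x $ i = y $ i + P * of_int m" using per[OF xy(3)] by blast
    have "\<bar>P * of_int m\<bar> \<le> P" using tx[of i] m by linarith
    then have "m \<in> {-1, 0, 1}" by (rule small)
    then have "\<not> (- P / 2 < y $ i \<and> y $ i < P / 2)"
      using m i tx[of i] P by auto
    then show ?thesis by (auto simp: mem_box_cart)
  qed
  have fib: "h x = h y" if xy: "x \<in> torus P" "y \<in> torus P" "torus_map P x = torus_map P y" for x y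
  proof (cases "x \<in> ?B \<and> y \<in> ?B")
    case True
    have "x $ i = y $ i" for i
    proof -
      obtain m where m: "x $ i = y $ i + P * of_int m" using per[OF xy(3)] by blast
      have b: "- P / 2 < x $ i" "x $ i < P / 2" "- P / 2 < y $ i" "y $ i < P / 2"
        using True by (auto simp: mem_box_cart)
      then have "\<bar>P * of_int m\<bar> \<le> P" using m by linarith
      then have "m \<in> {-1, 0, 1}" by (rule small)
      then show ?thesis using m b by auto
    qed
    then have "x = y" by (simp add: vec_eq_iff)
    then show ?thesis by simp
  next
    case False
    then have "x \<notin> ?B \<and> y \<notin> ?B" using edge xy by metis
    then show ?thesis by (simp add: h0)
  qed
  define H where "H = (\<lambda>z. h (SOME x. x \<in> torus P \<and> torus_map P x = z))"
  have H: "H (torus_map P x) = h x" if "x \<in> torus P" for x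
  proof -
    have "\<exists>y. y \<in> torus P \<and> torus_map P y = torus_map P x" using that by blast
    from someI_ex[OF this] show ?thesis unfolding H_def using fib that by metis
  qed
  have c: "compact (torus P)" by (simp add: torus_def)
  have cl: "closed (H -` B \<inter> torus_map P ` torus P)" if "closed B" for B
  proof -
    have "H -` B \<inter> torus_map P ` torus P = torus_map P ` (torus P \<inter> h -` B)"
      using H by auto
    moreover have "compact (torus P \<inter> h -` B)"
      using c that h by (intro compact_Int_closed continuous_closed_vimage) (auto simp: continuous_on_eq_continuous_at)
    ultimately show ?thesis
      using compact_imp_closed compact_continuous_image[OF continuous_torus_map] by metis
  qed
  have "closed (torus_map P ` torus P)"
    by (intro compact_imp_closed compact_continuous_image continuous_torus_map c)
  then have "continuous_on (torus_map P ` torus P) H"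
    using cl by (subst continuous_on_closed_vimage) auto
  with H that show thesis by blast
qed

lemma continuous_trig_approx:
  fixes h :: "space \<Rightarrow> real"
  assumes P: "P > 0" and h: "continuous_on UNIV h"
    and h0: "\<And>x. x \<notin> box (vec (- P / 2)) (vec (P / 2)) \<Longrightarrow> h x = 0" and e: "e > 0"
  obtains q where "trig_poly P q" "\<And>x. x \<in> torus P \<Longrightarrow> norm (of_real (h x) - q x) < e"
proof -
  obtain H where H: "continuous_on (torus_map P ` torus P) H" "\<And>x. x \<in> torus P \<Longrightarrow> H (torus_map P x) = h x"
    using torus_map_factor[OF P h h0] by metis
  have "compact (torus_map P ` torus P)"
    by (intro compact_continuous_image continuous_torus_map) (simp add: torus_def)
  then obtain g where g: "real_polynomial_function g" "\<And>z. z \<in> torus_map P ` torus P \<Longrightarrow> \<bar>H z - g z\<bar> < e"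
    using Stone_Weierstrass_real_polynomial_function[OF _ H(1) e] by metis
  show thesis
  proof (rule that[OF trig_poly_polynomial[OF g(1)]])
    fix x assume "x \<in> torus P"
    then have "\<bar>h x - g (torus_map P x)\<bar> < e" using g(2) H(2) by fastforce
    then show "norm (of_real (h x) - of_real (g (torus_map P x)) :: complex) < e"
      by (simp only: of_real_diff[symmetric] norm_of_real)
  qed
qed

lemma power2_sum_le: "(norm (a + b :: 'a::real_normed_vector))\<^sup>2 \<le> 2 * (norm a)\<^sup>2 + 2 * (norm b)\<^sup>2"
proof -
  have "(norm (a + b))\<^sup>2 \<le> (norm a + norm b)\<^sup>2" by (intro power_mono norm_triangle_ineq) simp
  also have "\<dots> \<le> 2 * (norm a)\<^sup>2 + 2 * (norm b)\<^sup>2"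
    using zero_le_power2[of "norm a - norm b"] by (simp add: power2_eq_square algebra_simps)
  finally show ?thesis .
qed

definition clamp1 :: "real \<Rightarrow> real \<Rightarrow> real" where
  "clamp1 m y = max (- m) (min m y)"

lemma abs_clamp1: "m \<ge> 0 \<Longrightarrow> \<bar>clamp1 m y\<bar> \<le> m"
  by (auto simp: clamp1_def)

lemma clamp1_id: "\<bar>y\<bar> \<le> m \<Longrightarrow> clamp1 m y = y"
  by (auto simp: clamp1_def)

text \<open>Reduces to bounded functions, for which a constant can dominate all continuous
  approximants at once.\<close>

lemma L2_truncation:
  fixes g :: "space \<Rightarrow> real"
  assumes g: "g \<in> borel_measurable M" "integrable M (\<lambda>x. (g x)\<^sup>2)" and e: "e > 0"
  obtains m :: real where "m > 0" "(\<integral>x. (g x - clamp1 m (g x))\<^sup>2 \<partial>M) < e"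
    "integrable M (\<lambda>x. (g x - clamp1 m (g x))\<^sup>2)"
proof -
  have meas: "(\<lambda>x. (g x - clamp1 m (g x))\<^sup>2) \<in> borel_measurable M" for m
    unfolding clamp1_def using g(1) by measurable
  have bd: "norm ((y - clamp1 m y)\<^sup>2) \<le> y\<^sup>2" if "m \<ge> 0" for m y
  proof -
    have "\<bar>y - clamp1 m y\<bar> \<le> \<bar>y\<bar>" using that by (auto simp: clamp1_def)
    then show ?thesis by (simp add: abs_le_square_iff)
  qed
  have "(\<lambda>n. \<integral>x. (g x - clamp1 (real n) (g x))\<^sup>2 \<partial>M) \<longlonglongrightarrow> (\<integral>x. 0 \<partial>M)"
  proof (rule integral_dominated_convergence[OF _ meas g(2)])
    show "AE x in M. (\<lambda>n. (g x - clamp1 (real n) (g x))\<^sup>2) \<longlonglongrightarrow> 0"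
    proof (rule AE_I2)
      fix x
      obtain N :: nat where "\<bar>g x\<bar> \<le> N" using real_arch_simple by blast
      then have "eventually (\<lambda>n. (g x - clamp1 (real n) (g x))\<^sup>2 = 0) sequentially"
        by (intro eventually_sequentiallyI[of N]) (simp add: clamp1_id)
      then show "(\<lambda>n. (g x - clamp1 (real n) (g x))\<^sup>2) \<longlonglongrightarrow> 0" by (rule tendsto_eventually)
    qed
  qed (auto simp: bd[simplified])
  then have "eventually (\<lambda>n. (\<integral>x. (g x - clamp1 (real n) (g x))\<^sup>2 \<partial>M) < e) sequentially"
    using e by (simp add: order_tendstoD)
  then obtain N where N: "\<And>n. n \<ge> N \<Longrightarrow> (\<integral>x. (g x - clamp1 (real n) (g x))\<^sup>2 \<partial>M) < e"
    by (auto simp: eventually_sequentially)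
  then have "(\<integral>x. (g x - clamp1 (real (Suc N)) (g x))\<^sup>2 \<partial>M) < e"
    by (intro N) simp
  moreover have "integrable M (\<lambda>x. (g x - clamp1 (real (Suc N)) (g x))\<^sup>2)"
    by (rule Bochner_Integration.integrable_bound[OF g(2) meas]) (simp add: bd[simplified])
  ultimately show thesis using that[of "real (Suc N)"] by simp
qed

text \<open>A measurable function is almost everywhere a limit of continuous ones. Clamping keeps
  the approximants bounded, a cutoff makes them vanish on the boundary so that they descend to the
  torus, and dominated convergence gives the limit in the mean square.\<close>

lemma bounded_continuous_approx:
  fixes g :: "space \<Rightarrow> real"
  assumes P: "P > 0" and g: "g \<in> borel_measurable (torus_measure P)" and m: "m > 0" "\<And>x. \<bar>g x\<bar> \<le> m" and e: "e > 0"
  obtains h where "continuous_on UNIV h" "\<And>x. x \<notin> box (vec (- P / 2)) (vec (P / 2)) \<Longrightarrow> h x = 0"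
    "(\<integral>x. (g x - h x)\<^sup>2 \<partial>torus_measure P) < e" "integrable (torus_measure P) (\<lambda>x. (g x - h x)\<^sup>2)"
proof -
  let ?B = "box (vec (- P / 2)) (vec (P / 2)) :: space set" and ?M = "torus_measure P"
  obtain N G where N: "negligible N" and G: "\<And>n. continuous_on UNIV (G n)"
    "\<And>x. x \<notin> N \<Longrightarrow> (\<lambda>n. G n x) \<longlonglongrightarrow> (if x \<in> torus P then g x else 0)"
    using g[folded measurable_on_iff_borel_measurable[OF torus_borel(2)]] unfolding measurable_on_def by metis
  \<comment> \<open>A continuous cutoff, zero off the open cell and, at each interior point, equal
    to 1 from some n on.\<close>
  define \<kappa> where "\<kappa> = (\<lambda>(n::nat) x. min 1 (real n * infdist x (- ?B)))"
  define h where "h = (\<lambda>n x. \<kappa> n x * clamp1 m (G n x))"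
  have ne: "- ?B \<noteq> {}"
  proof -
    have "vec P \<notin> ?B" using P by (auto simp: mem_box_cart)
    then show ?thesis by blast
  qed
  have hc: "continuous_on UNIV (h n)" for n
    unfolding h_def \<kappa>_def clamp1_def by (intro continuous_intros G)
  have h0: "h n x = 0" if "x \<notin> ?B" for n x
    using that by (simp add: h_def \<kappa>_def)
  have hm: "\<bar>h n x\<bar> \<le> m" for n x
  proof -
    have "\<bar>\<kappa> n x\<bar> \<le> 1" by (simp add: \<kappa>_def infdist_nonneg)
    then have "\<bar>\<kappa> n x\<bar> * \<bar>clamp1 m (G n x)\<bar> \<le> 1 * m"
      using abs_clamp1[of m] m(1) by (intro mult_mono) auto
    then show ?thesis by (simp add: h_def abs_mult)
  qed
  have bd: "norm ((g x - h n x)\<^sup>2) \<le> (2 * m)\<^sup>2" for x n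
  proof -
    have "\<bar>g x - h n x\<bar> \<le> \<bar>2 * m\<bar>" using hm[of n x] m(1) m(2)[of x] by linarith
    then show ?thesis by (simp only: abs_le_square_iff real_norm_def abs_power2)
  qed
  have meas: "(\<lambda>x. (g x - h n x)\<^sup>2) \<in> borel_measurable ?M" for n
    using borel_measurable_integrable[OF integrable_torus_continuous[OF hc[of n]], of P] g by measurable
  have int: "integrable ?M (\<lambda>x. (2 * m)\<^sup>2)"
    using finite_measure.integrable_const[OF finite_measure_torus] .
  have "(\<lambda>n. \<integral>x. (g x - h n x)\<^sup>2 \<partial>?M) \<longlonglongrightarrow> (\<integral>x. 0 \<partial>?M)"
  proof (rule integral_dominated_convergence[OF _ meas int])
    have "negligible (N \<union> frontier ?B)"
      using N by (simp add: negligible_frontier_interval negligible_convex_frontier)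
    then have "AE x in lebesgue. x \<notin> N \<union> frontier ?B"
      by (metis AE_not_in negligible_iff_null_sets)
    then show "AE x in ?M. (\<lambda>n. (g x - h n x)\<^sup>2) \<longlonglongrightarrow> 0"
      unfolding AE_restrict_space_iff[of "torus P" lebesgue, simplified]
    proof eventually_elim
      case (elim x)
      show ?case
      proof
        assume x: "x \<in> torus P"
        have "x \<in> closure ?B"
          using x P by (subst closure_box) (auto simp: torus_def mem_box_cart box_ne_empty Basis_vec_def inner_axis)
        then have xB: "x \<in> ?B" using elim by (auto simp: frontier_def interior_open[OF open_box])
        have "(\<lambda>n. G n x) \<longlonglongrightarrow> g x" using G(2)[of x] elim x by auto
        then have "(\<lambda>n. clamp1 m (G n x)) \<longlonglongrightarrow> clamp1 m (g x)"
          unfolding clamp1_def by (intro tendsto_intros)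
        then have "(\<lambda>n. clamp1 m (G n x)) \<longlonglongrightarrow> g x" by (simp add: clamp1_id m(2))
        moreover have "(\<lambda>n. \<kappa> n x) \<longlonglongrightarrow> 1"
        proof -
          have d: "infdist x (- ?B) > 0"
            using xB by (intro infdist_pos_not_in_closed closed_Compl open_box ne) simp
          obtain K :: nat where K: "1 / infdist x (- ?B) \<le> K" using real_arch_simple by blast
          have "\<kappa> n x = 1" if "n \<ge> K" for n
          proof -
            have "1 / infdist x (- ?B) \<le> real n" using K that by (meson of_nat_mono order_trans)
            then show ?thesis using d by (simp add: \<kappa>_def field_simps)
          qed
          then show ?thesis
            by (intro tendsto_eventually eventually_sequentiallyI[of K])
        qed
        ultimately have "(\<lambda>n. h n x) \<longlonglongrightarrow> 1 * g x" unfolding h_def by (intro tendsto_mult)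
        then have "(\<lambda>n. (g x - h n x)\<^sup>2) \<longlonglongrightarrow> (g x - 1 * g x)\<^sup>2" by (intro tendsto_intros)
        then show "(\<lambda>n. (g x - h n x)\<^sup>2) \<longlonglongrightarrow> 0" by simp
      qed
    qed
  qed (use bd in auto)
  then have "eventually (\<lambda>n. (\<integral>x. (g x - h n x)\<^sup>2 \<partial>?M) < e) sequentially"
    using e by (simp add: order_tendstoD)
  then obtain n where n: "(\<integral>x. (g x - h n x)\<^sup>2 \<partial>?M) < e"
    by (auto simp: eventually_sequentially)
  moreover have "integrable ?M (\<lambda>x. (g x - h n x)\<^sup>2)"
    by (rule Bochner_Integration.integrable_bound[OF int meas]) (use bd in auto)
  ultimately show thesis using that[OF hc h0] by blast
qed

lemma L2_trig_approx:
  fixes g :: "space \<Rightarrow> real"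
  assumes P: "P > 0" and g: "g \<in> borel_measurable (torus_measure P)" "integrable (torus_measure P) (\<lambda>x. (g x)\<^sup>2)"
    and e: "e > 0"
  obtains N c where "(\<integral>x. (norm (of_real (g x) - (\<Sum>n\<in>int_box N. c n * mode P n x)))\<^sup>2 \<partial>torus_measure P) < e"
proof -
  let ?M = "torus_measure P"
  obtain m where m: "m > 0" "(\<integral>x. (g x - clamp1 m (g x))\<^sup>2 \<partial>?M) < e / 16"
    and i1: "integrable ?M (\<lambda>x. (g x - clamp1 m (g x))\<^sup>2)"
    using L2_truncation[OF g, of "e / 16"] e by auto
  have cm: "(\<lambda>x. clamp1 m (g x)) \<in> borel_measurable ?M"
    unfolding clamp1_def using g(1) by measurable
  have cb: "\<bar>clamp1 m (g x)\<bar> \<le> m" for x using m(1) by (simp add: abs_clamp1)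
  have e8: "e / 16 > 0" using e by simp
  obtain h where h: "continuous_on UNIV h" "\<And>x. x \<notin> box (vec (- P / 2)) (vec (P / 2)) \<Longrightarrow> h x = 0"
    "(\<integral>x. (clamp1 m (g x) - h x)\<^sup>2 \<partial>?M) < e / 16" "integrable ?M (\<lambda>x. (clamp1 m (g x) - h x)\<^sup>2)"
    by (rule bounded_continuous_approx[OF P cm m(1) cb e8]) (rule that)
  \<comment> \<open>The truncation and the continuous approximation enter with weight 4, the uniform
    one with weight 2; each of the three contributes at most e / 4.\<close>
  define d where "d = sqrt (e / (8 * tvol P))"
  have d: "d > 0" "d\<^sup>2 * tvol P = e / 8" using e tvol_pos[OF P] by (auto simp: d_def)
  obtain q where q: "trig_poly P q" "\<And>x. x \<in> torus P \<Longrightarrow> norm (of_real (h x) - q x) < d"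
    using continuous_trig_approx[OF P h(1,2) d(1)] by metis
  obtain N c where qc: "\<And>x. q x = (\<Sum>n\<in>int_box N. c n * mode P n x)"
    using q(1) by (auto simp: trig_poly_def)
  have gi: "integrable ?M (\<lambda>x. (norm (of_real (g x) - q x))\<^sup>2)"
    unfolding qc using g by (intro L2_distance_trig_sum(1)[OF P]) (auto simp: finite_int_box)
  have "(\<integral>x. (norm (of_real (g x) - q x))\<^sup>2 \<partial>?M)
      \<le> (\<integral>x. 4 * (g x - clamp1 m (g x))\<^sup>2 + (4 * (clamp1 m (g x) - h x)\<^sup>2 + 2 * d\<^sup>2) \<partial>?M)"
  proof (rule integral_mono[OF gi])
    have "integrable ?M (\<lambda>x. 2 * d\<^sup>2)"
      by (rule finite_measure.integrable_const[OF finite_measure_torus])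
    then show "integrable ?M (\<lambda>x. 4 * (g x - clamp1 m (g x))\<^sup>2 + (4 * (clamp1 m (g x) - h x)\<^sup>2 + 2 * d\<^sup>2))"
      using i1 h(4) by simp
    fix x assume "x \<in> space ?M"
    then have x: "x \<in> torus P" by simp
    have t1: "(norm (of_real (g x) - q x))\<^sup>2 \<le> 2 * (norm (of_real (g x - h x) :: complex))\<^sup>2 + 2 * (norm (of_real (h x) - q x))\<^sup>2"
      using power2_sum_le[of "of_real (g x - h x)" "of_real (h x) - q x"] by simp
    have t2: "(norm (of_real (g x - h x) :: complex))\<^sup>2 = (g x - h x)\<^sup>2"
      by (simp only: norm_of_real power2_abs)
    have t3: "(g x - h x)\<^sup>2 \<le> 2 * (g x - clamp1 m (g x))\<^sup>2 + 2 * (clamp1 m (g x) - h x)\<^sup>2"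
      using power2_sum_le[of "g x - clamp1 m (g x)" "clamp1 m (g x) - h x"] by simp
    have t4: "(norm (of_real (h x) - q x))\<^sup>2 \<le> d\<^sup>2"
      using q(2)[OF x] by (intro power_mono) auto
    show "(norm (of_real (g x) - q x))\<^sup>2
        \<le> 4 * (g x - clamp1 m (g x))\<^sup>2 + (4 * (clamp1 m (g x) - h x)\<^sup>2 + 2 * d\<^sup>2)"
      using t1 t2 t3 t4 by linarith
  qed
  also have "\<dots> = 4 * (\<integral>x. (g x - clamp1 m (g x))\<^sup>2 \<partial>?M) + (4 * (\<integral>x. (clamp1 m (g x) - h x)\<^sup>2 \<partial>?M) + 2 * (d\<^sup>2 * tvol P))"
    using i1 h(4) finite_measure.integrable_const[OF finite_measure_torus, of P "2 * d\<^sup>2"]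
    by (simp add: tvol_def measure_restrict_space)
  also have "\<dots> < e" using m(2) h(3) d(2) e by linarith
  finally show thesis unfolding qc by (rule that)
qed

section \<open>Parseval's identity for scalar and vector fields\<close>

text \<open>Among trigonometric sums over a given cube the Fourier sum is closest, so one good
  approximant already makes the defect small for its cube; the defect decreases as the cube
  grows.\<close>

lemma parseval_tendsto:
  fixes g :: "space \<Rightarrow> real"
  assumes P: "P > 0" and g: "g \<in> borel_measurable (torus_measure P)" "integrable (torus_measure P) (\<lambda>x. (g x)\<^sup>2)"
  shows "(\<lambda>N. (\<integral>x. (g x)\<^sup>2 \<partial>torus_measure P) - tvol P * (\<Sum>n\<in>int_box N. (norm (coef P (\<lambda>x. of_real (g x)) n))\<^sup>2))
    \<longlonglongrightarrow> 0"
proof (rule LIMSEQ_I)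
  fix e :: real assume e: "e > 0"
  let ?M = "torus_measure P" and ?c = "coef P (\<lambda>x. of_real (g x))"
  let ?D = "\<lambda>N. (\<integral>x. (g x)\<^sup>2 \<partial>?M) - tvol P * (\<Sum>n\<in>int_box N. (norm (?c n))\<^sup>2)"
  have g': "(\<lambda>x. of_real (g x) :: complex) \<in> borel_measurable ?M"
    "integrable ?M (\<lambda>x. (norm (of_real (g x) :: complex))\<^sup>2)"
    using g by auto
  have D: "(\<integral>x. (norm (of_real (g x) - (\<Sum>n\<in>int_box N. a n * mode P n x)))\<^sup>2 \<partial>?M)
      = ?D N + tvol P * (\<Sum>n\<in>int_box N. (norm (a n - ?c n))\<^sup>2)" for N a
    using L2_distance_trig_sum(2)[OF P g' finite_int_box] by simp
  have D0: "?D N \<ge> 0" for N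
    using D[where N = N and a = ?c] Bochner_Integration.integral_nonneg[of ?M "\<lambda>x. (norm (of_real (g x) - (\<Sum>n\<in>int_box N. ?c n * mode P n x)))\<^sup>2"]
    by simp
  obtain N c where "(\<integral>x. (norm (of_real (g x) - (\<Sum>n\<in>int_box N. c n * mode P n x)))\<^sup>2 \<partial>?M) < e"
    by (rule L2_trig_approx[OF P g e]) (rule that)
  then have "?D N + tvol P * (\<Sum>n\<in>int_box N. (norm (c n - ?c n))\<^sup>2) < e" by (simp only: D)
  moreover have "tvol P * (\<Sum>n\<in>int_box N. (norm (c n - ?c n))\<^sup>2) \<ge> 0"
    using tvol_pos[OF P] by (simp add: sum_nonneg)
  ultimately have DN: "?D N < e" by linarith
  show "\<exists>N. \<forall>k\<ge>N. norm (?D k - 0) < e"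
  proof (intro exI allI impI)
    fix k assume "k \<ge> N"
    then have "tvol P * (\<Sum>n\<in>int_box N. (norm (?c n))\<^sup>2) \<le> tvol P * (\<Sum>n\<in>int_box k. (norm (?c n))\<^sup>2)"
      using tvol_pos[OF P] by (intro mult_left_mono sum_mono2 finite_int_box int_box_mono) auto
    then have "?D k \<le> ?D N" by linarith
    then show "norm (?D k - 0) < e" using DN D0[of k] by simp
  qed
qed

lemma norm_vec_squared: "(norm (x :: 'a::real_normed_vector ^ 'n))\<^sup>2 = (\<Sum>i\<in>UNIV. (norm (x $ i))\<^sup>2)"
  by (simp add: norm_vec_def L2_set_def sum_nonneg)

abbreviation wavevector :: "real \<Rightarrow> int ^ 3 \<Rightarrow> space" where
  "wavevector P n \<equiv> (2 * pi / P) *\<^sub>R int_vec n"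

lemma fourier_coeff_coef:
  "fourier_coeff P v (wavevector P n) $ i = coef P (\<lambda>x. of_real (v x $ i)) n"
proof -
  have "exp (- (\<i> * complex_of_real (wavevector P n \<bullet> x))) = cnj (mode P n x)" for x
  proof -
    have "exp (- (\<i> * complex_of_real (wavevector P n \<bullet> x))) = cis (- (wavevector P n \<bullet> x))"
      by (simp only: cis_conv_exp of_real_minus mult_minus_right)
    then show ?thesis by (simp add: mode_def cis_cnj)
  qed
  then show ?thesis by (simp add: fourier_coeff_def coef_def tvol_def)
qed

definition complexify :: "space \<Rightarrow> complex ^ 3" where
  "complexify x = (\<chi> i. of_real (x $ i))"

lemma norm_complexify [simp]: "norm (complexify x) = norm x"
  by (simp add: norm_vec_def complexify_def)

definition partial_sum :: "real \<Rightarrow> (space \<Rightarrow> space) \<Rightarrow> nat \<Rightarrow> space \<Rightarrow> complex ^ 3" where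
  "partial_sum P v N x = (\<chi> i. \<Sum>n\<in>int_box N. fourier_coeff P v (wavevector P n) $ i * mode P n x)"

text \<open>The energy outside the frequency cube, written as a defect: only finitely many
  coefficients occur, and it is meaningful before any convergence is known.\<close>

definition tail :: "real \<Rightarrow> (space \<Rightarrow> space) \<Rightarrow> nat \<Rightarrow> real" where
  "tail P v N = (\<integral>x. (norm (v x))\<^sup>2 \<partial>torus_measure P)
     - tvol P * (\<Sum>n\<in>int_box N. (norm (fourier_coeff P v (wavevector P n)))\<^sup>2)"

lemma vector_parseval:
  assumes P: "P > 0" and v: "in_Lp 2 (torus_measure P) v"
  shows integrable_partial_sum_error:
      "integrable (torus_measure P) (\<lambda>x. (norm (complexify (v x) - partial_sum P v N x))\<^sup>2)"
    and integral_partial_sum_error: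
      "(\<integral>x. (norm (complexify (v x) - partial_sum P v N x))\<^sup>2 \<partial>torus_measure P) = tail P v N"
    and tail_tendsto: "tail P v \<longlonglongrightarrow> 0"
proof -
  let ?M = "torus_measure P"
  have m: "v \<in> borel_measurable ?M" and i: "integrable ?M (\<lambda>x. (norm (v x))\<^sup>2)"
    using v by (auto simp: in_Lp_2_iff)
  have mi: "(\<lambda>x. v x $ j) \<in> borel_measurable ?M" for j
    by (rule measurable_compose[OF m]) (simp add: borel_measurable_continuous_onI continuous_intros)
  have ii: "integrable ?M (\<lambda>x. (v x $ j)\<^sup>2)" for j
  proof (rule Bochner_Integration.integrable_bound[OF i])
    show "(\<lambda>x. (v x $ j)\<^sup>2) \<in> borel_measurable ?M" using mi by measurable
    show "AE x in ?M. norm ((v x $ j)\<^sup>2) \<le> norm ((norm (v x))\<^sup>2)"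
      by (rule AE_I2) (simp add: component_le_norm_cart abs_le_square_iff[symmetric])
  qed
  have mi': "(\<lambda>x. of_real (v x $ j) :: complex) \<in> borel_measurable ?M"
    and ii': "integrable ?M (\<lambda>x. (norm (of_real (v x $ j) :: complex))\<^sup>2)" for j
    using mi ii by auto
  let ?c = "\<lambda>j. coef P (\<lambda>x. of_real (v x $ j))"
  have sq: "(norm (complexify (v x) - partial_sum P v N x))\<^sup>2
      = (\<Sum>j\<in>UNIV. (norm (of_real (v x $ j) - (\<Sum>n\<in>int_box N. ?c j n * mode P n x)))\<^sup>2)" for x
    by (simp add: norm_vec_squared complexify_def partial_sum_def fourier_coeff_coef)
  note L = L2_distance_trig_sum[OF P mi' ii' finite_int_box]
  show "integrable ?M (\<lambda>x. (norm (complexify (v x) - partial_sum P v N x))\<^sup>2)"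
    unfolding sq by (intro Bochner_Integration.integrable_sum L(1))
  have vi: "(\<integral>x. (norm (v x))\<^sup>2 \<partial>?M) = (\<Sum>j\<in>UNIV. \<integral>x. (v x $ j)\<^sup>2 \<partial>?M)"
    unfolding norm_vec_squared using ii by (subst Bochner_Integration.integral_sum[symmetric]) auto
  have tail: "tail P v N = (\<Sum>j\<in>UNIV. (\<integral>x. (v x $ j)\<^sup>2 \<partial>?M) - tvol P * (\<Sum>n\<in>int_box N. (norm (?c j n))\<^sup>2))" for N
  proof -
    have "(\<Sum>n\<in>int_box N. (norm (fourier_coeff P v (wavevector P n)))\<^sup>2)
        = (\<Sum>j\<in>UNIV. \<Sum>n\<in>int_box N. (norm (?c j n))\<^sup>2)"
      unfolding norm_vec_squared fourier_coeff_coef by (rule sum.swap)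
    then show ?thesis by (simp add: tail_def vi sum_subtractf sum_distrib_left)
  qed
  show "(\<integral>x. (norm (complexify (v x) - partial_sum P v N x))\<^sup>2 \<partial>?M) = tail P v N"
    unfolding sq tail using L(1) by (subst Bochner_Integration.integral_sum) (auto simp: L(2))
  have "(\<lambda>N. \<Sum>j\<in>UNIV. (\<integral>x. (v x $ j)\<^sup>2 \<partial>?M) - tvol P * (\<Sum>n\<in>int_box N. (norm (?c j n))\<^sup>2)) \<longlonglongrightarrow> (\<Sum>j\<in>(UNIV :: 3 set). 0)"
    by (intro tendsto_sum parseval_tendsto[OF P mi ii])
  then show "tail P v \<longlonglongrightarrow> 0" by (simp add: tail[abs_def])
qed

lemma tail_nonneg: "P > 0 \<Longrightarrow> in_Lp 2 (torus_measure P) v \<Longrightarrow> 0 \<le> tail P v N"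
  by (subst integral_partial_sum_error[symmetric]) auto

lemma bessel:
  assumes P: "P > 0" and v: "in_Lp 2 (torus_measure P) v"
    and K: "(\<integral>x. (norm (v x))\<^sup>2 \<partial>torus_measure P) \<le> K"
  shows "norm (fourier_coeff P v (wavevector P n)) \<le> sqrt (K / tvol P)"
proof -
  obtain N where N: "n \<in> int_box N" using in_int_box_Max by blast
  have "(norm (fourier_coeff P v (wavevector P n)))\<^sup>2 \<le> (\<Sum>n\<in>int_box N. (norm (fourier_coeff P v (wavevector P n)))\<^sup>2)"
    by (rule member_le_sum[OF N]) (auto simp: finite_int_box)
  then have "tvol P * (norm (fourier_coeff P v (wavevector P n)))\<^sup>2
      \<le> tvol P * (\<Sum>n\<in>int_box N. (norm (fourier_coeff P v (wavevector P n)))\<^sup>2)"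
    using tvol_pos[OF P] by (intro mult_left_mono) auto
  also have "\<dots> \<le> K"
    using tail_nonneg[OF P v, of N] K by (simp add: tail_def)
  finally have "(norm (fourier_coeff P v (wavevector P n)))\<^sup>2 \<le> K / tvol P"
    using tvol_pos[OF P] by (simp add: field_simps)
  then show ?thesis by (rule real_le_rsqrt)
qed

text \<open>The triangle inequality with the same bound for every coefficient. The count of modes,
  cubic in N, is the growth that the tail decay must later outweigh.\<close>

lemma norm_partial_sum_le:
  assumes "P > 0" and "in_Lp 2 (torus_measure P) v"
    and "(\<integral>x. (norm (v x))\<^sup>2 \<partial>torus_measure P) \<le> K"
  shows "norm (partial_sum P v N x) \<le> real (card (int_box N)) * sqrt (K / tvol P)"
proof -
  let ?f = "\<lambda>n. fourier_coeff P v (wavevector P n)"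
  have "partial_sum P v N x = (\<Sum>n\<in>int_box N. \<chi> i. ?f n $ i * mode P n x)"
    by (simp add: partial_sum_def vec_eq_iff)
  also have "norm \<dots> \<le> (\<Sum>n\<in>int_box N. norm (\<chi> i. ?f n $ i * mode P n x))"
    by (rule norm_sum)
  also have "\<dots> = (\<Sum>n\<in>int_box N. norm (?f n))"
    by (simp add: norm_vec_def norm_mult)
  also have "\<dots> \<le> (\<Sum>n\<in>int_box N. sqrt (K / tvol P))"
    by (intro sum_mono bessel assms)
  finally show ?thesis by simp
qed

text \<open>Real and imaginary parts are pairings with cosine and sine fields along an axis, to
  which weak continuity in time applies. This supplies the measurability in time of all quantities
  built from coefficients.\<close>

lemma continuous_fourier_coeff:
  assumes v: "in_C_L2w P T v"
  shows "continuous_on {0..T} (\<lambda>t. fourier_coeff P (v t) k)"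
  unfolding fourier_coeff_def
proof (intro continuous_on_vec_lambda continuous_on_mult continuous_on_const)
  fix i :: 3
  let ?M = "torus_measure P"
  have part: "continuous_on {0..T} (\<lambda>t. \<integral>x. v t x $ i * g x \<partial>?M)"
    if g: "continuous_on UNIV g" for g :: "space \<Rightarrow> real"
  proof -
    have "continuous_on UNIV (\<lambda>x. g x *\<^sub>R (axis i 1 :: space))" "continuous_on UNIV (\<lambda>x. (norm (g x *\<^sub>R (axis i 1 :: space)))\<^sup>2)"
      using g by (auto intro!: continuous_intros)
    then have "in_Lp 2 ?M (\<lambda>x. g x *\<^sub>R (axis i 1 :: space))"
      unfolding in_Lp_2_iff
      by (intro conjI integrable_torus_continuous borel_measurable_integrable[OF integrable_torus_continuous])
    then have "continuous_on {0..T} (\<lambda>t. \<integral>x. v t x \<bullet> (g x *\<^sub>R axis i 1) \<partial>?M)"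
      using v by (auto simp: in_C_L2w_def)
    then show ?thesis by (simp add: inner_axis mult.commute)
  qed
  have L: "in_Lp 2 ?M (v t)" if "t \<in> {0..T}" for t
    using v that by (auto simp: in_C_L2w_def)
  have eq: "(\<integral>x. of_real (v t x $ i) * exp (- (\<i> * of_real (k \<bullet> x))) \<partial>?M)
      = of_real (\<integral>x. v t x $ i * cos (k \<bullet> x) \<partial>?M) - \<i> * of_real (\<integral>x. v t x $ i * sin (k \<bullet> x) \<partial>?M)"
    if t: "t \<in> {0..T}" for t
  proof -
    have vm: "v t \<in> borel_measurable ?M" and vi: "integrable ?M (v t)"
      using L[OF t] integrable_torus_L2 by (auto simp: in_Lp_2_iff)
    have vc: "integrable ?M (\<lambda>x. v t x $ i)"
      by (rule integrable_bounded_linear[OF bounded_linear_vec_nth vi])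
    have int: "integrable ?M (\<lambda>x. v t x $ i * g x)"
      if "continuous_on UNIV g" "\<And>x. \<bar>g x\<bar> \<le> 1" for g :: "space \<Rightarrow> real"
    proof (rule Bochner_Integration.integrable_bound[OF vc])
      show "(\<lambda>x. v t x $ i * g x) \<in> borel_measurable ?M"
        by (intro borel_measurable_times borel_measurable_integrable[OF vc]
            borel_measurable_integrable[OF integrable_torus_continuous[OF that(1)]])
      show "AE x in ?M. norm (v t x $ i * g x) \<le> norm (v t x $ i)"
        using that(2) by (intro AE_I2) (simp add: abs_mult mult_left_le)
    qed
    have c: "integrable ?M (\<lambda>x. v t x $ i * cos (k \<bullet> x))" and s: "integrable ?M (\<lambda>x. v t x $ i * sin (k \<bullet> x))"
      by (intro int continuous_intros; simp)+
    have "(\<integral>x. of_real (v t x $ i) * exp (- (\<i> * of_real (k \<bullet> x))) \<partial>?M)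
      = (\<integral>x. of_real (v t x $ i * cos (k \<bullet> x)) - \<i> * of_real (v t x $ i * sin (k \<bullet> x)) \<partial>?M)"
    proof (rule Bochner_Integration.integral_cong[OF refl])
      fix x
      have "exp (- (\<i> * of_real (k \<bullet> x))) = cis (- (k \<bullet> x))" by (simp add: cis_conv_exp)
      then show "of_real (v t x $ i) * exp (- (\<i> * of_real (k \<bullet> x)))
          = of_real (v t x $ i * cos (k \<bullet> x)) - \<i> * of_real (v t x $ i * sin (k \<bullet> x))"
        by (simp add: complex_eq_iff)
    qed
    also have "\<dots> = (\<integral>x. complex_of_real (v t x $ i * cos (k \<bullet> x)) \<partial>?M) - (\<integral>x. \<i> * complex_of_real (v t x $ i * sin (k \<bullet> x)) \<partial>?M)"
      using c s by (intro Bochner_Integration.integral_diff integrable_mult_right integrable_of_real)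
    finally show ?thesis
      by (simp only: integral_mult_right_zero integral_complex_of_real)
  qed
  have "continuous_on {0..T} (\<lambda>t. of_real (\<integral>x. v t x $ i * cos (k \<bullet> x) \<partial>?M) - \<i> * complex_of_real (\<integral>x. v t x $ i * sin (k \<bullet> x) \<partial>?M))"
    by (intro continuous_on_diff continuous_on_mult continuous_on_const continuous_on_of_real part continuous_intros)
  then show "continuous_on {0..T} (\<lambda>t. \<integral>x. of_real (v t x $ i) * exp (- (\<i> * of_real (k \<bullet> x))) \<partial>?M)"
    using eq by (subst continuous_on_cong[OF refl]) auto
qed

section \<open>Lattice sums\<close>

lemma sum_symmetric_interval_le:
  fixes a :: "nat \<Rightarrow> real"
  assumes "\<And>k. 0 \<le> a k"
  shows "(\<Sum>m\<in>{- int K..int K}. a (nat \<bar>m\<bar>)) \<le> 2 * (\<Sum>k\<le>K. a k)"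
proof -
  have "{- int K..int K} \<subseteq> int ` {..K} \<union> (\<lambda>k. - int k) ` {..K}"
  proof
    fix m assume m: "m \<in> {- int K..int K}"
    show "m \<in> int ` {..K} \<union> (\<lambda>k. - int k) ` {..K}"
    proof (cases "m \<ge> 0")
      case True
      then show ?thesis using m by (intro UnI1 image_eqI[of _ _ "nat m"]) auto
    next
      case False
      then show ?thesis using m by (intro UnI2 image_eqI[of _ _ "nat (- m)"]) auto
    qed
  qed
  then have "(\<Sum>m\<in>{- int K..int K}. a (nat \<bar>m\<bar>)) \<le> (\<Sum>m\<in>int ` {..K} \<union> (\<lambda>k. - int k) ` {..K}. a (nat \<bar>m\<bar>))"
    using assms by (intro sum_mono2) auto
  also have "\<dots> \<le> (\<Sum>m\<in>int ` {..K}. a (nat \<bar>m\<bar>)) + (\<Sum>m\<in>(\<lambda>k. - int k) ` {..K}. a (nat \<bar>m\<bar>))"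
    using assms by (subst sum_Un) (auto intro!: sum_nonneg)
  also have "\<dots> = 2 * (\<Sum>k\<le>K. a k)"
    by (subst (1 2) sum.reindex) (auto simp: inj_on_def)
  finally show ?thesis .
qed

lemma bij_betw_int_box: "bij_betw vec_nth (int_box N) (UNIV \<rightarrow>\<^sub>E {- int N..int N})"
  by (rule bij_betwI[of _ _ _ vec_lambda])
    (auto simp: int_box_def abs_le_iff minus_le_iff PiE_def Pi_def)

text \<open>Over a cube containing \<open>F\<close> the sum of products is a product of
  one-dimensional sums, and each absolute value occurs for at most two integers.\<close>

lemma lattice_prod_sum_le:
  fixes a :: "nat \<Rightarrow> real" and F :: "(int ^ 3) set"
  assumes a: "\<And>k. 0 \<le> a k" "summable a" and F: "finite F"
  shows "(\<Sum>n\<in>F. \<Prod>i\<in>UNIV. a (nat \<bar>n $ i\<bar>)) \<le> (2 * suminf a) ^ 3"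
proof -
  let ?p = "\<lambda>n :: int ^ 3. \<Prod>i\<in>UNIV. a (nat \<bar>n $ i\<bar>)"
  \<comment> \<open>The inserted 0 keeps the maximum defined when \<open>F\<close> is empty.\<close>
  define K where "K = Max (insert 0 ((\<lambda>n. Max (range (\<lambda>i. nat \<bar>n $ i\<bar>))) ` F))"
  have "n \<in> int_box K" if "n \<in> F" for n
  proof -
    have "Max (range (\<lambda>i. nat \<bar>n $ i\<bar>)) \<le> K" unfolding K_def using F that by (intro Max_ge) auto
    then show ?thesis using in_int_box_Max int_box_mono by blast
  qed
  then have "F \<subseteq> int_box K" by blast
  then have "(\<Sum>n\<in>F. ?p n) \<le> (\<Sum>n\<in>int_box K. ?p n)"
    using a(1) by (intro sum_mono2 finite_int_box prod_nonneg) auto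
  also have "\<dots> = (\<Sum>f\<in>(UNIV :: 3 set) \<rightarrow>\<^sub>E {- int K..int K}. \<Prod>i\<in>UNIV. a (nat \<bar>f i\<bar>))"
    by (rule sum.reindex_bij_betw[OF bij_betw_int_box])
  also have "\<dots> = (\<Prod>i\<in>(UNIV :: 3 set). \<Sum>m\<in>{- int K..int K}. a (nat \<bar>m\<bar>))"
    by (rule prod_sum_PiE[symmetric]) auto
  also have "\<dots> = (\<Sum>m\<in>{- int K..int K}. a (nat \<bar>m\<bar>)) ^ 3" by simp
  also have "\<dots> \<le> (2 * suminf a) ^ 3"
  proof (rule power_mono)
    have "(\<Sum>m\<in>{- int K..int K}. a (nat \<bar>m\<bar>)) \<le> 2 * (\<Sum>k\<le>K. a k)"
      by (rule sum_symmetric_interval_le[OF a(1)])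
    also have "(\<Sum>k\<le>K. a k) \<le> suminf a"
      using a by (intro sum_le_suminf) auto
    finally show "(\<Sum>m\<in>{- int K..int K}. a (nat \<bar>m\<bar>)) \<le> 2 * suminf a" by simp
  qed (use a in \<open>auto intro: sum_nonneg\<close>)
  finally show ?thesis .
qed

lemma norm_int_vec_ge:
  assumes "n \<notin> int_box N"
  shows "real N \<le> norm (int_vec n)"
proof -
  obtain j where "\<bar>n $ j\<bar> > int N" using assms by (auto simp: int_box_def not_le)
  then have "real N \<le> \<bar>of_int (n $ j)\<bar>" by linarith
  also have "\<dots> \<le> norm (int_vec n)"
    using component_le_norm_cart[of "int_vec n" j] by (simp add: int_vec_def)
  finally show ?thesis .
qed

text \<open>Since \<open>(2 \<bar>n\<bar>)\<^sup>3 \<ge> \<Prod>\<^sub>i (1 + \<bar>n\<^sub>i\<bar>)\<close>, a power of \<open>\<bar>n\<bar>\<close> beyond the third is summable by comparison with a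
  product of one-dimensional series.\<close>

lemma lattice_tail_bound:
  assumes \<beta>: "\<beta> > 0"
  obtains C where "C \<ge> 0" "\<And>N F. N \<ge> 1 \<Longrightarrow> finite F \<Longrightarrow> F \<inter> int_box N = {} \<Longrightarrow>
    (\<Sum>n\<in>F. norm (int_vec n) powr (- (3 + \<beta>))) \<le> C * real N powr (- (\<beta> / 2))"
proof -
  \<comment> \<open>The choice makes 3 + \<beta> = \<beta> / 2 + 3 s with s > 1: the first part
    becomes the decay in N, the second a convergent series in each coordinate.\<close>
  define s where "s = 1 + \<beta> / 6"
  \<comment> \<open>The shift by one matters for vanishing coordinates: 0 \<open>powr\<close>
    anything is 0, and an unshifted product would vanish there.\<close>
  define a where "a = (\<lambda>k :: nat. real (Suc k) powr (- s))"
  have a0: "0 \<le> a k" for k by (simp add: a_def)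
  have "summable (\<lambda>k :: nat. real k powr (- s))"
    using \<beta> by (subst summable_real_powr_iff) (simp add: s_def)
  then have as: "summable a" unfolding a_def by (subst summable_Suc_iff)
  define C where "C = 8 powr s * (2 * suminf a) ^ 3"
  show ?thesis
  proof
    show "C \<ge> 0" unfolding C_def using suminf_nonneg[OF as a0] by simp
    fix N :: nat and F :: "(int ^ 3) set"
    assume N: "N \<ge> 1" and F: "finite F" "F \<inter> int_box N = {}"
    have "(\<Sum>n\<in>F. norm (int_vec n) powr (- (3 + \<beta>)))
        \<le> (\<Sum>n\<in>F. real N powr (- (\<beta> / 2)) * (8 powr s * (\<Prod>i\<in>UNIV. a (nat \<bar>n $ i\<bar>))))"
    proof (rule sum_mono)
      fix n assume "n \<in> F"
      then have "n \<notin> int_box N" using F(2) by blast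
      let ?r = "norm (int_vec n)"
      have comp: "\<bar>of_int (n $ i)\<bar> \<le> ?r" for i
        using component_le_norm_cart[of "int_vec n" i] by (simp add: int_vec_def)
      have rN: "real N \<le> ?r" by (rule norm_int_vec_ge) fact
      then have r1: "1 \<le> ?r" using N by linarith
      have "(\<Prod>i\<in>UNIV. real (Suc (nat \<bar>n $ i\<bar>))) \<le> (\<Prod>i\<in>(UNIV :: 3 set). 2 * ?r)"
      proof (rule prod_mono, intro conjI)
        fix i :: 3
        show "real (Suc (nat \<bar>n $ i\<bar>)) \<le> 2 * ?r" using comp[of i] r1 by simp
      qed simp
      also have "\<dots> = 8 * ?r powr 3" using r1 by (simp add: power_mult_distrib)
      finally have prod: "(\<Prod>i\<in>UNIV. real (Suc (nat \<bar>n $ i\<bar>))) \<le> 8 * ?r powr 3" .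
      have pp: "(\<Prod>i\<in>UNIV. real (Suc (nat \<bar>n $ i\<bar>))) > 0" by (intro prod_pos) simp
      have "?r powr (- (3 + \<beta>)) = ?r powr (- (\<beta> / 2)) * (?r powr 3) powr (- s)"
      proof -
        have "- (3 + \<beta>) = - (\<beta> / 2) + 3 * - s" by (simp add: s_def field_simps)
        then show ?thesis by (simp only: powr_add powr_powr)
      qed
      also have "\<dots> \<le> real N powr (- (\<beta> / 2)) * (8 powr s * (\<Prod>i\<in>UNIV. a (nat \<bar>n $ i\<bar>)))"
      proof (rule mult_mono)
        show "?r powr (- (\<beta> / 2)) \<le> real N powr (- (\<beta> / 2))"
          using \<beta> N rN by (intro powr_mono2') auto
        have "(?r powr 3) powr (- s) = 8 powr s * (8 * ?r powr 3) powr (- s)"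
          by (simp add: powr_mult mult.assoc[symmetric] powr_add[symmetric])
        also have "\<dots> \<le> 8 powr s * (\<Prod>i\<in>UNIV. real (Suc (nat \<bar>n $ i\<bar>))) powr (- s)"
          using \<beta> prod pp by (intro mult_left_mono powr_mono2') (auto simp: s_def)
        also have "(\<Prod>i\<in>UNIV. real (Suc (nat \<bar>n $ i\<bar>))) powr (- s) = (\<Prod>i\<in>UNIV. a (nat \<bar>n $ i\<bar>))"
          unfolding a_def by (rule prod_powr_distrib)
        finally show "(?r powr 3) powr (- s) \<le> 8 powr s * (\<Prod>i\<in>UNIV. a (nat \<bar>n $ i\<bar>))" .
      qed auto
      finally show "?r powr (- (3 + \<beta>)) \<le> real N powr (- (\<beta> / 2)) * (8 powr s * (\<Prod>i\<in>UNIV. a (nat \<bar>n $ i\<bar>)))" .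
    qed
    also have "\<dots> = real N powr (- (\<beta> / 2)) * (8 powr s * (\<Sum>n\<in>F. \<Prod>i\<in>UNIV. a (nat \<bar>n $ i\<bar>)))"
      by (simp add: sum_distrib_left)
    also have "\<dots> \<le> real N powr (- (\<beta> / 2)) * (8 powr s * (2 * suminf a) ^ 3)"
      by (intro mult_left_mono lattice_prod_sum_le a0 as F(1)) auto
    finally show "(\<Sum>n\<in>F. norm (int_vec n) powr (- (3 + \<beta>))) \<le> C * real N powr (- (\<beta> / 2))"
      by (simp add: C_def mult_ac)
  qed
qed

lemma card_int_box_le: "N \<ge> 1 \<Longrightarrow> card (int_box N) \<le> 27 * N ^ 3"
proof -
  assume N: "N \<ge> 1"
  have "card (int_box N) = card ((UNIV :: 3 set) \<rightarrow>\<^sub>E {- int N..int N})"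
    by (rule bij_betw_same_card[OF bij_betw_int_box])
  also have "\<dots> = nat (2 * int N + 1) ^ 3" by (simp add: card_PiE)
  also have "\<dots> = (2 * N + 1) ^ 3" by (rule arg_cong[of _ _ "\<lambda>k. k ^ 3"]) linarith
  also have "\<dots> \<le> (3 * N) ^ 3" using N by (intro power_mono) auto
  finally show ?thesis by (simp add: power_mult_distrib)
qed

section \<open>Integrability beyond the square\<close>

lemma in_Lp_nn_integral_le:
  fixes g :: "'a \<Rightarrow> 'b::real_normed_vector"
  assumes "g \<in> borel_measurable M" "(\<integral>\<^sup>+x. ennreal (norm (g x) powr s) \<partial>M) \<le> ennreal B" "B \<ge> 0"
  shows "in_Lp s M g" and "(\<integral>x. norm (g x) powr s \<partial>M) \<le> B"
proof -
  have m: "(\<lambda>x. norm (g x) powr s) \<in> borel_measurable M" using assms(1) by measurable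
  have "(\<integral>\<^sup>+x. ennreal (norm (g x) powr s) \<partial>M) < \<infinity>"
    using assms(2) by (rule order.strict_trans1) simp
  then have i: "integrable M (\<lambda>x. norm (g x) powr s)"
    using m by (intro integrableI_bounded) auto
  then show "in_Lp s M g" using assms(1) by (simp add: in_Lp_def)
  show "(\<integral>x. norm (g x) powr s \<partial>M) \<le> B"
    using assms(2,3) i by (simp add: nn_integral_eq_integral ennreal_le_iff)
qed

lemma tail_measurable:
  assumes P: "P > 0" and v: "in_C_L2w P T v"
  shows "(\<lambda>t. tail P (v t) N) \<in> borel_measurable (time_measure T)"
    and "(\<lambda>t. (norm (fourier_coeff P (v t) k))\<^sup>2) \<in> borel_measurable (time_measure T)"
    and "integrable (time_measure T) (\<lambda>t. (norm (fourier_coeff P (v t) k))\<^sup>2)"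
proof -
  have c: "continuous_on {0..T} (\<lambda>t. (norm (fourier_coeff P (v t) k))\<^sup>2)" for k
    by (intro continuous_intros continuous_fourier_coeff[OF v])
  have i: "integrable (time_measure T) (\<lambda>t. (norm (fourier_coeff P (v t) k))\<^sup>2)" for k
  proof -
    have "set_integrable lebesgue {0..T} (\<lambda>t. (norm (fourier_coeff P (v t) k))\<^sup>2)"
      using continuous_imp_integrable_real[OF c] unfolding set_integrable_def
      by (subst (asm) integrable_restrict_space) auto
    then have "set_integrable lebesgue {0<..<T} (\<lambda>t. (norm (fourier_coeff P (v t) k))\<^sup>2)"
      by (rule set_integrable_subset) auto
    then show ?thesis unfolding set_integrable_def by (subst integrable_restrict_space) auto
  qed
  then show "integrable (time_measure T) (\<lambda>t. (norm (fourier_coeff P (v t) k))\<^sup>2)"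
    and "(\<lambda>t. (norm (fourier_coeff P (v t) k))\<^sup>2) \<in> borel_measurable (time_measure T)"
    by auto
  show "(\<lambda>t. tail P (v t) N) \<in> borel_measurable (time_measure T)"
  proof (rule borel_measurable_LIMSEQ_real)
    fix t assume "t \<in> space (time_measure T)"
    then have "in_Lp 2 (torus_measure P) (v t)" using v by (auto simp: in_C_L2w_def)
    \<comment> \<open>The energy cancels in the difference of two tails, leaving finite sums of
      functions continuous in time.\<close>
    then have "(\<lambda>j. tail P (v t) N - tail P (v t) j) \<longlonglongrightarrow> tail P (v t) N - 0"
      by (intro tendsto_intros tail_tendsto P)
    then show "(\<lambda>j. tail P (v t) N - tail P (v t) j) \<longlonglongrightarrow> tail P (v t) N" by simp
  next
    fix j
    have "(\<lambda>t. tvol P * (\<Sum>n\<in>int_box j. (norm (fourier_coeff P (v t) (wavevector P n)))\<^sup>2)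
        - tvol P * (\<Sum>n\<in>int_box N. (norm (fourier_coeff P (v t) (wavevector P n)))\<^sup>2)) \<in> borel_measurable (time_measure T)"
      by (intro borel_measurable_diff borel_measurable_times borel_measurable_sum borel_measurable_const
          borel_measurable_integrable[OF i])
    then show "(\<lambda>t. tail P (v t) N - tail P (v t) j) \<in> borel_measurable (time_measure T)"
      by (simp add: tail_def)
  qed
qed

text \<open>The tail is a limit of finite sums over growing cubes, so Fatou's lemma turns a bound
  uniform over finite sets of modes into one for the whole tail.\<close>

lemma tail_time_integral:
  assumes P: "P > 0" and v: "in_C_L2w P T v" and B: "B \<ge> 0"
    and bound: "\<And>F. finite F \<Longrightarrow> F \<inter> int_box N = {} \<Longrightarrow>
      (\<Sum>n\<in>F. \<integral>t. (norm (fourier_coeff P (v t) (wavevector P n)))\<^sup>2 \<partial>time_measure T) \<le> B"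
  shows "(\<integral>\<^sup>+t. ennreal (tail P (v t) N) \<partial>time_measure T) \<le> ennreal (tvol P * B)"
proof -
  let ?c = "\<lambda>n t. (norm (fourier_coeff P (v t) (wavevector P n)))\<^sup>2"
  let ?S = "\<lambda>j t. tvol P * (\<Sum>n\<in>int_box (N + j) - int_box N. ?c n t)"
  have int: "integrable (time_measure T) (?c n)" for n by (rule tail_measurable(3)[OF P v])
  have S: "tail P (v t) N - tail P (v t) (N + j) = ?S j t" for t j
    using sum_diff[OF finite_int_box int_box_mono[of N "N + j"], of "\<lambda>n. ?c n t"]
    by (simp add: tail_def right_diff_distrib)
  have "(\<integral>\<^sup>+t. ennreal (tail P (v t) N) \<partial>time_measure T)
      = (\<integral>\<^sup>+t. liminf (\<lambda>j. ennreal (?S j t)) \<partial>time_measure T)"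
  proof (rule nn_integral_cong)
    fix t assume "t \<in> space (time_measure T)"
    then have "in_Lp 2 (torus_measure P) (v t)" using v by (auto simp: in_C_L2w_def)
    from LIMSEQ_ignore_initial_segment[OF tail_tendsto[OF P this], of N]
    have "(\<lambda>j. tail P (v t) N - tail P (v t) (N + j)) \<longlonglongrightarrow> tail P (v t) N - 0"
      by (intro tendsto_intros) (simp add: add.commute)
    then have "(\<lambda>j. ennreal (?S j t)) \<longlonglongrightarrow> ennreal (tail P (v t) N)"
      by (intro tendsto_ennrealI) (simp add: S)
    then show "ennreal (tail P (v t) N) = liminf (\<lambda>j. ennreal (?S j t))"
      by (simp add: lim_imp_Liminf)
  qed
  also have "\<dots> \<le> liminf (\<lambda>j. \<integral>\<^sup>+t. ennreal (?S j t) \<partial>time_measure T)"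
  proof (rule nn_integral_liminf)
    fix j
    show "(\<lambda>t. ennreal (?S j t)) \<in> borel_measurable (time_measure T)"
      by (intro measurable_compose[OF _ measurable_ennreal] borel_measurable_times borel_measurable_sum
          borel_measurable_const borel_measurable_integrable[OF int])
  qed
  also have "\<dots> \<le> liminf (\<lambda>j. ennreal (tvol P * B))"
  proof (rule Liminf_mono, rule always_eventually, rule allI)
    fix j
    have "(\<integral>\<^sup>+t. ennreal (?S j t) \<partial>time_measure T) = ennreal (\<integral>t. ?S j t \<partial>time_measure T)"
      using int tvol_pos[OF P]
      by (intro nn_integral_eq_integral) (auto intro!: Bochner_Integration.integrable_sum AE_I2 mult_nonneg_nonneg sum_nonneg)
    also have "(\<integral>t. ?S j t \<partial>time_measure T) = tvol P * (\<Sum>n\<in>int_box (N + j) - int_box N. \<integral>t. ?c n t \<partial>time_measure T)"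
      using int by (simp add: Bochner_Integration.integral_sum)
    also have "\<dots> \<le> tvol P * B"
      using tvol_pos[OF P] by (intro mult_left_mono bound) (auto simp: finite_int_box)
    finally show "(\<integral>\<^sup>+t. ennreal (?S j t) \<partial>time_measure T) \<le> ennreal (tvol P * B)"
      by (simp add: ennreal_leI)
  qed
  finally show ?thesis by (simp add: Liminf_const)
qed

text \<open>The interpolation step: where \<open>2 \<Lambda>\<^sub>j < y \<le> 2 \<Lambda>\<^sub>j\<^sub>+\<^sub>1\<close>, the low frequencies, bounded by \<open>\<Lambda>\<^sub>j\<close>, account for at
  most half of \<open>y\<close>.\<close>

lemma level_decomposition:
  fixes d \<Lambda> :: "nat \<Rightarrow> real"
  assumes r: "r \<ge> 0" and y: "y \<ge> 0" and d: "\<And>j. y \<le> \<Lambda> j + d j"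
    and \<Lambda>: "filterlim \<Lambda> at_top sequentially"
  shows "ennreal (y powr (2 + r)) \<le> ennreal ((2 * \<Lambda> 0) powr r * y\<^sup>2)
    + (\<Sum>j. ennreal (4 * (2 * \<Lambda> (Suc j)) powr r) * ennreal ((d j)\<^sup>2))"
proof (cases "y \<le> 2 * \<Lambda> 0")
  case True
  have "y powr (2 + r) = y powr r * y\<^sup>2" using y by (simp add: powr_add mult.commute)
  also have "\<dots> \<le> (2 * \<Lambda> 0) powr r * y\<^sup>2"
    using True y r by (intro mult_right_mono powr_mono2) auto
  finally have "ennreal (y powr (2 + r)) \<le> ennreal ((2 * \<Lambda> 0) powr r * y\<^sup>2)" by (rule ennreal_leI)
  then show ?thesis by (rule order_trans) simp
next
  case False
  have "\<exists>j. y \<le> 2 * \<Lambda> j"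
    using eventually_happens[OF \<Lambda>[unfolded filterlim_at_top, rule_format, of "y / 2"]] by (auto simp: field_simps)
  \<comment> \<open>At the first level that reaches y, the preceding level i still has 2
    \<Lambda>(i) < y, which forces y \<le> 2 d(i).\<close>
  define j where "j = (LEAST j. y \<le> 2 * \<Lambda> j)"
  have j: "y \<le> 2 * \<Lambda> j" unfolding j_def using \<open>\<exists>j. y \<le> 2 * \<Lambda> j\<close> by (rule LeastI_ex)
  with False have "j \<noteq> 0" by metis
  then obtain i where i: "j = Suc i" by (cases j) auto
  have "\<not> y \<le> 2 * \<Lambda> i"
    using not_less_Least[of i "\<lambda>j. y \<le> 2 * \<Lambda> j"] i by (simp add: j_def[symmetric])
  then have "y \<le> 2 * d i" using d[of i] by linarith
  then have "y\<^sup>2 \<le> 4 * (d i)\<^sup>2" using power_mono[of y "2 * d i" 2] y by (simp add: power_mult_distrib)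
  have "y powr (2 + r) = y powr r * y\<^sup>2" using y by (simp add: powr_add mult.commute)
  also have "\<dots> \<le> (2 * \<Lambda> (Suc i)) powr r * (4 * (d i)\<^sup>2)"
    using j i y r \<open>y\<^sup>2 \<le> 4 * (d i)\<^sup>2\<close> by (intro mult_mono powr_mono2) auto
  finally have "ennreal (y powr (2 + r)) \<le> ennreal ((4 * (2 * \<Lambda> (Suc i)) powr r) * (d i)\<^sup>2)"
    by (intro ennreal_leI) (simp add: mult_ac)
  also have "\<dots> = ennreal (4 * (2 * \<Lambda> (Suc i)) powr r) * ennreal ((d i)\<^sup>2)"
    by (intro ennreal_mult) auto
  \<comment> \<open>A single level is relevant for each y; summing over all of them yields one
    expression in y and spares a partition of the domain into level sets.\<close>
  also have "\<dots> \<le> (\<Sum>j. ennreal (4 * (2 * \<Lambda> (Suc j)) powr r) * ennreal ((d j)\<^sup>2))"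
    using sum_le_suminf[of "\<lambda>j. ennreal (4 * (2 * \<Lambda> (Suc j)) powr r) * ennreal ((d j)\<^sup>2)" "{i}"] by simp
  finally show ?thesis by (rule order_trans) simp
qed

text \<open>The level decomposition is applied at every point, with the Fourier remainders as
  high-frequency parts. Integration turns their squares into tails, which are linear in the
  quantities that the Kolmogorov hypothesis bounds after integrating in time.\<close>

lemma slice_powr_bound:
  fixes v :: "space \<Rightarrow> space"
  assumes P: "P > 0" and v: "in_Lp 2 (torus_measure P) v"
    and K: "(\<integral>x. (norm (v x))\<^sup>2 \<partial>torus_measure P) \<le> K"
    and r: "r \<ge> 0" and \<Lambda>: "\<And>j. real (card (int_box (N j))) * sqrt (K / tvol P) \<le> \<Lambda> j"
    "filterlim \<Lambda> at_top sequentially"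
  shows "(\<integral>\<^sup>+x. ennreal (norm (v x) powr (2 + r)) \<partial>torus_measure P)
    \<le> ennreal ((2 * \<Lambda> 0) powr r * K) + (\<Sum>j. ennreal (4 * (2 * \<Lambda> (Suc j)) powr r) * ennreal (tail P v (N j)))"
proof -
  let ?M = "torus_measure P"
  let ?d = "\<lambda>j x. norm (complexify (v x) - partial_sum P v (N j) x)"
  have m: "(\<lambda>x. ennreal ((norm (v x))\<^sup>2)) \<in> borel_measurable ?M"
    and i: "integrable ?M (\<lambda>x. (norm (v x))\<^sup>2)"
    using v by (auto simp: in_Lp_2_iff)
  have di: "integrable ?M (\<lambda>x. (?d j x)\<^sup>2)" for j by (rule integrable_partial_sum_error[OF P v])
  have dm: "(\<lambda>x. ennreal ((?d j x)\<^sup>2)) \<in> borel_measurable ?M" for j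
    using borel_measurable_integrable[OF di] by simp
  have le: "norm (v x) \<le> \<Lambda> j + ?d j x" for x j
  proof -
    have "norm (complexify (v x)) \<le> norm (partial_sum P v (N j) x) + ?d j x"
      using norm_triangle_sub[of "complexify (v x)" "partial_sum P v (N j) x"] by simp
    then show ?thesis using norm_partial_sum_le[OF P v K, of "N j" x] \<Lambda>(1)[of j] by simp
  qed
  have "(\<integral>\<^sup>+x. ennreal (norm (v x) powr (2 + r)) \<partial>?M)
    \<le> (\<integral>\<^sup>+x. ennreal ((2 * \<Lambda> 0) powr r * (norm (v x))\<^sup>2)
        + (\<Sum>j. ennreal (4 * (2 * \<Lambda> (Suc j)) powr r) * ennreal ((?d j x)\<^sup>2)) \<partial>?M)"
    by (intro nn_integral_mono level_decomposition r \<Lambda>(2) le) simp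
  also have "\<dots> = (\<integral>\<^sup>+x. ennreal ((2 * \<Lambda> 0) powr r * (norm (v x))\<^sup>2) \<partial>?M)
        + (\<integral>\<^sup>+x. (\<Sum>j. ennreal (4 * (2 * \<Lambda> (Suc j)) powr r) * ennreal ((?d j x)\<^sup>2)) \<partial>?M)"
    using i by (intro nn_integral_add borel_measurable_suminf_order borel_measurable_times_ennreal borel_measurable_const dm) auto
  also have "(\<integral>\<^sup>+x. (\<Sum>j. ennreal (4 * (2 * \<Lambda> (Suc j)) powr r) * ennreal ((?d j x)\<^sup>2)) \<partial>?M)
      = (\<Sum>j. \<integral>\<^sup>+x. ennreal (4 * (2 * \<Lambda> (Suc j)) powr r) * ennreal ((?d j x)\<^sup>2) \<partial>?M)"
    by (intro nn_integral_suminf borel_measurable_times_ennreal borel_measurable_const dm)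
  also have "\<dots> = (\<Sum>j. ennreal (4 * (2 * \<Lambda> (Suc j)) powr r) * ennreal (tail P v (N j)))"
    using dm di by (simp add: nn_integral_cmult nn_integral_eq_integral integral_partial_sum_error[OF P v])
  also have "(\<integral>\<^sup>+x. ennreal ((2 * \<Lambda> 0) powr r * (norm (v x))\<^sup>2) \<partial>?M)
      = ennreal ((2 * \<Lambda> 0) powr r * (\<integral>x. (norm (v x))\<^sup>2 \<partial>?M))"
    using i by (subst nn_integral_eq_integral) auto
  also have "\<dots> \<le> ennreal ((2 * \<Lambda> 0) powr r * K)"
    using K by (intro ennreal_leI mult_left_mono) auto
  finally show ?thesis by (simp add: add_right_mono)
qed

section \<open>Tail decay and summation over dyadic levels\<close>

text \<open>An index outside the cube has norm at least N, so its wavevector has reached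
  \<open>kstar\<close> and the hypothesis covers every mode in the sum.\<close>

lemma fourier_tail_time_sum:
  assumes P: "P > 0" and \<beta>: "\<beta> > 0" and C: "C > 0"
    and K41: "\<And>k. k \<in> wavevectors P \<Longrightarrow> norm k \<ge> kstar \<Longrightarrow>
      norm k powr (3 + \<beta>) * (\<integral>t. (norm (fourier_coeff P (v t) k))\<^sup>2 \<partial>time_measure T) \<le> C"
    and CL: "\<And>N F. N \<ge> 1 \<Longrightarrow> finite F \<Longrightarrow> F \<inter> int_box N = {} \<Longrightarrow>
      (\<Sum>n\<in>F. norm (int_vec n) powr (- (3 + \<beta>))) \<le> CL * real N powr (- (\<beta> / 2))"
    and N: "N \<ge> 1" "kstar \<le> 2 * pi / P * real N" and F: "finite F" "F \<inter> int_box N = {}"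
  shows "(\<Sum>n\<in>F. \<integral>t. (norm (fourier_coeff P (v t) (wavevector P n)))\<^sup>2 \<partial>time_measure T)
    \<le> C * (2 * pi / P) powr (- (3 + \<beta>)) * CL * real N powr (- (\<beta> / 2))"
proof -
  let ?I = "\<lambda>n. \<integral>t. (norm (fourier_coeff P (v t) (wavevector P n)))\<^sup>2 \<partial>time_measure T"
  have gen: "y \<le> C * x powr (- s)" if "x powr s * y \<le> C" "x > 0" for x y s :: real
    using that by (simp add: powr_minus field_simps)
  have "?I n \<le> C * (2 * pi / P) powr (- (3 + \<beta>)) * norm (int_vec n) powr (- (3 + \<beta>))" if "n \<in> F" for n
  proof -
    have rN: "real N \<le> norm (int_vec n)" using norm_int_vec_ge F(2) that by blast
    then have pos: "norm (int_vec n) > 0" using N(1) by linarith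
    have k: "norm (wavevector P n) = 2 * pi / P * norm (int_vec n)" using P by simp
    have "2 * pi / P * real N \<le> 2 * pi / P * norm (int_vec n)"
      using P rN by (intro mult_left_mono) auto
    then have "kstar \<le> norm (wavevector P n)" unfolding k using N(2) by linarith
    moreover have "wavevector P n \<in> wavevectors P" by (auto simp: wavevectors_def int_vec_def)
    ultimately have "norm (wavevector P n) powr (3 + \<beta>) * ?I n \<le> C" using K41 by blast
    moreover have "norm (wavevector P n) > 0" unfolding k using P pos by simp
    ultimately have "?I n \<le> C * norm (wavevector P n) powr (- (3 + \<beta>))"
      by (intro gen)
    also have "norm (wavevector P n) powr (- (3 + \<beta>)) = (2 * pi / P) powr (- (3 + \<beta>)) * norm (int_vec n) powr (- (3 + \<beta>))"
      unfolding k by (intro powr_mult)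
    finally show ?thesis by (simp add: mult.assoc)
  qed
  then have "(\<Sum>n\<in>F. ?I n) \<le> (\<Sum>n\<in>F. C * (2 * pi / P) powr (- (3 + \<beta>)) * norm (int_vec n) powr (- (3 + \<beta>)))"
    by (rule sum_mono)
  also have "\<dots> = C * (2 * pi / P) powr (- (3 + \<beta>)) * (\<Sum>n\<in>F. norm (int_vec n) powr (- (3 + \<beta>)))"
    by (simp add: sum_distrib_left)
  also have "\<dots> \<le> C * (2 * pi / P) powr (- (3 + \<beta>)) * (CL * real N powr (- (\<beta> / 2)))"
    using C by (intro mult_left_mono CL N(1) F) auto
  finally show ?thesis by (simp add: mult.assoc)
qed

text \<open>Doubling the frequency multiplies the level by 8, hence its power \<beta> / 12 by 2 to
  the \<beta> / 4, while the tail bound shrinks by 2 to the -\<beta> / 2. The series is geometric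
  with ratio 2 to the -\<beta> / 4.\<close>

lemma dyadic_interpolation_sum:
  fixes a B \<beta> :: real and N1 :: nat
  assumes \<beta>: "\<beta> > 0" and a: "a > 0" and B: "B \<ge> 0"
  obtains D where "D \<ge> 0" "(\<Sum>j. ennreal (4 * (2 * (a * 8 ^ Suc j)) powr (\<beta> / 12)) *
      ennreal (B * real (N1 * 2 ^ j) powr (- (\<beta> / 2)))) \<le> ennreal D"
proof -
  define r where "r = \<beta> / 12"
  define c where "c = 4 * (16 * a) powr r * B * real N1 powr (- (\<beta> / 2))"
  define \<rho> :: real where "\<rho> = 2 powr (- (\<beta> / 4))"
  have c: "c \<ge> 0" using B by (simp add: c_def)
  have "\<rho> < 2 powr 0" unfolding \<rho>_def using \<beta> by (intro powr_less_mono) auto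
  then have \<rho>: "0 \<le> \<rho>" "\<rho> < 1" by (auto simp: \<rho>_def)
  have terms: "ennreal (4 * (2 * (a * 8 ^ Suc j)) powr r) * ennreal (B * real (N1 * 2 ^ j) powr (- (\<beta> / 2)))
      = ennreal (c * \<rho> ^ j)" for j
  proof -
    have "(2 * (a * 8 ^ Suc j)) powr r = (16 * a) powr r * (2 powr (3 * real j)) powr r"
    proof -
      have "(8::real) ^ j = 2 powr (3 * real j)"
        by (simp add: powr_realpow[symmetric] powr_powr[symmetric])
      then show ?thesis using a by (simp add: powr_mult[symmetric] mult_ac)
    qed
    moreover have "real (N1 * 2 ^ j) powr (- (\<beta> / 2)) = real N1 powr (- (\<beta> / 2)) * (2 powr real j) powr (- (\<beta> / 2))"
      by (simp add: powr_mult powr_realpow)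
    moreover have "(2 powr (3 * real j)) powr r * (2 powr real j) powr (- (\<beta> / 2)) = \<rho> ^ j"
      by (simp add: powr_powr powr_add[symmetric] \<rho>_def r_def powr_realpow[symmetric] field_simps)
    ultimately have "4 * (2 * (a * 8 ^ Suc j)) powr r * (B * real (N1 * 2 ^ j) powr (- (\<beta> / 2))) = c * \<rho> ^ j"
      by (simp add: c_def mult_ac)
    then show ?thesis using B by (subst ennreal_mult[symmetric]) auto
  qed
  have "(\<Sum>j. ennreal (c * \<rho> ^ j)) = ennreal (\<Sum>j. c * \<rho> ^ j)"
    using c \<rho> by (intro suminf_ennreal2) (auto intro: summable_mult summable_geometric)
  moreover have "0 \<le> (\<Sum>j. c * \<rho> ^ j)"
    using c \<rho> by (intro suminf_nonneg) (auto intro: summable_mult summable_geometric)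
  ultimately show thesis
    using that[of "\<Sum>j. c * \<rho> ^ j"] terms unfolding r_def by simp
qed

theorem proposition4p3:
  fixes P :: real
    and u0 :: "space \<Rightarrow> space"
    and f :: "real \<Rightarrow> space \<Rightarrow> space"
    and u :: "real \<Rightarrow> real \<Rightarrow> space \<Rightarrow> space"
    and p :: "real \<Rightarrow> real \<Rightarrow> space \<Rightarrow> real"
  assumes "P > 0"
    and "periodic P u0" and "in_Lp 2 (torus_measure P) u0"
    and "\<forall>t\<ge>0. periodic P (f t)" and "\<forall>T>0. in_Lp_Lp P T 2 2 f"
    and "\<forall>\<mu>>0. NS_weak_solution P \<mu> u0 f (u \<mu>) (p \<mu>)"
    and "K41w P u"
  shows "\<forall>T>0. \<exists>q>2. \<exists>M>0. \<forall>\<mu>>0.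
           in_L2_Lq q (lebesgue_on ({0..<T} \<times> torus P)) (\<lambda>(t, x). u \<mu> t x) \<and>
           L2_Lq_norm q (lebesgue_on ({0..<T} \<times> torus P)) (\<lambda>(t, x). u \<mu> t x) \<le> M"
proof (intro allI impI)
  fix T :: real assume T: "T > 0"
  note P = \<open>P > 0\<close>
  let ?Q = "lebesgue_on ({0..<T} \<times> torus P)"
  obtain K where K: "K \<ge> 0" "\<And>\<mu> v \<pi> \<tau>. \<mu> > 0 \<Longrightarrow> NS_weak_solution P \<mu> u0 f v \<pi> \<Longrightarrow> 0 < \<tau> \<Longrightarrow> \<tau> < T \<Longrightarrow>
       (\<integral>x. (norm (v \<tau> x))\<^sup>2 \<partial>torus_measure P) \<le> K"
    by (rule energy_bound[OF P T assms(4) assms(5)[rule_format, OF T], where ?u0.0 = u0]) (rule that)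
  obtain \<beta> where \<beta>: "\<beta> > 0" and "\<forall>T>0. \<exists>C>0. \<exists>kstar>0. \<forall>\<mu>>0.
        \<forall>k\<in>wavevectors P. norm k \<ge> kstar \<longrightarrow>
          norm k powr (3 + \<beta>) * (\<integral>t. (norm (fourier_coeff P (u \<mu> t) k))\<^sup>2 \<partial>time_measure T) \<le> C"
    using assms(7) unfolding K41w_def by blast
  from this(2)[rule_format, OF T] obtain C kstar where C: "C > 0" and "\<forall>\<mu>>0. \<forall>k\<in>wavevectors P. norm k \<ge> kstar \<longrightarrow>
      norm k powr (3 + \<beta>) * (\<integral>t. (norm (fourier_coeff P (u \<mu> t) k))\<^sup>2 \<partial>time_measure T) \<le> C"
    by (elim exE conjE)
  note K41 = this(2)[rule_format]
  obtain CL where CL: "CL \<ge> 0" "\<And>N F. N \<ge> 1 \<Longrightarrow> finite F \<Longrightarrow> F \<inter> int_box N = {} \<Longrightarrow>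
    (\<Sum>n\<in>F. norm (int_vec n) powr (- (3 + \<beta>))) \<le> CL * real N powr (- (\<beta> / 2))"
    by (rule lattice_tail_bound[OF \<beta>]) (rule that)
  \<comment> \<open>Even the smallest cube contains all frequencies below \<open>kstar\<close>,
    about which the hypothesis says nothing; the energy bound alone handles them.\<close>
  obtain N0 :: nat where N0: "kstar * P / (2 * pi) \<le> real N0" using real_arch_simple by blast
  define N1 where "N1 = Suc N0"
  define N where "N = (\<lambda>j. N1 * 2 ^ j)"
  have N: "N j \<ge> 1" "kstar \<le> 2 * pi / P * real (N j)" for j
  proof -
    have "N1 * 1 \<le> N j" unfolding N_def by (intro mult_le_mono2) simp
    then have le: "real N0 \<le> real (N j)" and "N j \<ge> 1" by (auto simp: N1_def)
    then show "N j \<ge> 1" by simp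
    have "kstar = 2 * pi / P * (kstar * P / (2 * pi))" using P by simp
    also have "\<dots> \<le> 2 * pi / P * real (N j)"
      using P order_trans[OF N0 le] by (intro mult_left_mono) auto
    finally show "kstar \<le> 2 * pi / P * real (N j)" .
  qed
  define B where "B = C * (2 * pi / P) powr (- (3 + \<beta>)) * CL"
  have B: "B \<ge> 0" using C CL(1) by (simp add: B_def)
  \<comment> \<open>The summand 1 keeps \<open>a\<close> positive when K = 0, so that the levels
    still tend to infinity.\<close>
  define a where "a = 27 * real N1 ^ 3 * sqrt (K / tvol P) + 1"
  have a: "a > 0" unfolding a_def using K(1) tvol_pos[OF P] by (intro add_nonneg_pos) auto
  define \<Lambda> where "\<Lambda> = (\<lambda>j. a * 8 ^ j)"
  have \<Lambda>: "real (card (int_box (N j))) * sqrt (K / tvol P) \<le> \<Lambda> j" for j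
  proof -
    have "real (card (int_box (N j))) \<le> real (27 * N j ^ 3)"
      using card_int_box_le[OF N(1)] of_nat_mono by blast
    also have "\<dots> = 27 * real N1 ^ 3 * 8 ^ j"
      by (simp add: N_def power_mult_distrib power_mult[symmetric] mult.commute[of _ 3] power_mult)
    finally have "real (card (int_box (N j))) * sqrt (K / tvol P) \<le> (27 * real N1 ^ 3 * 8 ^ j) * sqrt (K / tvol P)"
      using K(1) tvol_pos[OF P] by (intro mult_right_mono) auto
    also have "\<dots> = (27 * real N1 ^ 3 * sqrt (K / tvol P)) * 8 ^ j" by simp
    also have "\<dots> \<le> \<Lambda> j" unfolding \<Lambda>_def a_def by (intro mult_right_mono) auto
    finally show ?thesis .
  qed
  have \<Lambda>_top: "filterlim \<Lambda> at_top sequentially"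
    unfolding \<Lambda>_def using a
    by (intro filterlim_tendsto_pos_mult_at_top[OF tendsto_const]
        filterlim_at_infinity_imp_filterlim_at_top[OF filterlim_realpow_sequentially_gt1]) auto
  define r where "r = \<beta> / 12"
  have r: "r > 0" using \<beta> by (simp add: r_def)
  obtain D where D: "D \<ge> 0" "(\<Sum>j. ennreal (4 * (2 * \<Lambda> (Suc j)) powr r) *
      ennreal (tvol P * B * real (N j) powr (- (\<beta> / 2)))) \<le> ennreal D"
    unfolding \<Lambda>_def N_def r_def
    using dyadic_interpolation_sum[OF \<beta> a, of "tvol P * B" N1] B tvol_pos[OF P] by auto
  \<comment> \<open>The first term comes from points below the lowest level, where the extra power r
    is bounded and the energy is integrated over time; \<open>D\<close> collects all higher
    levels.\<close>
  define E where "E = T * ((2 * \<Lambda> 0) powr r * K) + D"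
  have E: "E \<ge> 0" using T K(1) D(1) by (simp add: E_def)
  have bounds: "in_Lp 2 ?Q (\<lambda>(t, x). u \<mu> t x) \<and> (\<integral>z. norm (case z of (t, x) \<Rightarrow> u \<mu> t x) powr 2 \<partial>?Q) \<le> T * K \<and>
      in_Lp (2 + r) ?Q (\<lambda>(t, x). u \<mu> t x) \<and> (\<integral>z. norm (case z of (t, x) \<Rightarrow> u \<mu> t x) powr (2 + r) \<partial>?Q) \<le> E"
    if \<mu>: "\<mu> > 0" for \<mu>
  proof -
    let ?v = "u \<mu>"
    have NS: "NS_weak_solution P \<mu> u0 f ?v (p \<mu>)" using assms(6) \<mu> by blast
    have vw: "in_C_L2w P T ?v" and v2: "in_Lp_Lp P T 2 2 ?v"
      using NS T by (auto simp: NS_weak_solution_def in_L2_H1_def)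
    have m: "(\<lambda>(t, x). ?v t x) \<in> borel_measurable ?Q"
      using in_Lp_Lp_2_measurable[OF v2] by (simp add: case_prod_beta')
    have L: "in_Lp 2 (torus_measure P) (?v t)" if "t \<in> space (time_measure T)" for t
      using vw that by (auto simp: in_C_L2w_def)
    have e: "(\<integral>x. (norm (?v t x))\<^sup>2 \<partial>torus_measure P) \<le> K" if "t \<in> space (time_measure T)" for t
      using K(2)[OF \<mu> NS] that by auto
    have fubini: "(\<integral>\<^sup>+z. ennreal (norm (case z of (t, x) \<Rightarrow> ?v t x) powr s) \<partial>?Q)
        = (\<integral>\<^sup>+t. \<integral>\<^sup>+x. ennreal (norm (?v t x) powr s) \<partial>torus_measure P \<partial>time_measure T)" for s
    proof -
      have "(\<lambda>z. ennreal (norm (case z of (t, x) \<Rightarrow> ?v t x) powr s)) \<in> borel_measurable ?Q"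
        using m by measurable
      then show ?thesis
        by (subst nn_integral_lebesgue_on_pair) (simp_all add: nn_integral_initial_time)
    qed
    have time: "(\<integral>\<^sup>+t. ennreal c \<partial>time_measure T) = ennreal (T * c)" if "c \<ge> 0" for c
      using T that by (simp add: emeasure_restrict_space ennreal_mult[symmetric] mult.commute)
    have "(\<integral>\<^sup>+t. \<integral>\<^sup>+x. ennreal (norm (?v t x) powr 2) \<partial>torus_measure P \<partial>time_measure T)
        \<le> (\<integral>\<^sup>+t. ennreal K \<partial>time_measure T)"
    proof (rule nn_integral_mono)
      fix t assume t: "t \<in> space (time_measure T)"
      have "(\<integral>\<^sup>+x. ennreal (norm (?v t x) powr 2) \<partial>torus_measure P) = ennreal (\<integral>x. (norm (?v t x))\<^sup>2 \<partial>torus_measure P)"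
        using L[OF t] by (simp add: in_Lp_2_iff nn_integral_eq_integral)
      then show "(\<integral>\<^sup>+x. ennreal (norm (?v t x) powr 2) \<partial>torus_measure P) \<le> ennreal K"
        using e[OF t] by (simp add: ennreal_leI)
    qed
    then have b2: "(\<integral>\<^sup>+z. ennreal (norm (case z of (t, x) \<Rightarrow> ?v t x) powr 2) \<partial>?Q) \<le> ennreal (T * K)"
      using time[OF K(1)] by (simp only: fubini)
    let ?w = "\<lambda>j. ennreal (4 * (2 * \<Lambda> (Suc j)) powr r)"
    have tm: "(\<lambda>t. ennreal (tail P (?v t) n)) \<in> borel_measurable (time_measure T)" for n
      using tail_measurable(1)[OF P vw] by simp
    have "(\<integral>\<^sup>+t. \<integral>\<^sup>+x. ennreal (norm (?v t x) powr (2 + r)) \<partial>torus_measure P \<partial>time_measure T)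
        \<le> (\<integral>\<^sup>+t. ennreal ((2 * \<Lambda> 0) powr r * K) + (\<Sum>j. ?w j * ennreal (tail P (?v t) (N j))) \<partial>time_measure T)"
      using r by (intro nn_integral_mono slice_powr_bound[OF P L e _ \<Lambda> \<Lambda>_top]) auto
    also have "\<dots> = (\<integral>\<^sup>+t. ennreal ((2 * \<Lambda> 0) powr r * K) \<partial>time_measure T)
        + (\<integral>\<^sup>+t. (\<Sum>j. ?w j * ennreal (tail P (?v t) (N j))) \<partial>time_measure T)"
      by (intro nn_integral_add borel_measurable_suminf_order borel_measurable_times_ennreal borel_measurable_const tm)
    also have "(\<integral>\<^sup>+t. (\<Sum>j. ?w j * ennreal (tail P (?v t) (N j))) \<partial>time_measure T)
        = (\<Sum>j. ?w j * (\<integral>\<^sup>+t. ennreal (tail P (?v t) (N j)) \<partial>time_measure T))"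
      using tm by (subst nn_integral_suminf) (auto intro!: borel_measurable_times_ennreal simp: nn_integral_cmult)
    also have "\<dots> \<le> (\<Sum>j. ?w j * ennreal (tvol P * B * real (N j) powr (- (\<beta> / 2))))"
    proof (intro suminf_le mult_left_mono)
      fix j
      show "(\<integral>\<^sup>+t. ennreal (tail P (?v t) (N j)) \<partial>time_measure T) \<le> ennreal (tvol P * B * real (N j) powr (- (\<beta> / 2)))"
        unfolding B_def mult.assoc[of "tvol P"]
        by (intro tail_time_integral[OF P vw] fourier_tail_time_sum[OF P \<beta> C K41[OF \<mu>] CL(2) N])
          (use C CL(1) in auto)
    qed auto
    also note D(2)
    also have "(\<integral>\<^sup>+t. ennreal ((2 * \<Lambda> 0) powr r * K) \<partial>time_measure T) + ennreal D = ennreal E"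
      using time[of "(2 * \<Lambda> 0) powr r * K"] K(1) T D(1) by (simp add: E_def ennreal_plus)
    finally have bq: "(\<integral>\<^sup>+z. ennreal (norm (case z of (t, x) \<Rightarrow> ?v t x) powr (2 + r)) \<partial>?Q) \<le> ennreal E"
      by (simp only: fubini add_left_mono)
    show ?thesis
      using in_Lp_nn_integral_le[OF m b2] in_Lp_nn_integral_le[OF m bq E] T K(1) by simp
  qed
  \<comment> \<open>The summand 1 makes the bound strictly positive even if both norms
    vanish.\<close>
  define M where "M = max ((T * K) powr (1 / 2)) (E powr (1 / (2 + r))) + 1"
  show "\<exists>q>2. \<exists>M>0. \<forall>\<mu>>0. in_L2_Lq q ?Q (\<lambda>(t, x). u \<mu> t x) \<and> L2_Lq_norm q ?Q (\<lambda>(t, x). u \<mu> t x) \<le> M"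
  proof (intro exI conjI allI impI)
    show "2 + r > 2" using r by simp
    show "M > 0" unfolding M_def by (intro add_nonneg_pos) (auto simp: max_def)
    fix \<mu> :: real assume "\<mu> > 0"
    note b = bounds[OF this]
    show "in_L2_Lq (2 + r) ?Q (\<lambda>(t, x). u \<mu> t x)" using b by (simp add: in_L2_Lq_def)
    have "Lp_norm 2 ?Q (\<lambda>(t, x). u \<mu> t x) \<le> (T * K) powr (1 / 2)"
      unfolding Lp_norm_def using b by (intro powr_mono2) auto
    moreover have "Lp_norm (2 + r) ?Q (\<lambda>(t, x). u \<mu> t x) \<le> E powr (1 / (2 + r))"
      unfolding Lp_norm_def using b r by (intro powr_mono2) auto
    ultimately show "L2_Lq_norm (2 + r) ?Q (\<lambda>(t, x). u \<mu> t x) \<le> M"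
      by (auto simp: L2_Lq_norm_def M_def)
  qed
qed

end
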